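(* Let $r\geq 3$, $k\geq 1$, $p\geq 0$, $\ell_1,\dots,\ell_k\geq 5$ be integers, and if $p\geq 1$ let $t_1,\dots,t_p\geq 2$ be integers. Let $s\geq r$ be an integer and $t=\sum_{i=1}^k\lfloor\frac{\ell_i+1}{2}\rfloor+p-1$. Suppose either $Q_i=P_{\ell_i}^r$ for all $i\in[k]$, or $Q_i=C_{\ell_i}^r$ for all $i\in[k]$. Let $n\to\infty$. (i) If $s\leq t+r-1$, then $$\mathrm{ex}_r(n,K_s^{(r)},Q_1\cup\cdots\cup Q_k\cup S^r_{t_1}\cup\cdots\cup S^r_{t_p})=(1+o(1))\,\mathcal{N}(K_s^{(r)},S_{n,t}^r)=\binom{t}{s-r+1}\frac{n^{r-1}}{(r-1)!}+o(n^{r-1}).$$ (ii) If $s\geq t+r$, then $\mathrm{ex}_r(n,K_s^{(r)},Q_1\cup\cdots\cup Q_k\cup S^r_{t_1}\cup\cdots\cup S^r_{t_p})=o(n^{r-1})$.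
   Context: An $r$-graph is a hypergraph all of whose hyperedges have exactly $r$ vertices. $K_s^{(r)}$ is the complete $r$-graph on $s$ vertices. $P_\ell$, $C_\ell$, $S_\ell$ are the path, cycle and star with $\ell$ edges. For a graph $F$, the $r$-expansion $F^r$ is obtained from $F$ by adding $r-2$ new vertices to each edge, all new vertices distinct from each other and from $V(F)$. $\cup$ denotes vertex-disjoint union (when $p=0$ there are no star components). $S_{n,t}^r$ is the $n$-vertex $r$-graph whose hyperedges are all $r$-sets intersecting a fixed set of $t$ vertices. $\mathcal{N}(\mathcal{G}_1,\mathcal{G}_2)$ is the number of copies of $\mathcal{G}_1$ in $\mathcal{G}_2$. $\mathrm{ex}_r(n,\mathcal{H},\mathcal{F})$ is the maximum number of copies of $\mathcal{H}$ in an $n$-vertex $r$-graph containing no copy of $\mathcal{F}$. *)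

theory Defs
  imports Complex_Main "HOL-Library.Landau_Symbols"
begin

datatype 'a hypergraph = Hypergraph (verts: "'a set") (edges: "'a set set")

definition wf_hypergraph :: "'a hypergraph \<Rightarrow> bool" where
  "wf_hypergraph G \<longleftrightarrow> finite (verts G) \<and> (\<forall>e\<in>edges G. e \<subseteq> verts G)"

definition r_graph :: "nat \<Rightarrow> 'a hypergraph \<Rightarrow> bool" where
  "r_graph r G \<longleftrightarrow> wf_hypergraph G \<and> (\<forall>e\<in>edges G. card e = r)"

definition sub_hypergraph :: "'a hypergraph \<Rightarrow> 'a hypergraph \<Rightarrow> bool" where
  "sub_hypergraph H G \<longleftrightarrow> wf_hypergraph H \<and> verts H \<subseteq> verts G \<and> edges H \<subseteq> edges G"

definition hypergraph_iso :: "'a hypergraph \<Rightarrow> 'b hypergraph \<Rightarrow> bool" where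
  "hypergraph_iso G H \<longleftrightarrow>
     (\<exists>f. bij_betw f (verts G) (verts H) \<and> (\<lambda>e. f ` e) ` edges G = edges H)"

text \<open>A copy of \<open>H\<close> in \<open>G\<close> is a (not necessarily induced) subhypergraph of \<open>G\<close> isomorphic to \<open>H\<close>.\<close>

definition copies :: "'a hypergraph \<Rightarrow> 'b hypergraph \<Rightarrow> 'b hypergraph set" where
  "copies H G = {H'. sub_hypergraph H' G \<and> hypergraph_iso H H'}"

definition num_copies :: "'a hypergraph \<Rightarrow> 'b hypergraph \<Rightarrow> nat" where
  "num_copies H G = card (copies H G)"

text \<open>The maximum is over a finite set, since the number of subhypergraphs of an \<open>n\<close>-vertex
  hypergraph is bounded in terms of \<open>n\<close>; the set is nonempty whenever \<open>F\<close> has an edge, because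
  the edgeless hypergraph on \<open>n\<close> vertices then contains no copy of \<open>F\<close>. Every finite
  hypergraph is isomorphic to one with vertices of type \<^typ>\<open>nat\<close>.\<close>

definition gen_turan :: "nat \<Rightarrow> nat \<Rightarrow> 'a hypergraph \<Rightarrow> 'b hypergraph \<Rightarrow> nat" where
  "gen_turan r n H F =
     Max {num_copies H G | G :: nat hypergraph. r_graph r G \<and> card (verts G) = n \<and> copies F G = {}}"

definition complete_r_graph :: "nat \<Rightarrow> nat \<Rightarrow> nat hypergraph" where
  "complete_r_graph r s = Hypergraph {..<s} {e. e \<subseteq> {..<s} \<and> card e = r}"

definition path_graph :: "nat \<Rightarrow> nat hypergraph" where
  "path_graph l = Hypergraph {..l} ((\<lambda>i. {i, Suc i}) ` {..<l})"

text \<open>For \<open>l \<ge> 3\<close> this is the cycle with \<open>l\<close> edges.\<close>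

definition cycle_graph :: "nat \<Rightarrow> nat hypergraph" where
  "cycle_graph l = Hypergraph {..<l} ((\<lambda>i. {i, Suc i mod l}) ` {..<l})"

definition star_graph :: "nat \<Rightarrow> nat hypergraph" where
  "star_graph l = Hypergraph {..l} ((\<lambda>i. {0, i}) ` {1..l})"

text \<open>\<open>Inl v\<close> is an original vertex, \<open>Inr (e, j)\<close> is the \<open>j\<close>-th new vertex of the edge \<open>e\<close>.\<close>

definition expansion :: "nat \<Rightarrow> 'a hypergraph \<Rightarrow> ('a + 'a set \<times> nat) hypergraph" where
  "expansion r F =
     Hypergraph (Inl ` verts F \<union> Inr ` (edges F \<times> {..<r - 2}))
                ((\<lambda>e. Inl ` e \<union> Inr ` ({e} \<times> {..<r - 2})) ` edges F)"

definition disjoint_union :: "'a hypergraph \<Rightarrow> 'b hypergraph \<Rightarrow> ('a + 'b) hypergraph" where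
  "disjoint_union G H =
     Hypergraph (Inl ` verts G \<union> Inr ` verts H)
                ((\<lambda>e. Inl ` e) ` edges G \<union> (\<lambda>e. Inr ` e) ` edges H)"

definition disjoint_Union :: "'i set \<Rightarrow> ('i \<Rightarrow> 'a hypergraph) \<Rightarrow> ('i \<times> 'a) hypergraph" where
  "disjoint_Union I H =
     Hypergraph (SIGMA i:I. verts (H i)) (\<Union>i\<in>I. (\<lambda>e. Pair i ` e) ` edges (H i))"

text \<open>The hypergraph \<open>S\<^sub>n\<^sub>,\<^sub>t\<^sup>r\<close> (with fixed \<open>t\<close>-set \<open>{..<t}\<close>, meaningful for \<open>n \<ge> t\<close>).\<close>

definition S_graph :: "nat \<Rightarrow> nat \<Rightarrow> nat \<Rightarrow> nat hypergraph" where
  "S_graph r n t =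
     Hypergraph {..<n} {e. e \<subseteq> {..<n} \<and> card e = r \<and> e \<inter> {..<t} \<noteq> {}}"

end

theory Submission imports Defs "HOL-Library.FuncSet" "HOL-Library.Ramsey"
begin

text \<open>The lower bound holds because every vertex lies in at most two edges of an expanded path or
  cycle, so that no \<open>t\<close> vertices cover the forbidden hypergraph.

  For the upper bound, repeatedly delete the \<open>s\<close>-cliques through an \<open>(r - 1)\<close>-set that lies in at most
  \<open>t choose (s - r + 1)\<close> of the remaining ones. This accounts for the main term, and in the \<open>r\<close>-graph
  spanned by the surviving cliques every \<open>(r - 1)\<close>-set of the shadow has at least \<open>t + 1\<close> extensions.
  If the shadow had positive density, it would contain a large complete \<open>(r - 1)\<close>-partite grid. Regard
  the \<open>t + 1\<close> extensions of a transversal as colours; by Ramsey's theorem each of them may be assumed,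
  for every coordinate, to be either independent of it or to determine it. If at least \<open>t\<close> colours are
  constant, their values serve as the cover of all but one or two edges of a copy of the forbidden
  hypergraph, and the last colour supplies those edges. Otherwise the nonconstant colours link the
  vertices of one part by loose paths of lengths two and three, which combine to cycles of all lengths.
  Hence the shadow is sparse; a second deletion with a large threshold bounds the number of surviving
  cliques by a constant times the size of the shadow, since a hypergraph in which all extension numbers
  are large contains every expansion needed.\<close>

section \<open>Embeddings and loose paths\<close>


text \<open>The number \<open>t + 1\<close> occurs twice for related reasons. It bounds the covering
  number of the forbidden hypergraph from below: a path or cycle with \<open>l\<close> edges needs
  \<open>(l + 1) div 2\<close> vertices, a star needs one. It is also the number of extensions that
  the first deletion guarantees: if the cliques through an \<open>(r - 1)\<close>-set used only
  \<open>t\<close> further vertices, each clique would be determined by \<open>s - r + 1\<close> of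
  them, whence the threshold. Grids are needed because extensions of different sets may coincide in
  uncontrolled ways. On a homogeneous grid a nonconstant colour can be kept off any bounded set by
  the choice of the transversal; a constant one cannot. Odd cycles arise as a link of length three
  closed by at least one link of length two, hence from length 5 on. The delicate case is
  \<open>r = 3\<close>: a transversal has only two vertices, a colour may be tied to one of them,
  and extensions of extensions are used to change the parity.\<close>

lemma Int_eq_singleton_iff: "A \<inter> B = {b} \<longleftrightarrow> b \<in> A \<and> b \<in> B \<and> (\<forall>x\<in>A. x \<in> B \<longrightarrow> x = b)"
  by auto

text \<open>The target is a bare edge family with a set \<open>S\<close> containing the image, so
  that disjoint components can be assembled by comparing the sets \<open>S\<close> alone.\<close>

definition embeds :: "'b set set \<Rightarrow> 'a hypergraph \<Rightarrow> 'b set \<Rightarrow> bool" where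
  "embeds E H S \<longleftrightarrow> (\<exists>f. inj_on f (verts H) \<and> f ` verts H \<subseteq> S \<and> (\<forall>e\<in>edges H. f ` e \<in> E))"

lemma embeds_mono: "embeds E H S \<Longrightarrow> E \<subseteq> E' \<Longrightarrow> S \<subseteq> S' \<Longrightarrow> embeds E' H S'"
  unfolding embeds_def by (meson order_trans subsetD)

lemma copies_nonempty_iff:
  assumes "wf_hypergraph H"
  shows "copies H G \<noteq> {} \<longleftrightarrow> embeds (edges G) H (verts G)"
proof
  assume "copies H G \<noteq> {}"
  then obtain H' f where H': "sub_hypergraph H' G" "bij_betw f (verts H) (verts H')"
      "(\<lambda>e. f ` e) ` edges H = edges H'"
    unfolding copies_def hypergraph_iso_def by auto
  then have "inj_on f (verts H) \<and> f ` verts H \<subseteq> verts G \<and> (\<forall>e\<in>edges H. f ` e \<in> edges G)"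
    unfolding sub_hypergraph_def bij_betw_def by auto
  then show "embeds (edges G) H (verts G)"
    unfolding embeds_def by (rule exI[of _ f])
next
  assume "embeds (edges G) H (verts G)"
  then obtain f where f: "inj_on f (verts H)" "f ` verts H \<subseteq> verts G" "\<forall>e\<in>edges H. f ` e \<in> edges G"
    unfolding embeds_def by auto
  define H' where "H' = Hypergraph (f ` verts H) ((\<lambda>e. f ` e) ` edges H)"
  have "wf_hypergraph H'" "verts H' \<subseteq> verts G" "edges H' \<subseteq> edges G"
    using assms f unfolding wf_hypergraph_def H'_def by (auto intro!: imageI)
  moreover have "hypergraph_iso H H'"
    unfolding hypergraph_iso_def H'_def using f by (auto simp: bij_betw_def)
  ultimately have "H' \<in> copies H G"
    unfolding copies_def sub_hypergraph_def by blast
  then show "copies H G \<noteq> {}" by blast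
qed

lemma embeds_disjoint_union:
  assumes "embeds E H1 S1" "embeds E H2 S2" "S1 \<inter> S2 = {}"
  shows "embeds E (disjoint_union H1 H2) (S1 \<union> S2)"
proof -
  obtain f where f: "inj_on f (verts H1)" "f ` verts H1 \<subseteq> S1" "\<forall>e\<in>edges H1. f ` e \<in> E"
    using assms unfolding embeds_def by auto
  obtain g where g: "inj_on g (verts H2)" "g ` verts H2 \<subseteq> S2" "\<forall>e\<in>edges H2. g ` e \<in> E"
    using assms unfolding embeds_def by auto
  show ?thesis unfolding embeds_def
  proof (intro exI[of _ "case_sum f g"] conjI)
    show "inj_on (case_sum f g) (verts (disjoint_union H1 H2))"
    proof (rule inj_onI)
      fix x y assume xy: "x \<in> verts (disjoint_union H1 H2)" "y \<in> verts (disjoint_union H1 H2)"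
        "case_sum f g x = case_sum f g y"
      have "f u \<noteq> g w" if "u \<in> verts H1" "w \<in> verts H2" for u w
        using f(2) g(2) assms(3) that by (metis disjoint_iff image_subset_iff)
      then show "x = y" using xy f(1) g(1) unfolding disjoint_union_def
        by (cases x; cases y) (auto dest: inj_onD, metis)
    qed
    show "case_sum f g ` verts (disjoint_union H1 H2) \<subseteq> S1 \<union> S2"
      using f g unfolding disjoint_union_def by auto
    show "\<forall>e\<in>edges (disjoint_union H1 H2). case_sum f g ` e \<in> E"
      using f g unfolding disjoint_union_def by (auto simp: image_image)
  qed
qed

lemma embeds_disjoint_Union:
  assumes "\<And>i. i \<in> I \<Longrightarrow> embeds E (H i) (S i)" "\<And>i j. i \<in> I \<Longrightarrow> j \<in> I \<Longrightarrow> i \<noteq> j \<Longrightarrow> S i \<inter> S j = {}"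
  shows "embeds E (disjoint_Union I H) (\<Union>i\<in>I. S i)"
proof -
  have "\<forall>i\<in>I. \<exists>f. inj_on f (verts (H i)) \<and> f ` verts (H i) \<subseteq> S i \<and> (\<forall>e\<in>edges (H i). f ` e \<in> E)"
    using assms unfolding embeds_def by simp
  then obtain f where f: "\<And>i. i \<in> I \<Longrightarrow> inj_on (f i) (verts (H i))"
      "\<And>i. i \<in> I \<Longrightarrow> f i ` verts (H i) \<subseteq> S i" "\<And>i e. i \<in> I \<Longrightarrow> e \<in> edges (H i) \<Longrightarrow> f i ` e \<in> E"
    by metis
  show ?thesis unfolding embeds_def
  proof (intro exI[of _ "\<lambda>(i, x). f i x"] conjI)
    show "inj_on (\<lambda>(i, x). f i x) (verts (disjoint_Union I H))"
    proof (rule inj_onI, clarsimp simp: disjoint_Union_def)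
      fix i x j y
      assume *: "f i x = f j y" "i \<in> I" "x \<in> verts (H i)" "j \<in> I" "y \<in> verts (H j)"
      then have "f i x \<in> S i \<inter> S j" using f(2) by fastforce
      then have "i = j" using assms(2) * by blast
      then show "i = j \<and> x = y" using * f(1) by (auto dest: inj_onD)
    qed
    show "(\<lambda>(i, x). f i x) ` verts (disjoint_Union I H) \<subseteq> (\<Union>i\<in>I. S i)"
      using f(2) unfolding disjoint_Union_def by force
    show "\<forall>e\<in>edges (disjoint_Union I H). (\<lambda>(i, x). f i x) ` e \<in> E"
      using f(3) unfolding disjoint_Union_def by (auto simp: image_image)
  qed
qed

text \<open>Outside the images of the original vertices the host edges \<open>\<eta> i\<close> are
  pairwise disjoint, and each has exactly \<open>r - 2\<close> vertices there; these serve as the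
  new vertices of the expanded edge. Indexing by \<open>I\<close> lets \<open>\<eta>\<close> be a
  function of the position along a path or cycle.\<close>

lemma embeds_expansion:
  assumes ed: "edges H = \<epsilon> ` I" "inj_on \<epsilon> I"
    and \<epsilon>: "\<And>i. i \<in> I \<Longrightarrow> \<epsilon> i \<subseteq> verts H" "\<And>i. i \<in> I \<Longrightarrow> card (\<epsilon> i) = 2"
    and \<phi>: "inj_on \<phi> (verts H)"
    and \<eta>: "\<And>i. i \<in> I \<Longrightarrow> \<eta> i \<in> E" "\<And>i. i \<in> I \<Longrightarrow> card (\<eta> i) = r"
      "\<And>i. i \<in> I \<Longrightarrow> \<eta> i \<inter> \<phi> ` verts H = \<phi> ` \<epsilon> i"
      "\<And>i j. i \<in> I \<Longrightarrow> j \<in> I \<Longrightarrow> i \<noteq> j \<Longrightarrow> \<eta> i \<inter> \<eta> j \<subseteq> \<phi> ` verts H"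
    and r: "r \<ge> 2"
  shows "embeds E (expansion r H) (\<phi> ` verts H \<union> (\<Union>i\<in>I. \<eta> i))"
proof -
  have "\<exists>g. bij_betw g {..<r - 2} (\<eta> i - \<phi> ` \<epsilon> i)" if i: "i \<in> I" for i
  proof -
    have fin: "finite (\<eta> i)" using \<eta>(2)[OF i] r by (intro card_ge_0_finite) simp
    have "card (\<phi> ` \<epsilon> i) = 2"
      using card_image inj_on_subset[OF \<phi> \<epsilon>(1)[OF i]] \<epsilon>(2)[OF i] by metis
    moreover have "\<phi> ` \<epsilon> i \<subseteq> \<eta> i" using \<eta>(3)[OF i] by blast
    ultimately have "card (\<eta> i - \<phi> ` \<epsilon> i) = r - 2"
      using \<eta>(2)[OF i] fin by (simp add: card_Diff_subset finite_subset)
    then show ?thesis using fin by (metis bij_betw_iff_card card_lessThan finite_Diff finite_lessThan)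
  qed
  then obtain g where g: "\<And>i. i \<in> I \<Longrightarrow> bij_betw (g i) {..<r - 2} (\<eta> i - \<phi> ` \<epsilon> i)" by metis
  have g_in: "g i j \<in> \<eta> i" "g i j \<notin> \<phi> ` verts H" if "i \<in> I" "j < r - 2" for i j
    using g[OF that(1)] that \<eta>(3)[OF that(1)] unfolding bij_betw_def by blast+
  \<comment> \<open>A new vertex is labelled by its edge; \<open>inv_into\<close> recovers the index
    of that edge.\<close>
  define f where "f = case_sum \<phi> (\<lambda>(e, j). g (inv_into I \<epsilon> e) j)"
  have f1: "f (Inl v) = \<phi> v" for v by (simp add: f_def)
  have f2: "f (Inr (\<epsilon> i, j)) = g i j" if "i \<in> I" for i j
    using that ed(2) by (simp add: f_def)
  have V: "verts (expansion r H) = Inl ` verts H \<union> Inr ` (\<epsilon> ` I \<times> {..<r - 2})"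
    by (simp add: expansion_def ed)
  have g_inj: "i = i' \<and> j = j'" if "i \<in> I" "j < r - 2" "i' \<in> I" "j' < r - 2" "g i j = g i' j'" for i j i' j'
  proof -
    have "i = i'"
      using g_in[of i j] g_in[of i' j'] \<eta>(4)[of i i'] that by auto
    then show ?thesis using g[OF that(1)] that unfolding bij_betw_def inj_on_def by blast
  qed
  show ?thesis unfolding embeds_def
  proof (intro exI[of _ f] conjI)
    show "inj_on f (verts (expansion r H))"
      unfolding inj_on_def V
    proof (intro ballI impI)
      fix x y
      assume x: "x \<in> Inl ` verts H \<union> Inr ` (\<epsilon> ` I \<times> {..<r - 2})"
        and y: "y \<in> Inl ` verts H \<union> Inr ` (\<epsilon> ` I \<times> {..<r - 2})" and xy: "f x = f y"
      from x consider (l) v where "x = Inl v" "v \<in> verts H"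
        | (r) i j where "x = Inr (\<epsilon> i, j)" "i \<in> I" "j < r - 2" by blast
      note cx = this
      from y consider (l) v where "y = Inl v" "v \<in> verts H"
        | (r) i j where "y = Inr (\<epsilon> i, j)" "i \<in> I" "j < r - 2" by blast
      note cy = this
      show "x = y"
      proof (cases rule: cx)
        case (l v)
        note xl = l
        show ?thesis
        proof (cases rule: cy)
          case (l w)
          then show ?thesis using xl xy \<phi> by (auto simp: f1 dest: inj_onD)
        next
          case (r i j)
          then show ?thesis using xl xy g_in(2)[of i j] by (metis f1 f2 imageI)
        qed
      next
        case (r i j)
        note xr = r
        show ?thesis
        proof (cases rule: cy)
          case (l w)
          then show ?thesis using xr xy g_in(2)[of i j] by (metis f1 f2 imageI)
        next
          case (r i' j')
          then show ?thesis using xr xy g_inj[of i j i' j'] by (auto simp: f2)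
        qed
      qed
    qed
    show "f ` verts (expansion r H) \<subseteq> \<phi> ` verts H \<union> (\<Union>i\<in>I. \<eta> i)"
      unfolding V using g_in(1) by (auto simp: f1 f2)
    show "\<forall>e\<in>edges (expansion r H). f ` e \<in> E"
    proof
      fix e assume "e \<in> edges (expansion r H)"
      then obtain i where i: "i \<in> I" and e: "e = Inl ` \<epsilon> i \<union> Inr ` ({\<epsilon> i} \<times> {..<r - 2})"
        by (auto simp: expansion_def ed)
      have "f ` e = \<phi> ` \<epsilon> i \<union> g i ` {..<r - 2}"
        unfolding e image_Un image_image f1 using f2[OF i] by (auto simp: image_iff)
      also have "\<dots> = \<eta> i" using g[OF i] \<eta>(3)[OF i] unfolding bij_betw_def by blast
      finally show "f ` e \<in> E" using \<eta>(1)[OF i] by simp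
    qed
  qed
qed

section \<open>Loose paths and loose cycles\<close>

inductive lpath :: "'a set set \<Rightarrow> nat \<Rightarrow> 'a \<Rightarrow> 'a \<Rightarrow> 'a set \<Rightarrow> bool" for E where
  single: "e \<in> E \<Longrightarrow> a \<in> e \<Longrightarrow> b \<in> e \<Longrightarrow> a \<noteq> b \<Longrightarrow> lpath E (Suc 0) a b e"
| step: "e \<in> E \<Longrightarrow> a \<in> e \<Longrightarrow> a \<noteq> b \<Longrightarrow> e \<inter> S = {b} \<Longrightarrow> lpath E n b c S \<Longrightarrow> lpath E (Suc n) a c (e \<union> S)"

lemma lpath_ends: "lpath E n a b S \<Longrightarrow> a \<in> S \<and> b \<in> S \<and> a \<noteq> b \<and> n \<ge> 1"
  by (induction rule: lpath.induct) auto

lemma lpath_finite: "lpath E n a b S \<Longrightarrow> (\<And>e. e \<in> E \<Longrightarrow> finite e) \<Longrightarrow> finite S"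
  by (induction rule: lpath.induct) auto

lemma lpath_card: "lpath E n a b S \<Longrightarrow> (\<And>e. e \<in> E \<Longrightarrow> card e = r) \<Longrightarrow> card S \<le> n * r"
proof (induction rule: lpath.induct)
  case (step e a b S n c)
  then show ?case using card_Un_le[of e S] by auto
qed simp

text \<open>The set argument of \<open>lpath\<close> is the union of the edges, which turns gluing
  into a condition on two sets. In the inductive step the far end \<open>d\<close> of the first path
  is not in its first edge, so this edge still meets the longer remainder in one vertex
  only.\<close>

lemma lpath_concat:
  "lpath E m a b S \<Longrightarrow> lpath E n b c S' \<Longrightarrow> S \<inter> S' = {b} \<Longrightarrow> lpath E (m + n) a c (S \<union> S')"
proof (induction rule: lpath.induct)
  case (single e a b)
  then show ?case by (auto intro: lpath.step)
next
  case (step e a b S n' d)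
  have "d \<in> S" "b \<noteq> d" using step.hyps(5) lpath_ends by metis+
  then have "d \<notin> e" using step.hyps(4) by (metis IntI singletonD)
  then have "e \<inter> (S \<union> S') = {b}" "S \<inter> S' = {d}"
    using step.hyps(4) step.prems(2) \<open>d \<in> S\<close> lpath_ends[OF step.prems(1)] \<open>d \<notin> e\<close>
    unfolding Int_eq_singleton_iff by blast+
  then have "lpath E (Suc (n' + n)) a c (e \<union> (S \<union> S'))"
    using step by (intro lpath.step) auto
  then show ?case by (simp add: Un_assoc)
qed

lemma lpath_shorten:
  "lpath E n a b S \<Longrightarrow> 1 \<le> m \<Longrightarrow> m \<le> n \<Longrightarrow> \<exists>a' S'. lpath E m a' b S' \<and> S' \<subseteq> S"
proof (induction rule: lpath.induct)
  case (single e a b)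
  then show ?case using lpath.single by (metis One_nat_def le_antisym subset_refl)
next
  case (step e a b S n c)
  show ?case
  proof (cases "m = Suc n")
    case True
    then show ?thesis using lpath.step[OF step.hyps] by blast
  next
    case False
    then show ?thesis using step by (metis le_Suc_eq le_supI2)
  qed
qed

text \<open>Unfolds the inductive path into sequences of the form that
  \<open>embeds_expansion\<close> requires: the joints become the original vertices, and distinct
  edges meet only in joints.\<close>

lemma lpath_functions:
  "lpath E n a b S \<Longrightarrow> \<exists>v e. v 0 = a \<and> v n = b \<and> inj_on v {..n} \<and> (\<forall>i<n. e i \<in> E) \<and>
     (\<forall>i<n. e i \<inter> v ` {..n} = {v i, v (Suc i)}) \<and>
     (\<forall>i<n. \<forall>j<n. i \<noteq> j \<longrightarrow> e i \<inter> e j \<subseteq> v ` {..n}) \<and> S = \<Union> (e ` {..<n})"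
proof (induction rule: lpath.induct)
  case (single e a b)
  show ?case
    by (rule exI[of _ "case_nat a (\<lambda>_. b)"], rule exI[of _ "\<lambda>_. e"])
       (use single in \<open>auto simp: inj_on_def atMost_Suc\<close>)
next
  case (step e0 a b S n c)
  then obtain v e where ve: "v 0 = b" "v n = c" "inj_on v {..n}" "\<forall>i<n. e i \<in> E"
     "\<forall>i<n. e i \<inter> v ` {..n} = {v i, v (Suc i)}"
     "\<forall>i<n. \<forall>j<n. i \<noteq> j \<longrightarrow> e i \<inter> e j \<subseteq> v ` {..n}" "S = \<Union> (e ` {..<n})" by (elim exE conjE) (rule that)
  have n: "n \<ge> 1" using lpath_ends[OF step.hyps(5)] by blast
  have vS: "v ` {..n} \<subseteq> S"
  proof
    fix x assume "x \<in> v ` {..n}"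
    then obtain i where i: "x = v i" "i \<le> n" by auto
    show "x \<in> S"
    proof (cases "i < n")
      case True
      then have "v i \<in> e i" using ve(5) by blast
      then show ?thesis using ve(7) i True by blast
    next
      case False
      then have "x = v (Suc (n - 1))" "n - 1 < n" using i n by auto
      moreover from this have "v (Suc (n - 1)) \<in> e (n - 1)" using ve(5) by blast
      ultimately show ?thesis using ve(7) by blast
    qed
  qed
  have aS: "a \<notin> S" using step by blast
  have im: "case_nat a v ` {..Suc n} = insert a (v ` {..n})"
    by (auto simp: image_iff atMost_Suc_eq_insert_0 split: nat.splits)
  have bv: "b \<in> v ` {..n}" using ve(1) by force
  show ?case
  proof (intro exI[of _ "case_nat a v"] exI[of _ "case_nat e0 e"] conjI)
    show "inj_on (case_nat a v) {..Suc n}"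
      unfolding atMost_Suc_eq_insert_0 using ve(3) vS aS
      by (auto simp: inj_on_def)
    show "\<forall>i<Suc n. case_nat e0 e i \<in> E" using step ve by (auto split: nat.splits)
    show "\<forall>i<Suc n. case_nat e0 e i \<inter> case_nat a v ` {..Suc n} = {case_nat a v i, case_nat a v (Suc i)}"
    proof (intro allI impI)
      fix i assume i: "i < Suc n"
      show "case_nat e0 e i \<inter> case_nat a v ` {..Suc n} = {case_nat a v i, case_nat a v (Suc i)}"
      proof (cases i)
        case 0
        then show ?thesis unfolding im using step.hyps ve(1) vS bv by auto
      next
        case (Suc j)
        then have "j < n" using i by simp
        then have "a \<notin> e j" using ve(7) aS by blast
        then show ?thesis unfolding im using Suc ve(5) \<open>j < n\<close> by auto
      qed
    qed
    have e0: "e0 \<inter> e j \<subseteq> v ` {..n}" if "j < n" for j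
      using ve(7) that step.hyps(4) bv by blast
    show "\<forall>i<Suc n. \<forall>j<Suc n. i \<noteq> j \<longrightarrow> case_nat e0 e i \<inter> case_nat e0 e j \<subseteq> case_nat a v ` {..Suc n}"
      unfolding im using e0 ve(6) by (auto split: nat.splits) blast+
    show "e0 \<union> S = \<Union> (case_nat e0 e ` {..<Suc n})"
      unfolding ve(7) lessThan_Suc_eq_insert_0 by auto
  qed (use ve in auto)
qed

lemma path_edges_inj: "inj_on (\<lambda>i. {i, Suc i}) I"
  by (auto simp: inj_on_def doubleton_eq_iff)

lemma embeds_path:
  assumes "lpath E n a b S" "\<And>e. e \<in> E \<Longrightarrow> card e = r" "r \<ge> 2"
  shows "embeds E (expansion r (path_graph n)) S"
proof -
  obtain v e where ve: "inj_on v {..n}" "\<forall>i<n. e i \<in> E"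
     "\<forall>i<n. e i \<inter> v ` {..n} = {v i, v (Suc i)}"
     "\<forall>i<n. \<forall>j<n. i \<noteq> j \<longrightarrow> e i \<inter> e j \<subseteq> v ` {..n}" "S = \<Union> (e ` {..<n})"
    using lpath_functions[OF assms(1)] by (elim exE conjE) (rule that)
  have n: "n \<ge> 1" using lpath_ends[OF assms(1)] by blast
  have "v i \<in> S" if "i \<le> n" for i
  proof (cases "i < n")
    case True
    then have "v i \<in> e i" using ve(3) by blast
    then show ?thesis using ve(5) True by blast
  next
    case False
    then have "v i = v (Suc (n - 1))" "n - 1 < n" using that n by auto
    moreover from this have "v (Suc (n - 1)) \<in> e (n - 1)" using ve(3) by blast
    ultimately show ?thesis using ve(5) by auto
  qed
  then have "v ` {..n} \<union> (\<Union>i\<in>{..<n}. e i) = S" using ve(5) by auto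
  moreover have "embeds E (expansion r (path_graph n)) (v ` verts (path_graph n) \<union> (\<Union>i\<in>{..<n}. e i))"
    by (rule embeds_expansion[where \<epsilon> = "\<lambda>i. {i, Suc i}"])
       (use ve assms in \<open>auto simp: path_graph_def path_edges_inj\<close>)
  ultimately show ?thesis by (simp add: path_graph_def)
qed

text \<open>Opening a cycle at one edge reduces it to a loose path. The ends \<open>a\<close> and
  \<open>b\<close> differ by \<open>lpath_ends\<close>, so the closing edge meets the path in
  exactly two vertices.\<close>

definition lcycle :: "'a set set \<Rightarrow> nat \<Rightarrow> 'a set \<Rightarrow> bool" where
  "lcycle E l S \<longleftrightarrow> (\<exists>a b S' e. lpath E (l - 1) a b S' \<and> e \<in> E \<and> e \<inter> S' = {a, b} \<and> S = S' \<union> e)"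

text \<open>For \<open>l = 2\<close> both positions give the same pair, hence the lower bound on
  \<open>l\<close>.\<close>

lemma cycle_edges_inj:
  assumes "l \<ge> 3" shows "inj_on (\<lambda>i. {i, Suc i mod l}) {..<l}"
proof (rule inj_onI)
  fix i j assume ij: "i \<in> {..<l}" "j \<in> {..<l}" "{i, Suc i mod l} = {j, Suc j mod l}"
  show "i = j"
  proof (rule ccontr)
    assume "i \<noteq> j"
    then have "i = Suc j mod l" "j = Suc i mod l" using ij by (auto simp: doubleton_eq_iff)
    moreover have m: "Suc x mod l = (if Suc x = l then 0 else Suc x)" if "x < l" for x
      using that by auto
    ultimately have "i = (if Suc j = l then 0 else Suc j)" "j = (if Suc i = l then 0 else Suc i)"
      using ij m[of i] m[of j] by simp_all
    then show False using assms by presburger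
  qed
qed

lemma embeds_cycle:
  assumes "lcycle E l S" "\<And>e. e \<in> E \<Longrightarrow> card e = r" "r \<ge> 2" "l \<ge> 3"
  shows "embeds E (expansion r (cycle_graph l)) S"
proof -
  define n where "n = l - 1"
  then have l: "l = Suc n" "n \<ge> 2" using assms by auto
  obtain a b S' e0 where c: "lpath E n a b S'" "e0 \<in> E" "e0 \<inter> S' = {a, b}" "S = S' \<union> e0"
    using assms(1) unfolding lcycle_def n_def by blast
  obtain v e where ve: "inj_on v {..n}" "\<forall>i<n. e i \<in> E"
     "\<forall>i<n. e i \<inter> v ` {..n} = {v i, v (Suc i)}"
     "\<forall>i<n. \<forall>j<n. i \<noteq> j \<longrightarrow> e i \<inter> e j \<subseteq> v ` {..n}" "S' = \<Union> (e ` {..<n})" "v 0 = a" "v n = b"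
    using lpath_functions[OF c(1)] by (elim exE conjE) (rule that)
  have vS: "v i \<in> S'" if "i \<le> n" for i
  proof (cases "i < n")
    case True
    then have "v i \<in> e i" using ve(3) by blast
    then show ?thesis using ve(5) True by blast
  next
    case False
    then have "v i = v (Suc (n - 1))" "n - 1 < n" using that l by auto
    moreover from this have "v (Suc (n - 1)) \<in> e (n - 1)" using ve(3) by blast
    ultimately show ?thesis using ve(5) by auto
  qed
  define e' where "e' i = (if i < n then e i else e0)" for i
  have ab: "a \<in> v ` {..n}" "b \<in> v ` {..n}" using ve by force+
  have e0: "e0 \<inter> e i \<subseteq> v ` {..n}" if "i < n" for i
    using c(3) ve(5) ab that by blast
  have e0': "e0 \<inter> v ` {..n} = {v n, v 0}" using c(3) vS ve(6,7) ab by blast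
  have *: "{..<l} = {..n}" using l by auto
  have "embeds E (expansion r (cycle_graph l)) (v ` verts (cycle_graph l) \<union> (\<Union>i\<in>{..<l}. e' i))"
  proof (rule embeds_expansion[where \<epsilon> = "\<lambda>i. {i, Suc i mod l}"])
    show "inj_on (\<lambda>i. {i, Suc i mod l}) {..<l}" using cycle_edges_inj assms by blast
    fix i assume i: "i \<in> {..<l}"
    then show "card {i, Suc i mod l} = 2" using assms(4) by (auto simp: card_insert_if mod_Suc)
    show "e' i \<inter> v ` verts (cycle_graph l) = v ` {i, Suc i mod l}"
    proof (cases "i < n")
      case True
      then have "e i \<inter> v ` {..n} = {v i, v (Suc i)}" using ve(3) by blast
      then show ?thesis using True l by (simp add: cycle_graph_def e'_def lessThan_Suc_atMost)
    next
      case False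
      then have "i = n" using i l by simp
      then show ?thesis using e0' l by (auto simp: cycle_graph_def * e'_def)
    qed
    fix j assume j: "j \<in> {..<l}" "i \<noteq> j"
    have V: "verts (cycle_graph l) = {..n}" using * by (simp add: cycle_graph_def)
    consider "i < n" "j < n" | "i < n" "j = n" | "i = n" "j < n" using i j l by fastforce
    then show "e' i \<inter> e' j \<subseteq> v ` verts (cycle_graph l)"
    proof cases
      case 1
      then show ?thesis using ve(4) j by (simp add: e'_def V)
    next
      case 2
      then show ?thesis using e0[of i] by (simp add: e'_def V Int_commute)
    next
      case 3
      then show ?thesis using e0[of j] by (simp add: e'_def V)
    qed
  qed (use assms ve c * in \<open>auto simp: cycle_graph_def e'_def\<close>)
  moreover have "v ` verts (cycle_graph l) \<union> (\<Union>i\<in>{..<l}. e' i) \<subseteq> S"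
    using vS ve(5) c(4) by (auto simp: cycle_graph_def * e'_def)
  ultimately show ?thesis by (blast intro: embeds_mono)
qed

text \<open>The first edge of the second path becomes the closing edge, and the rest of that path is
  glued to the first one at \<open>a\<close>. With \<open>n \<ge> 2\<close> such a rest
  exists.\<close>

lemma lcycle_join:
  assumes "lpath E m a b S" "lpath E n b a S'" "S \<inter> S' = {a, b}" "n \<ge> 2"
  shows "lcycle E (m + n) (S \<union> S')"
  using assms(2)
proof cases
  case single
  then show ?thesis using assms by simp
next
  case (step e c S'' n')
  have "c \<noteq> a" "a \<in> S''" "c \<in> S''" using lpath_ends[OF step(7)] by blast+
  have eS: "c \<in> e" "\<forall>x\<in>e. x \<in> S'' \<longrightarrow> x = c" using step(6) unfolding Int_eq_singleton_iff by auto
  have SS: "a \<in> S" "b \<in> S" "\<forall>x\<in>S. x \<in> S' \<longrightarrow> x = a \<or> x = b" using assms(3) by auto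
  have "b \<notin> S''" using step(4,5) eS by blast
  have "a \<notin> e" using eS \<open>c \<noteq> a\<close> \<open>a \<in> S''\<close> by blast
  have "S'' \<inter> S = {a}" unfolding Int_eq_singleton_iff
    using \<open>b \<notin> S''\<close> \<open>a \<in> S''\<close> SS step(2) by blast
  then have "lpath E (n' + m) c b (S'' \<union> S)" using lpath_concat step(7) assms(1) by fast
  moreover have "e \<inter> (S'' \<union> S) = {c, b}"
  proof
    have "x = b" if "x \<in> e" "x \<in> S" for x using that SS step(2) \<open>a \<notin> e\<close> by blast
    then show "e \<inter> (S'' \<union> S) \<subseteq> {c, b}" using eS by blast
    show "{c, b} \<subseteq> e \<inter> (S'' \<union> S)" using eS(1) SS(2) step(4) \<open>c \<in> S''\<close> by simp
  qed
  moreover have "n' + m = m + n - 1" using step(1) by simp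
  moreover have "S \<union> S' = S'' \<union> S \<union> e" using step(2) by blast
  ultimately have "lpath E (m + n - 1) c b (S'' \<union> S) \<and> e \<in> E \<and> e \<inter> (S'' \<union> S) = {c, b} \<and>
    S \<union> S' = S'' \<union> S \<union> e"
    using step(3) by simp
  then show ?thesis unfolding lcycle_def by (intro exI)
qed

text \<open>Any vertex of \<open>e i\<close> other than \<open>y\<close> can be the leaf, since the
  petals meet in \<open>y\<close> alone.\<close>

lemma embeds_star:
  assumes "\<And>i. i \<in> {1..n} \<Longrightarrow> e i \<in> E" "\<And>i. i \<in> {1..n} \<Longrightarrow> y \<in> e i"
    "\<And>i j. i \<in> {1..n} \<Longrightarrow> j \<in> {1..n} \<Longrightarrow> i \<noteq> j \<Longrightarrow> e i \<inter> e j = {y}"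
    and r: "\<And>e. e \<in> E \<Longrightarrow> card e = r" "r \<ge> 2"
  shows "embeds E (expansion r (star_graph n)) (insert y (\<Union>i\<in>{1..n}. e i))"
proof -
  have "\<exists>x. x \<in> e i \<and> x \<noteq> y" if "i \<in> {1..n}" for i
  proof -
    have "card (e i) \<ge> 2" using assms that by simp
    then have "\<not> e i \<subseteq> {y}" using card_mono[of "{y}" "e i"] by auto
    then show ?thesis by blast
  qed
  then obtain x where x: "\<And>i. i \<in> {1..n} \<Longrightarrow> x i \<in> e i \<and> x i \<noteq> y" by metis
  have xe: "i = j" if "i \<in> {1..n}" "j \<in> {1..n}" "x i \<in> e j" for i j
    using assms(3)[OF that(1,2)] x that by blast
  define v where "v i = (if i = 0 then y else x i)" for i
  have "embeds E (expansion r (star_graph n)) (v ` verts (star_graph n) \<union> (\<Union>i\<in>{1..n}. e i))"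
  proof (rule embeds_expansion[where \<epsilon> = "\<lambda>i. {0, i}"])
    show "inj_on (\<lambda>i. {0, i}) {1..n}" by (auto simp: inj_on_def doubleton_eq_iff)
    show "inj_on v (verts (star_graph n))"
    proof (rule inj_onI)
      fix i j assume "i \<in> verts (star_graph n)" "j \<in> verts (star_graph n)" "v i = v j"
      then show "i = j" using x[of i] x[of j] xe[of i j] unfolding v_def star_graph_def
        by (cases "i = 0"; cases "j = 0") auto
    qed
    fix i assume i: "i \<in> {1..n}"
    show "e i \<inter> v ` verts (star_graph n) = v ` {0, i}"
    proof
      show "e i \<inter> v ` verts (star_graph n) \<subseteq> v ` {0, i}"
      proof
        fix z assume "z \<in> e i \<inter> v ` verts (star_graph n)"
        then obtain j where j: "z = v j" "j \<le> n" "v j \<in> e i" by (auto simp: star_graph_def)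
        then show "z \<in> v ` {0, i}" using xe[of j i] i by (cases "j = 0") (auto simp: v_def)
      qed
      show "v ` {0, i} \<subseteq> e i \<inter> v ` verts (star_graph n)"
        using i x[OF i] assms(2)[OF i] by (auto simp: v_def star_graph_def)
    qed
    show "e i \<inter> e j \<subseteq> v ` verts (star_graph n)" if "j \<in> {1..n}" "i \<noteq> j" for j
    proof -
      have "y = v 0" "0 \<in> verts (star_graph n)" by (auto simp: v_def star_graph_def)
      then show ?thesis using assms(3)[OF i that] by blast
    qed
  qed (use assms in \<open>auto simp: star_graph_def\<close>)
  moreover have "v ` verts (star_graph n) \<union> (\<Union>i\<in>{1..n}. e i) \<subseteq> insert y (\<Union>i\<in>{1..n}. e i)"
  proof -
    have "v i \<in> insert y (\<Union>i\<in>{1..n}. e i)" if "i \<le> n" for i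
      using that x[of i] by (cases "i = 0") (auto simp: v_def)
    then show ?thesis by (auto simp: star_graph_def)
  qed
  ultimately show ?thesis by (blast intro: embeds_mono)
qed


section \<open>Homogeneous grids\<close>

text \<open>The box theorem of Erdos for ordered tuples, by induction on \<open>q\<close>: many
  tuples of length \<open>q\<close> share a common \<open>m\<close>-set of last coordinates, and the
  induction hypothesis is applied to these tuples. The parts may overlap here; in the application
  \<open>T\<close> consists of injective tuples, which makes them disjoint.\<close>

lemma dense_grid:
  assumes "\<epsilon> > (0::real)"
  shows "\<exists>n0. \<forall>(V :: 'a set) T. finite V \<longrightarrow> card V \<ge> n0 \<longrightarrow> T \<subseteq> ({..<q} \<rightarrow>\<^sub>E V) \<longrightarrow>
    real (card T) \<ge> \<epsilon> * real (card V) ^ q \<longrightarrow>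
    (\<exists>X. (\<forall>j<q. X j \<subseteq> V \<and> card (X j) = m) \<and> PiE {..<q} X \<subseteq> T)"
  using assms
proof (induction q arbitrary: \<epsilon>)
  case 0
  have "PiE {..<0::nat} X \<subseteq> T" if "T \<subseteq> ({..<0} \<rightarrow>\<^sub>E V)" "real (card T) \<ge> \<epsilon> * real (card V) ^ 0" for V :: "'a set" and T X
  proof -
    have "card T \<noteq> 0" using that 0 by auto
    then have "T \<noteq> {}" by force
    then show ?thesis using that by auto
  qed
  then show ?case by (intro exI[of _ 0]) auto
next
  case (Suc q)
  \<comment> \<open>Among \<open>N\<close> heavy last coordinates, tuples lying in fewer than
    \<open>m\<close> links are discarded; \<open>N * \<epsilon> \<ge> 4 * m\<close> makes this loss
    at most half of the total weight \<open>N * \<epsilon> / 2\<close>.\<close>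
  define N where "N = nat \<lceil>4 * real m / \<epsilon>\<rceil> + 1"
  have N: "real N * \<epsilon> \<ge> 4 * real m" "N \<ge> 1"
  proof -
    have "4 * real m / \<epsilon> \<le> real N" unfolding N_def by linarith
    then show "real N * \<epsilon> \<ge> 4 * real m" using Suc.prems by (simp add: divide_le_eq)
  qed (simp add: N_def)
  \<comment> \<open>The factor 4 comes from the averaging, \<open>2 ^ N\<close> from the pigeonhole
    over the subsets of the \<open>N\<close> chosen vertices.\<close>
  define \<delta> where "\<delta> = \<epsilon> / (4 * 2 ^ N)"
  have \<delta>: "\<delta> > 0" using Suc.prems by (simp add: \<delta>_def)
  obtain n1 where n1: "\<forall>(V :: 'a set) T. finite V \<longrightarrow> card V \<ge> n1 \<longrightarrow> T \<subseteq> ({..<q} \<rightarrow>\<^sub>E V) \<longrightarrow>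
    real (card T) \<ge> \<delta> * real (card V) ^ q \<longrightarrow>
    (\<exists>X. (\<forall>j<q. X j \<subseteq> V \<and> card (X j) = m) \<and> PiE {..<q} X \<subseteq> T)"
    using Suc.IH[OF \<delta>] by (elim exE) (rule that)
  \<comment> \<open>The second bound guarantees at least \<open>N\<close> heavy vertices.\<close>
  define n0 where "n0 = max n1 (nat \<lceil>2 * real N / \<epsilon>\<rceil> + 1)"
  show ?case
  proof (intro exI[of _ n0] allI impI)
    fix V :: "'a set" and T
    assume V: "finite V" "n0 \<le> card V" and T: "T \<subseteq> ({..<Suc q} \<rightarrow>\<^sub>E V)"
      and dense: "\<epsilon> * real (card V) ^ Suc q \<le> real (card T)"
    define n where "n = card V"
    have n: "n > 0" "n \<ge> n1" "real n * \<epsilon> \<ge> 2 * real N"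
    proof -
      have "2 * real N / \<epsilon> \<le> real n" using V(2) unfolding n_def n0_def by linarith
      then show "real n * \<epsilon> \<ge> 2 * real N" using Suc.prems by (simp add: divide_le_eq)
    qed (use V in \<open>auto simp: n_def n0_def\<close>)
    define P where "P = ({..<q} \<rightarrow>\<^sub>E V)"
    have P: "finite P" "card P = n ^ q"
      unfolding P_def using V(1) by (auto simp: finite_PiE card_PiE n_def)
    define L where "L x = {g \<in> P. g(q := x) \<in> T}" for x
    have L: "finite (L x)" "card (L x) \<le> n ^ q" for x
      using P card_mono[of P "L x"] by (auto simp: L_def)
    have "T \<subseteq> (\<Union>x\<in>V. (\<lambda>g. g(q := x)) ` L x)"
    proof
      fix f assume f: "f \<in> T"
      then have fV: "f \<in> {..<Suc q} \<rightarrow>\<^sub>E V" using T by blast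
      define g where "g = restrict f {..<q}"
      have gf: "g(q := f q) = f"
      proof
        fix j show "(g(q := f q)) j = f j"
          using fV by (cases "j < q") (auto simp: g_def PiE_def extensional_def)
      qed
      have "f j \<in> V" if "j < q" for j using PiE_mem[OF fV, of j] that by simp
      then have "g \<in> P" by (simp add: g_def P_def restrict_PiE_iff)
      then have "g \<in> L (f q)" unfolding L_def using f gf by simp
      moreover have "f q \<in> V" using PiE_mem[OF fV, of q] by simp
      ultimately show "f \<in> (\<Union>x\<in>V. (\<lambda>g. g(q := x)) ` L x)"
        using gf[symmetric] by (intro UN_I[of "f q"] image_eqI[of _ _ g])
    qed
    then have "card T \<le> card (\<Union>x\<in>V. (\<lambda>g. g(q := x)) ` L x)"
      using V(1) L(1) by (intro card_mono) auto
    also have "\<dots> \<le> (\<Sum>x\<in>V. card ((\<lambda>g. g(q := x)) ` L x))" using V(1) by (rule card_UN_le)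
    also have "\<dots> \<le> (\<Sum>x\<in>V. card (L x))" using L(1) by (intro sum_mono card_image_le)
    finally have cT: "real (card T) \<le> (\<Sum>x\<in>V. real (card (L x)))"
      by (simp flip: of_nat_sum)
    \<comment> \<open>Heavy vertices: their link has at least half of the guaranteed average
      density.\<close>
    define Big where "Big = {x \<in> V. real (card (L x)) \<ge> \<epsilon> / 2 * real n ^ q}"
    have Big: "finite Big" "Big \<subseteq> V" using V(1) by (auto simp: Big_def)
    have "(\<Sum>x\<in>V. real (card (L x))) = (\<Sum>x\<in>Big. real (card (L x))) + (\<Sum>x\<in>V - Big. real (card (L x)))"
      using V(1) Big by (metis add.commute sum.subset_diff)
    also have "(\<Sum>x\<in>Big. real (card (L x))) \<le> (\<Sum>x\<in>Big. real n ^ q)"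
      using L(2) by (intro sum_mono) (metis of_nat_le_iff of_nat_power)
    also have "(\<Sum>x\<in>V - Big. real (card (L x))) \<le> (\<Sum>x\<in>V - Big. \<epsilon> / 2 * real n ^ q)"
      by (intro sum_mono) (auto simp: Big_def)
    also have "\<dots> \<le> (\<Sum>x\<in>V. \<epsilon> / 2 * real n ^ q)"
      using V(1) Suc.prems by (intro sum_mono2) auto
    finally have "\<epsilon> * real n ^ Suc q \<le> real (card Big) * real n ^ q + real n * (\<epsilon> / 2 * real n ^ q)"
      using dense cT by (simp add: n_def)
    then have "real n ^ q * (\<epsilon> / 2 * real n) \<le> real n ^ q * real (card Big)"
      by (simp add: algebra_simps)
    then have "\<epsilon> / 2 * real n \<le> real (card Big)"
      using n(1) by (simp add: mult_le_cancel_left_pos)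
    then have "N \<le> card Big" using n(3) by (simp add: mult.commute)
    then obtain Y where Y: "Y \<subseteq> Big" "card Y = N" by (metis obtain_subset_with_card_n)
    have finY: "finite Y" using Y Big finite_subset by blast
    define d where "d g = card {x \<in> Y. g \<in> L x}" for g
    define G where "G = {g \<in> P. d g \<ge> m}"
    have G: "finite G" "G \<subseteq> P" using P by (auto simp: G_def)
    have dN: "d g \<le> N" for g unfolding d_def using finY Y(2) card_mono[of Y "{x \<in> Y. g \<in> L x}"] by auto
    have "real N * (\<epsilon> / 2 * real n ^ q) = (\<Sum>x\<in>Y. \<epsilon> / 2 * real n ^ q)" using Y by simp
    also have "\<dots> \<le> (\<Sum>x\<in>Y. real (card (L x)))"
      using Y(1) by (intro sum_mono) (auto simp: Big_def)
    also have "\<dots> = real (\<Sum>x\<in>Y. card (L x))" by simp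
    also have "(\<Sum>x\<in>Y. card (L x)) = (\<Sum>g\<in>P. d g)"
    proof -
      have "(\<Sum>x\<in>Y. card (L x)) = (\<Sum>x\<in>Y. \<Sum>g\<in>P. if g \<in> L x then 1 else 0)"
      proof (rule sum.cong)
        fix x assume "x \<in> Y"
        have "{g \<in> P. g \<in> L x} = L x" by (auto simp: L_def)
        then show "card (L x) = (\<Sum>g\<in>P. if g \<in> L x then 1 else 0)"
          using P(1) by (simp add: sum.If_cases Int_def)
      qed simp
      also have "\<dots> = (\<Sum>g\<in>P. \<Sum>x\<in>Y. if g \<in> L x then 1 else 0)" by (rule sum.swap)
      also have "\<dots> = (\<Sum>g\<in>P. d g)"
        using finY by (intro sum.cong) (auto simp: d_def sum.If_cases Int_def)
      finally show ?thesis .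
    qed
    also have "real (\<Sum>g\<in>P. d g) \<le> real (card G * N + n ^ q * m)"
    proof -
      have "(\<Sum>g\<in>P. d g) = (\<Sum>g\<in>G. d g) + (\<Sum>g\<in>P - G. d g)"
        using P(1) G by (metis add.commute sum.subset_diff)
      also have "\<dots> \<le> (\<Sum>g\<in>G. N) + (\<Sum>g\<in>P - G. m)"
        using dN by (intro add_mono sum_mono) (auto simp: G_def)
      also have "\<dots> \<le> card G * N + n ^ q * m"
        using card_mono[of P "P - G"] P by (auto intro!: mult_right_mono)
      finally show ?thesis by (simp only: of_nat_le_iff)
    qed
    finally have "real N * (\<epsilon> / 2 * real n ^ q) \<le> real (card G) * real N + real n ^ q * real m" by simp
    moreover have "real n ^ q * (4 * real m) \<le> real n ^ q * (real N * \<epsilon>)"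
      using N(1) by (intro mult_left_mono) auto
    ultimately have "real N * (\<epsilon> / 4 * real n ^ q) \<le> real N * real (card G)"
      by (simp add: algebra_simps)
    then have cG: "\<epsilon> / 4 * real n ^ q \<le> real (card G)" using N(2) by (simp add: mult_le_cancel_left_pos)
    \<comment> \<open>Each tuple of \<open>G\<close> selects one \<open>m\<close>-set of admissible
      last coordinates; by pigeonhole some set is selected by a proportion \<open>\<delta>\<close>
      of all tuples.\<close>
    have "\<forall>g\<in>G. \<exists>A. A \<subseteq> {x \<in> Y. g \<in> L x} \<and> card A = m"
      unfolding G_def d_def by (metis (mono_tags, lifting) mem_Collect_eq obtain_subset_with_card_n)
    then obtain h where h: "\<And>g. g \<in> G \<Longrightarrow> h g \<subseteq> {x \<in> Y. g \<in> L x} \<and> card (h g) = m" by metis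
    have "\<exists>A\<in>Pow Y. real (card {g \<in> G. h g = A}) \<ge> \<delta> * real n ^ q"
    proof (rule ccontr)
      assume "\<not> ?thesis"
      then have less: "real (card {g \<in> G. h g = A}) < \<delta> * real n ^ q" if "A \<in> Pow Y" for A
        using that by (metis not_le)
      have "real (card G) = real (\<Sum>A\<in>Pow Y. card {g \<in> G. h g = A})"
      proof -
        have "(\<Sum>A\<in>Pow Y. card {g \<in> G. h g = A}) = card (\<Union>A\<in>Pow Y. {g \<in> G. h g = A})"
          using finY G(1) by (intro card_UN_disjoint[symmetric]) auto
        also have "(\<Union>A\<in>Pow Y. {g \<in> G. h g = A}) = G"
        proof -
          have "h g \<in> Pow Y" if "g \<in> G" for g using h[OF that] by auto
          then show ?thesis by auto
        qed
        finally show ?thesis by simp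
      qed
      also have "\<dots> = (\<Sum>A\<in>Pow Y. real (card {g \<in> G. h g = A}))" by simp
      also have "\<dots> < (\<Sum>A\<in>Pow Y. \<delta> * real n ^ q)"
        using finY less by (intro sum_strict_mono) auto
      also have "\<dots> = \<epsilon> / 4 * real n ^ q" using finY Y by (simp add: card_Pow \<delta>_def)
      finally show False using cG by simp
    qed
    then obtain A where A: "A \<subseteq> Y" "real (card {g \<in> G. h g = A}) \<ge> \<delta> * real n ^ q" by blast
    have "\<delta> * real n ^ q > 0" using \<delta> n(1) by simp
    then have "{g \<in> G. h g = A} \<noteq> {}" using A(2) by (metis card.empty linorder_not_less of_nat_0)
    then have cA: "card A = m" using h by blast
    have "{g \<in> G. h g = A} \<subseteq> ({..<q} \<rightarrow>\<^sub>E V)" using G by (auto simp: P_def)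
    then obtain X where X: "\<forall>j<q. X j \<subseteq> V \<and> card (X j) = m" "PiE {..<q} X \<subseteq> {g \<in> G. h g = A}"
      using n1[rule_format, of V "{g \<in> G. h g = A}"] V(1) n(2) A(2) unfolding n_def by metis
    show "\<exists>X. (\<forall>j<Suc q. X j \<subseteq> V \<and> card (X j) = m) \<and> PiE {..<Suc q} X \<subseteq> T"
    proof (intro exI[of _ "X(q := A)"] conjI)
      have "A \<subseteq> V" using A Y Big by blast
      then show "\<forall>j<Suc q. (X(q := A)) j \<subseteq> V \<and> card ((X(q := A)) j) = m"
        using X(1) cA by (auto simp: less_Suc_eq)
      show "PiE {..<Suc q} (X(q := A)) \<subseteq> T"
      proof
        fix f assume f: "f \<in> PiE {..<Suc q} (X(q := A))"
        define g where "g = restrict f {..<q}"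
        have gf: "g(q := f q) = f"
        proof
          fix j show "(g(q := f q)) j = f j"
            using f by (cases "j < q") (auto simp: g_def PiE_def extensional_def)
        qed
        have "g j \<in> X j" if "j < q" for j
        proof -
          have "f j \<in> (X(q := A)) j" using f that by (intro PiE_mem[OF f]) simp
          then show ?thesis using that by (simp add: g_def)
        qed
        then have "g \<in> PiE {..<q} X" by (simp add: g_def restrict_PiE_iff)
        then have "g \<in> G" "h g = A" using X(2) by auto
        moreover have "f q \<in> A" using PiE_mem[OF f, of q] by simp
        ultimately have "g \<in> L (f q)" using h by blast
        then show "f \<in> T" using gf by (simp add: L_def)
      qed
    qed
  qed
qed

section \<open>Canonical colourings of grids\<close>

definition indep_coord :: "nat \<Rightarrow> (nat \<Rightarrow> 'a set) \<Rightarrow> ((nat \<Rightarrow> 'a) \<Rightarrow> 'b) \<Rightarrow> nat \<Rightarrow> bool" where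
  "indep_coord q Y c j \<longleftrightarrow> (\<forall>f\<in>PiE {..<q} Y. \<forall>a\<in>Y j. c (f(j := a)) = c f)"

text \<open>The colour reveals the coordinate whatever the other coordinates are. This is stronger
  than changing its value whenever only coordinate \<open>j\<close> changes.\<close>

definition dep_coord :: "nat \<Rightarrow> (nat \<Rightarrow> 'a set) \<Rightarrow> ((nat \<Rightarrow> 'a) \<Rightarrow> 'b) \<Rightarrow> nat \<Rightarrow> bool" where
  "dep_coord q Y c j \<longleftrightarrow> (\<forall>f\<in>PiE {..<q} Y. \<forall>g\<in>PiE {..<q} Y. f j \<noteq> g j \<longrightarrow> c f \<noteq> c g)"

text \<open>A product version of the canonical Ramsey theorem. For every \<open>2 * q\<close>-set it
  is recorded which colours agree on which pairs of grid points that can be read off it; once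
  Ramsey's theorem makes this record constant, equality of colours depends only on the order pattern
  of the two points. The assumption \<open>m \<ge> 3\<close> provides a third value to which a
  coordinate can be moved.\<close>

lemma homogeneous_grid:
  assumes I: "finite (I :: 'i set)" and m: "m \<ge> 3"
  shows "\<exists>M. \<forall>(X :: nat \<Rightarrow> 'a set) (c :: 'i \<Rightarrow> (nat \<Rightarrow> 'a) \<Rightarrow> 'b). (\<forall>j<q. card (X j) = M) \<longrightarrow>
    (\<exists>Y. (\<forall>j<q. Y j \<subseteq> X j \<and> card (Y j) = m) \<and>
      (\<forall>i\<in>I. \<forall>j<q. indep_coord q Y (c i) j \<or> dep_coord q Y (c i) j))"
proof -
  define Col where "Col = Pow (I \<times> Pow {..<q} \<times> Pow {..<q})"
  have Col: "finite Col" using I by (simp add: Col_def)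
  then obtain \<kappa> where \<kappa>: "bij_betw \<kappa> Col {..<card Col}"
    using finite_same_card_bij[of Col "{..<card Col}"] by auto
  obtain N :: nat where "partn_lst {..<N} (replicate (card Col) (q * (m + 1))) (2 * q)"
    using ramsey_full by blast
  \<comment> \<open>The successor makes \<open>M\<close> positive, so that
    \<open>card (X j) = M\<close> forces \<open>X j\<close> to be finite.\<close>
  then have N: "partn_lst {..<Suc N} (replicate (card Col) (q * (m + 1))) (2 * q)"
    by (rule partn_lst_greater_resource) simp
  define M where "M = Suc N"
  show ?thesis
  proof (intro exI[of _ M] allI impI)
    fix X :: "nat \<Rightarrow> 'a set" and c :: "'i \<Rightarrow> (nat \<Rightarrow> 'a) \<Rightarrow> 'b"
    assume X: "\<forall>j<q. card (X j) = M"
    have "\<forall>j. \<exists>e. j < q \<longrightarrow> bij_betw e {..<M} (X j)"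
    proof (intro allI)
      fix j show "\<exists>e. j < q \<longrightarrow> bij_betw e {..<M} (X j)"
      proof (cases "j < q")
        case True
        then have "card (X j) = M" "finite (X j)" using X by (auto simp: M_def intro: card_ge_0_finite)
        then show ?thesis using finite_same_card_bij[of "{..<M}" "X j"] by auto
      qed simp
    qed
    then obtain e where e: "\<And>j. j < q \<Longrightarrow> bij_betw (e j) {..<M} (X j)" by metis
    \<comment> \<open>Entries \<open>2 * j\<close> and \<open>2 * j + 1\<close> of the sorted set
      are two candidates for coordinate \<open>j\<close>; \<open>\<sigma>\<close> collects the
      coordinates that take the larger one.\<close>
    define sub where "sub S \<sigma> = (\<lambda>j\<in>{..<q}. e j (sorted_list_of_set S ! (2 * j + of_bool (j \<in> \<sigma>))))"
      for S :: "nat set" and \<sigma>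
    define pat where "pat S = {(i, \<sigma>, \<tau>). i \<in> I \<and> \<sigma> \<subseteq> {..<q} \<and> \<tau> \<subseteq> {..<q} \<and> c i (sub S \<sigma>) = c i (sub S \<tau>)}" for S
    have pat: "pat S \<in> Col" for S by (auto simp: pat_def Col_def)
    have "(\<lambda>S. \<kappa> (pat S)) \<in> nsets {..<M} (2 * q) \<rightarrow> {..<card Col}"
      using pat \<kappa> by (auto simp: bij_betw_def)
    from partn_lstE[OF N[folded M_def] this] obtain i0 H where
      i0: "i0 < card Col" "H \<in> nsets {..<M} (q * (m + 1))"
        "(\<lambda>S. \<kappa> (pat S)) ` nsets H (2 * q) \<subseteq> {i0}"
      by auto
    define K where "K = inv_into Col \<kappa> i0"
    have K: "pat S = K" if "S \<in> nsets H (2 * q)" for S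
    proof -
      have "\<kappa> (pat S) = i0" using i0(3) that by blast
      then show ?thesis using pat \<kappa> unfolding K_def by (metis bij_betw_inv_into_left)
    qed
    have H: "finite H" "card H = q * (m + 1)" "H \<subseteq> {..<M}" using i0(2) by (auto simp: nsets_def)
    define hs where "hs = sorted_list_of_set H"
    have hs: "length hs = q * (m + 1)" "set hs = H" "sorted_wrt (<) hs"
      using H by (auto simp: hs_def)
    have hs_less: "hs ! a < hs ! b" if "a < b" "b < q * (m + 1)" for a b
      using hs that sorted_wrt_nth_less by metis
    have pos: "j * (m + 1) + a < q * (m + 1)" if "j < q" "a \<le> m" for j a
    proof -
      have "j * (m + 1) + a < Suc j * (m + 1)" using that by simp
      also have "\<dots> \<le> q * (m + 1)" using that by (intro mult_right_mono) auto
      finally show ?thesis .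
    qed
    have hs_in: "hs ! k \<in> {..<M}" if "k < q * (m + 1)" for k
      using H(3) hs(1,2) that nth_mem[of k hs] by auto
    \<comment> \<open>\<open>H\<close> is cut into \<open>q\<close> blocks of length
      \<open>m + 1\<close>; the last entry of each block is a spare that belongs to no part.\<close>
    define pt where "pt j a = e j (hs ! (j * (m + 1) + a))" for j a
    have pt_inj: "a = b" if "pt j a = pt j b" "j < q" "a \<le> m" "b \<le> m" for j a b
    proof -
      have "hs ! (j * (m + 1) + a) \<in> {..<M}" "hs ! (j * (m + 1) + b) \<in> {..<M}"
        using hs_in pos that by blast+
      then have "hs ! (j * (m + 1) + a) = hs ! (j * (m + 1) + b)"
        using that e unfolding pt_def bij_betw_def inj_on_def by blast
      then show "a = b"
        using hs_less[of "j * (m + 1) + a" "j * (m + 1) + b"]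
          hs_less[of "j * (m + 1) + b" "j * (m + 1) + a"] pos[OF that(2,3)] pos[OF that(2,4)]
        by (cases a b rule: linorder_cases) auto
    qed
    define Y where "Y j = pt j ` {..<m}" for j
    define F where "F \<phi> = (\<lambda>j\<in>{..<q}. pt j (\<phi> j))" for \<phi> :: "nat \<Rightarrow> nat"
    have key: "c i (F \<phi>) = c i (F \<psi>) \<longleftrightarrow> (i, {j. j < q \<and> \<psi> j < \<phi> j}, {j. j < q \<and> \<phi> j < \<psi> j}) \<in> K"
      if i: "i \<in> I" and \<phi>: "\<And>j. j < q \<Longrightarrow> \<phi> j < m" and \<psi>: "\<And>j. j < q \<Longrightarrow> \<psi> j < m" for i \<phi> \<psi>
    proof -
      define lo where "lo j = min (\<phi> j) (\<psi> j)" for j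
      \<comment> \<open>Where the two points agree, the spare index \<open>m\<close> fills the
        second slot, so that \<open>2 * q\<close> distinct entries are always available.\<close>
      define hi where "hi j = (if \<phi> j = \<psi> j then m else max (\<phi> j) (\<psi> j))" for j
      have lohi: "lo j < hi j" "hi j \<le> m" if "j < q" for j
        using \<phi>[OF that] \<psi>[OF that] by (auto simp: lo_def hi_def)
      define p where "p k = (k div 2) * (m + 1) + (if even k then lo (k div 2) else hi (k div 2))" for k
      have p_less: "p k < q * (m + 1)" if "k < 2 * q" for k
        using that pos[of "k div 2"] lohi[of "k div 2"] by (auto simp: p_def)
      have p_Suc: "p k < p (Suc k)" if "Suc k < 2 * q" for k
      proof (cases "even k")
        case True
        then show ?thesis using lohi[of "k div 2"] that by (auto simp: p_def)
      next
        case False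
        then have "Suc k div 2 = Suc (k div 2)" by presburger
        moreover have "k div 2 < q" using that by simp
        ultimately show ?thesis using False lohi[of "k div 2"] by (simp add: p_def)
      qed
      have p_mono: "p a < p b" if "a < b" "b < 2 * q" for a b
        using that
      proof (induction b)
        case (Suc b)
        have "p b < p (Suc b)" using p_Suc[of b] Suc.prems(2) by blast
        moreover have "a = b \<or> p a < p b" using Suc.IH Suc.prems by linarith
        ultimately show ?case by (metis less_trans)
      qed simp
      define s where "s = map (\<lambda>k. hs ! p k) [0..<2 * q]"
      have s_sorted: "sorted_wrt (<) s"
        unfolding s_def sorted_wrt_iff_nth_less using p_mono p_less hs_less by simp
      define S where "S = set s"
      have sS: "sorted_list_of_set S = s"
        using s_sorted unfolding S_def
        by (simp add: sorted_list_of_set.idem_if_sorted_distinct strict_sorted_iff)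
      have "S \<subseteq> H" unfolding S_def s_def using hs p_less by (auto simp flip: hs(2))
      moreover have "card S = 2 * q"
      proof -
        have "distinct s" "length s = 2 * q" using s_sorted by (auto simp: strict_sorted_iff s_def)
        then show ?thesis unfolding S_def by (simp add: distinct_card)
      qed
      ultimately have "S \<in> nsets H (2 * q)" using H(1) finite_subset by (auto simp: nsets_def)
      then have pS: "pat S = K" by (rule K)
      have s_nth: "s ! (2 * j) = hs ! (j * (m + 1) + lo j)" "s ! (2 * j + 1) = hs ! (j * (m + 1) + hi j)"
        if "j < q" for j
        using that by (auto simp: s_def p_def)
      have "sub S {j. j < q \<and> \<psi> j < \<phi> j} = F \<phi>"
      proof
        fix j show "sub S {j. j < q \<and> \<psi> j < \<phi> j} j = F \<phi> j"
          using s_nth[of j] by (auto simp: sub_def F_def sS pt_def lo_def hi_def)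
      qed
      moreover have "sub S {j. j < q \<and> \<phi> j < \<psi> j} = F \<psi>"
      proof
        fix j show "sub S {j. j < q \<and> \<phi> j < \<psi> j} j = F \<psi> j"
          using s_nth[of j] by (auto simp: sub_def F_def sS pt_def lo_def hi_def)
      qed
      ultimately show ?thesis unfolding pS[symmetric] using i by (auto simp: pat_def)
    qed
    have surj: "\<exists>\<phi>. f = F \<phi> \<and> (\<forall>j<q. \<phi> j < m)" if "f \<in> PiE {..<q} Y" for f
    proof -
      have "\<forall>j. \<exists>a. j < q \<longrightarrow> f j = pt j a \<and> a < m"
        using that unfolding Y_def by (auto simp: PiE_def Pi_def image_iff)
      then obtain \<phi> where \<phi>: "\<And>j. j < q \<Longrightarrow> f j = pt j (\<phi> j) \<and> \<phi> j < m" by metis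
      have "f = F \<phi>"
      proof
        fix j show "f j = F \<phi> j"
          using \<phi>[of j] that by (cases "j < q") (auto simp: F_def PiE_def extensional_def)
      qed
      then show ?thesis using \<phi> by blast
    qed
    \<comment> \<open>Raising and lowering one coordinate give the same pattern after the two points
      have been put in order, so one membership in \<open>K\<close> decides both.\<close>
    have single: "c i (F \<phi>) = c i (F (\<phi>(j := b))) \<longleftrightarrow> (i, {}, {j}) \<in> K"
      if i: "i \<in> I" and \<phi>: "\<And>j. j < q \<Longrightarrow> \<phi> j < m" and "j < q" "b < m" "b \<noteq> \<phi> j" for i \<phi> j b
    proof -
      have b': "(\<phi>(j := b)) k < m" if "k < q" for k using \<phi>[OF that] \<open>b < m\<close> by simp
      show ?thesis
    proof (cases "\<phi> j < b")
      case True
      have "{k. k < q \<and> (\<phi>(j := b)) k < \<phi> k} = {}" "{k. k < q \<and> \<phi> k < (\<phi>(j := b)) k} = {j}"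
        using True that by auto
      then show ?thesis using key[OF i, of \<phi> "\<phi>(j := b)", OF \<phi> b'] by (simp only:)
    next
      case False
      have "{k. k < q \<and> (\<phi>(j := b)) k < \<phi> k} = {j}" "{k. k < q \<and> \<phi> k < (\<phi>(j := b)) k} = {}"
        using False that by (auto split: if_splits)
      then show ?thesis using key[OF i, of "\<phi>(j := b)" \<phi>, OF b' \<phi>]
        by (simp only: eq_commute[of "c i (F \<phi>)"])
    qed
    qed
    \<comment> \<open>Moving coordinate \<open>j\<close> of one point to a third value on the same
      side of the other point preserves the pattern and hence the equality. Then two points
      differing in \<open>j\<close> alone have equal colours, against \<open>nK\<close>.\<close>
    have nodep: "c i (F \<phi>) \<noteq> c i (F \<psi>)"
      if i: "i \<in> I" and \<phi>: "\<And>j. j < q \<Longrightarrow> \<phi> j < m" and \<psi>: "\<And>j. j < q \<Longrightarrow> \<psi> j < m"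
        and j: "j < q" "\<phi> j < \<psi> j" and nK: "(i, {}, {j}) \<notin> K" for i \<phi> \<psi> j
    proof
      assume eq: "c i (F \<phi>) = c i (F \<psi>)"
      have "\<exists>b<m. b \<noteq> \<phi> j \<and> b \<noteq> \<psi> j" using m by presburger
      then obtain b where b: "b < m" "b \<noteq> \<phi> j" "b \<noteq> \<psi> j" by blast
      show False
      proof (cases "b < \<psi> j")
        case True
        have "{k. k < q \<and> \<psi> k < (\<phi>(j := b)) k} = {k. k < q \<and> \<psi> k < \<phi> k}"
          "{k. k < q \<and> (\<phi>(j := b)) k < \<psi> k} = {k. k < q \<and> \<phi> k < \<psi> k}"
          using True j by auto
        then have "c i (F (\<phi>(j := b))) = c i (F \<psi>)"
          using key[OF i, of \<phi> \<psi>] key[OF i, of "\<phi>(j := b)" \<psi>] \<phi> \<psi> b(1) eq by simp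
        then show False using single[OF i, of \<phi> j b, OF \<phi> j(1) b(1,2)] nK eq by simp
      next
        case False
        have "{k. k < q \<and> (\<psi>(j := b)) k < \<phi> k} = {k. k < q \<and> \<psi> k < \<phi> k}"
          "{k. k < q \<and> \<phi> k < (\<psi>(j := b)) k} = {k. k < q \<and> \<phi> k < \<psi> k}"
          using False j by auto
        then have "c i (F \<phi>) = c i (F (\<psi>(j := b)))"
          using key[OF i, of \<phi> \<psi>] key[OF i, of \<phi> "\<psi>(j := b)"] \<phi> \<psi> b(1) eq by simp
        then show False using single[OF i, of \<psi> j b, OF \<psi> j(1) b(1,3)] nK eq by simp
      qed
    qed
    show "\<exists>Y. (\<forall>j<q. Y j \<subseteq> X j \<and> card (Y j) = m) \<and>
      (\<forall>i\<in>I. \<forall>j<q. indep_coord q Y (c i) j \<or> dep_coord q Y (c i) j)"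
    proof (intro exI[of _ Y] conjI allI impI ballI)
      fix j assume j: "j < q"
      show "Y j \<subseteq> X j"
      proof
        fix x assume "x \<in> Y j"
        then obtain a where a: "a < m" "x = e j (hs ! (j * (m + 1) + a))" by (auto simp: Y_def pt_def)
        have "hs ! (j * (m + 1) + a) \<in> {..<M}"
          using hs_in pos[OF j, of a] a by simp
        then show "x \<in> X j" using e[OF j] a by (auto simp: bij_betw_def)
      qed
      have "inj_on (pt j) {..<m}" using pt_inj[OF _ j] by (auto simp: inj_on_def)
      then show "card (Y j) = m" by (simp add: Y_def card_image)
      fix i assume i: "i \<in> I"
      show "indep_coord q Y (c i) j \<or> dep_coord q Y (c i) j"
      proof (cases "(i, {}, {j}) \<in> K")
        case True
        have "c i (f(j := a)) = c i f" if f: "f \<in> PiE {..<q} Y" and a: "a \<in> Y j" for f a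
        proof -
          obtain \<phi> where \<phi>: "f = F \<phi>" "\<forall>j<q. \<phi> j < m" using surj[OF f] by blast
          obtain b where b: "b < m" "a = pt j b" using a by (auto simp: Y_def)
          have "f(j := a) = F (\<phi>(j := b))" using \<phi> b j by (auto simp: F_def)
          then show ?thesis using single[OF i, of \<phi> j b] \<phi> b j True by (cases "b = \<phi> j") auto
        qed
        then show ?thesis by (auto simp: indep_coord_def)
      next
        case False
        have "c i f \<noteq> c i g" if f: "f \<in> PiE {..<q} Y" and g: "g \<in> PiE {..<q} Y" and fg: "f j \<noteq> g j" for f g
        proof -
          obtain \<phi> where \<phi>: "f = F \<phi>" "\<forall>j<q. \<phi> j < m" using surj[OF f] by blast
          obtain \<psi> where \<psi>: "g = F \<psi>" "\<forall>j<q. \<psi> j < m" using surj[OF g] by blast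
          have "\<phi> j \<noteq> \<psi> j" using fg \<phi> \<psi> j by (auto simp: F_def)
          then consider "\<phi> j < \<psi> j" | "\<psi> j < \<phi> j" by linarith
          then show ?thesis
          proof cases
            case 1
            then show ?thesis using nodep[OF i, of \<phi> \<psi> j] \<phi> \<psi> j False by blast
          next
            case 2
            then show ?thesis using nodep[OF i, of \<psi> \<phi> j] \<phi> \<psi> j False by metis
          qed
        qed
        then show ?thesis by (auto simp: dep_coord_def)
      qed
    qed
  qed
qed


section \<open>Assembling the components\<close>

text \<open>Greedy selection. The step may use that the sets chosen so far satisfy \<open>P\<close>,
  which is where their size bounds come from.\<close>

lemma disjoint_choice:
  assumes "finite I"
    and step: "\<And>J S i. J \<subseteq> I \<Longrightarrow> i \<in> I - J \<Longrightarrow> (\<And>j. j \<in> J \<Longrightarrow> P j (S j)) \<Longrightarrow>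
      \<exists>S'. P i S' \<and> S' \<inter> (\<Union>j\<in>J. S j) = {}"
  shows "\<exists>S. (\<forall>i\<in>I. P i (S i)) \<and> (\<forall>i\<in>I. \<forall>j\<in>I. i \<noteq> j \<longrightarrow> S i \<inter> S j = {})"
proof -
  have "\<exists>S. (\<forall>i\<in>J. P i (S i)) \<and> (\<forall>i\<in>J. \<forall>j\<in>J. i \<noteq> j \<longrightarrow> S i \<inter> S j = {})" if "finite J" "J \<subseteq> I" for J
    using that
  proof (induction J)
    case (insert i J)
    then obtain S where S: "\<forall>i\<in>J. P i (S i)" "\<forall>i\<in>J. \<forall>j\<in>J. i \<noteq> j \<longrightarrow> S i \<inter> S j = {}" by auto
    obtain S' where S': "P i S'" "S' \<inter> (\<Union>j\<in>J. S j) = {}"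
      using step[of J i S] insert S by auto
    have "S' \<inter> S j = {}" if "j \<in> J" for j using S'(2) that by blast
    then show ?case
      using S S'(1) insert.hyps(2)
      by (intro exI[of _ "S(i := S')"]) (auto simp: Int_commute)
  qed simp
  then show ?thesis using assms(1) by blast
qed

lemma finite_card_UN_le:
  assumes "finite J" "card J \<le> k" "\<And>j. j \<in> J \<Longrightarrow> finite (S j) \<and> card (S j) \<le> b"
  shows "finite (\<Union>j\<in>J. S j)" "card (\<Union>j\<in>J. S j) \<le> k * b"
proof -
  show "finite (\<Union>j\<in>J. S j)" using assms by auto
  have "card (\<Union>j\<in>J. S j) \<le> (\<Sum>j\<in>J. card (S j))" using assms(1) by (rule card_UN_le)
  also have "\<dots> \<le> card J * b" using assms(3) sum_bounded_above[of J "\<lambda>j. card (S j)" b] by simp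
  also have "\<dots> \<le> k * b" using assms(2) by simp
  finally show "card (\<Union>j\<in>J. S j) \<le> k * b" .
qed

lemma lcycle_finite_card:
  assumes "lcycle E n S" "\<And>e. e \<in> E \<Longrightarrow> card e = r" "r \<ge> 2" "n \<ge> 1"
  shows "finite S" "card S \<le> n * r"
proof -
  obtain a b S' e where c: "lpath E (n - 1) a b S'" "e \<in> E" "S = S' \<union> e"
    using assms(1) unfolding lcycle_def by auto
  have fin: "finite e" if "e \<in> E" for e using assms(2)[OF that] assms(3) by (intro card_ge_0_finite) simp
  show "finite S" using c(2,3) fin lpath_finite[OF c(1) fin] by auto
  have "card S \<le> card S' + card e" using c(3) card_Un_le by simp
  also have "\<dots> \<le> (n - 1) * r + r" using lpath_card[OF c(1), of r] assms(2) c(2) by force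
  also have "\<dots> = n * r" using assms(4) by (cases n) auto
  finally show "card S \<le> n * r" .
qed

locale expanded_union =
  fixes r k p :: nat and l ts :: "nat \<Rightarrow> nat" and Q :: "nat \<Rightarrow> (nat + nat set \<times> nat) hypergraph"
  assumes r: "r \<ge> 3" and k: "k \<ge> 1"
    and l: "\<And>i. i \<in> {1..k} \<Longrightarrow> l i \<ge> 5"
    and Q: "(\<forall>i\<in>{1..k}. Q i = expansion r (path_graph (l i))) \<or>
            (\<forall>i\<in>{1..k}. Q i = expansion r (cycle_graph (l i)))"
begin

definition F where
  "F = disjoint_union (disjoint_Union {1..k} Q) (disjoint_Union {1..p} (\<lambda>i. expansion r (star_graph (ts i))))"

text \<open>One bound for all component sizes. It is strict because a path is cut out of a cycle
  with one more edge.\<close>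

definition L where "L = Suc (sum l {1..k} + sum ts {1..p})"

lemma l_less_L: "i \<in> {1..k} \<Longrightarrow> l i < L"
  unfolding L_def using member_le_sum[of i "{1..k}" l] by simp

lemma ts_less_L: "i \<in> {1..p} \<Longrightarrow> ts i < L"
  unfolding L_def using member_le_sum[of i "{1..p}" ts] by simp

lemma Q_cases:
  assumes "i \<in> {1..k}"
  shows "Q i = expansion r (path_graph (l i)) \<or> Q i = expansion r (cycle_graph (l i))"
  using Q assms by blast

lemma embeds_F:
  assumes "\<And>i. i \<in> {1..k} \<Longrightarrow> embeds E (Q i) (S i)"
    "\<And>i j. i \<in> {1..k} \<Longrightarrow> j \<in> {1..k} \<Longrightarrow> i \<noteq> j \<Longrightarrow> S i \<inter> S j = {}"
    "\<And>i. i \<in> {1..p} \<Longrightarrow> embeds E (expansion r (star_graph (ts i))) (S' i)"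
    "\<And>i j. i \<in> {1..p} \<Longrightarrow> j \<in> {1..p} \<Longrightarrow> i \<noteq> j \<Longrightarrow> S' i \<inter> S' j = {}"
    "\<And>i. i \<in> {1..p} \<Longrightarrow> S' i \<inter> (\<Union>i\<in>{1..k}. S i) = {}"
  shows "embeds E F UNIV"
proof -
  have "embeds E (disjoint_Union {1..k} Q) (\<Union>i\<in>{1..k}. S i)"
    using assms by (intro embeds_disjoint_Union)
  moreover have "embeds E (disjoint_Union {1..p} (\<lambda>i. expansion r (star_graph (ts i)))) (\<Union>i\<in>{1..p}. S' i)"
    using assms by (intro embeds_disjoint_Union)
  moreover have "(\<Union>i\<in>{1..k}. S i) \<inter> (\<Union>i\<in>{1..p}. S' i) = {}" using assms(5) by blast
  ultimately show ?thesis
    unfolding F_def by (intro embeds_mono[OF embeds_disjoint_union]) auto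
qed

text \<open>In the application \<open>U\<close> consists of the values of constant colours, which cannot be replaced by
  fresh vertices. Every cycle uses at most two of them, so \<open>t \<ge> 3 * k - 1\<close> extensions always leave
  a free one.\<close>

lemma embeds_F_of_cycles:
  assumes E: "\<And>e. e \<in> E \<Longrightarrow> card e = r"
    and cyc: "\<And>W n. finite W \<Longrightarrow> card W \<le> (k + p) * (L * r) \<Longrightarrow> card (W \<inter> U) \<le> 2 * (k - 1) \<Longrightarrow>
      5 \<le> n \<Longrightarrow> n \<le> L \<Longrightarrow> \<exists>S. lcycle E n S \<and> S \<inter> W = {} \<and> card (S \<inter> U) \<le> 2"
    and star: "\<And>W n. finite W \<Longrightarrow> card W \<le> (k + p) * (L * r) \<Longrightarrow> n < L \<Longrightarrow>
      \<exists>S. embeds E (expansion r (star_graph n)) S \<and> S \<inter> W = {} \<and> finite S \<and> card S \<le> L * r"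
  shows "embeds E F UNIV"
proof -
  define P where "P i S \<longleftrightarrow> embeds E (Q i) S \<and> finite S \<and> card S \<le> L * r \<and> card (S \<inter> U) \<le> 2" for i S
  have "\<exists>S. (\<forall>i\<in>{1..k}. P i (S i)) \<and> (\<forall>i\<in>{1..k}. \<forall>j\<in>{1..k}. i \<noteq> j \<longrightarrow> S i \<inter> S j = {})"
  proof (rule disjoint_choice)
    fix J S i assume J: "J \<subseteq> {1..k}" and i: "i \<in> {1..k} - J" and S: "\<And>j. j \<in> J \<Longrightarrow> P j (S j)"
    define W where "W = (\<Union>j\<in>J. S j)"
    have "card J \<le> card ({1..k} - {i})" using J i by (intro card_mono) auto
    then have cJ: "card J \<le> k - 1" "finite J" using i J finite_subset by auto
    have W: "finite W" "card W \<le> (k - 1) * (L * r)"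
      unfolding W_def using finite_card_UN_le[OF cJ(2,1), of S "L * r"] S by (auto simp: P_def)
    have "(k - 1) * (L * r) \<le> (k + p) * (L * r)" by (intro mult_right_mono) auto
    then have W': "card W \<le> (k + p) * (L * r)" using W by linarith
    have "W \<inter> U = (\<Union>j\<in>J. S j \<inter> U)" by (auto simp: W_def)
    then have WU: "card (W \<inter> U) \<le> 2 * (k - 1)"
      using finite_card_UN_le(2)[OF cJ(2,1), of "\<lambda>j. S j \<inter> U" 2] S by (auto simp: P_def mult.commute)
    have li: "5 \<le> l i" "Suc (l i) \<le> L" using i l l_less_L[of i] by auto
    consider "Q i = expansion r (path_graph (l i))" | "Q i = expansion r (cycle_graph (l i))"
      using Q_cases i by blast
    then show "\<exists>S'. P i S' \<and> S' \<inter> (\<Union>j\<in>J. S j) = {}"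
    proof cases
      case 1
      \<comment> \<open>Dropping the closing edge of a cycle with \<open>l i + 1\<close> edges
        leaves the path.\<close>
      obtain S' where S': "lcycle E (Suc (l i)) S'" "S' \<inter> W = {}" "card (S' \<inter> U) \<le> 2"
        using cyc[OF W(1) W' WU, of "Suc (l i)"] li by auto
      then obtain a b S'' where S'': "lpath E (l i) a b S''" "S'' \<subseteq> S'" unfolding lcycle_def by auto
      have "finite S'" using lcycle_finite_card[OF S'(1) E] r by simp
      moreover from this have "card (S'' \<inter> U) \<le> card (S' \<inter> U)" using S''(2) by (intro card_mono) auto
      moreover have "card S'' \<le> L * r"
        using lpath_card[OF S''(1) E] li(2) by (meson Suc_leD le_trans mult_le_mono1)
      ultimately have "P i S''" unfolding P_def 1
        using embeds_path[OF S''(1) E] r S'(3) S''(2) finite_subset by auto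
      then show ?thesis using S''(2) S'(2) unfolding W_def by blast
    next
      case 2
      obtain S' where S': "lcycle E (l i) S'" "S' \<inter> W = {}" "card (S' \<inter> U) \<le> 2"
        using cyc[OF W(1) W' WU, of "l i"] li by auto
      have "finite S'" "card S' \<le> l i * r" using lcycle_finite_card[OF S'(1) E] r li by auto
      moreover have "l i * r \<le> L * r" using li(2) by (intro mult_right_mono) auto
      ultimately have "finite S'" "card S' \<le> L * r" using le_trans by blast+
      then have "P i S'" unfolding P_def 2
        using embeds_cycle[OF S'(1) E] r S'(3) li(1) by auto
      then show ?thesis using S'(2) unfolding W_def by blast
    qed
  qed simp
  then obtain S where S: "\<forall>i\<in>{1..k}. P i (S i)" "\<forall>i\<in>{1..k}. \<forall>j\<in>{1..k}. i \<noteq> j \<longrightarrow> S i \<inter> S j = {}"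
    by auto
  \<comment> \<open>The stars come last: only the cycles have to economise on
    \<open>U\<close>.\<close>
  define W1 where "W1 = (\<Union>i\<in>{1..k}. S i)"
  have W1: "finite W1" "card W1 \<le> k * (L * r)"
    unfolding W1_def using finite_card_UN_le[of "{1..k}" k S "L * r"] S(1) by (auto simp: P_def)
  define P' where "P' i S \<longleftrightarrow> embeds E (expansion r (star_graph (ts i))) S \<and> finite S \<and> card S \<le> L * r \<and>
    S \<inter> W1 = {}" for i S
  have "\<exists>S. (\<forall>i\<in>{1..p}. P' i (S i)) \<and> (\<forall>i\<in>{1..p}. \<forall>j\<in>{1..p}. i \<noteq> j \<longrightarrow> S i \<inter> S j = {})"
  proof (rule disjoint_choice)
    fix J S i assume J: "J \<subseteq> {1..p}" and i: "i \<in> {1..p} - J" and S: "\<And>j. j \<in> J \<Longrightarrow> P' j (S j)"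
    have cJ: "card J \<le> p" "finite J" using card_mono[OF _ J] J finite_subset by auto
    define W where "W = W1 \<union> (\<Union>j\<in>J. S j)"
    have "finite W" "card (\<Union>j\<in>J. S j) \<le> p * (L * r)"
      unfolding W_def using finite_card_UN_le[OF cJ(2,1), of S "L * r"] S W1 by (auto simp: P'_def)
    moreover from this have "card W \<le> (k + p) * (L * r)"
      using card_Un_le[of W1 "\<Union>j\<in>J. S j"] W1 unfolding W_def by (simp add: distrib_right)
    ultimately obtain S' where "embeds E (expansion r (star_graph (ts i))) S'" "S' \<inter> W = {}"
      "finite S'" "card S' \<le> L * r"
      using star[of W "ts i"] ts_less_L[of i] i by auto
    then have "P' i S' \<and> S' \<inter> (\<Union>j\<in>J. S j) = {}" unfolding P'_def W_def by blast
    then show "\<exists>S'. P' i S' \<and> S' \<inter> (\<Union>j\<in>J. S j) = {}" by blast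
  qed simp
  then obtain S' where S': "\<forall>i\<in>{1..p}. P' i (S' i)" "\<forall>i\<in>{1..p}. \<forall>j\<in>{1..p}. i \<noteq> j \<longrightarrow> S' i \<inter> S' j = {}"
    by auto
  show ?thesis
    by (rule embeds_F[of E S S']) (use S S' in \<open>auto simp: P_def P'_def W1_def\<close>)
qed

end

text \<open>The petals are chosen greedily, each avoiding the earlier ones; \<open>B\<close> pays
  for the forbidden set together with all petals.\<close>

lemma star_of_strong:
  assumes E: "\<And>e. e \<in> E \<Longrightarrow> card e = r" "r \<ge> 2"
    and strong: "\<And>W. finite W \<Longrightarrow> card W \<le> B \<Longrightarrow> y \<notin> W \<Longrightarrow> \<exists>e\<in>E. y \<in> e \<and> e \<inter> W = {}"
    and W: "finite W" "y \<notin> W" "card W + n * r \<le> B"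
  shows "\<exists>S. embeds E (expansion r (star_graph n)) S \<and> S \<inter> W = {} \<and> finite S \<and> card S \<le> Suc (n * r)"
proof -
  have fin: "finite e" if "e \<in> E" for e using E(1)[OF that] E(2) by (intro card_ge_0_finite) simp
  \<comment> \<open>Petals are stored without their centre, so that the greedy choice can make them
    disjoint.\<close>
  define P where "P i e \<longleftrightarrow> insert y e \<in> E \<and> y \<notin> e \<and> e \<inter> W = {}" for i :: nat and e
  have "\<exists>e. (\<forall>i\<in>{1..n}. P i (e i)) \<and> (\<forall>i\<in>{1..n}. \<forall>j\<in>{1..n}. i \<noteq> j \<longrightarrow> e i \<inter> e j = {})"
  proof (rule disjoint_choice)
    fix J e i assume J: "J \<subseteq> {1..n}" "i \<in> {1..n} - J" and e: "\<And>j. j \<in> J \<Longrightarrow> P j (e j)"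
    have cJ: "card J \<le> n" "finite J" using card_mono[OF _ J(1)] J finite_subset by auto
    have fe: "finite (e j) \<and> card (e j) \<le> r" if "j \<in> J" for j
    proof -
      have *: "insert y (e j) \<in> E" using e[OF that] by (simp add: P_def)
      show ?thesis using fin[OF *] E(1)[OF *] by (auto simp: card_insert_if split: if_splits)
    qed
    define W' where "W' = W \<union> (\<Union>j\<in>J. e j)"
    have "finite W'" "card (\<Union>j\<in>J. e j) \<le> n * r"
      unfolding W'_def using finite_card_UN_le[OF cJ(2,1), of e r] fe W(1) by auto
    moreover from this have "card W' \<le> B"
      using card_Un_le[of W "\<Union>j\<in>J. e j"] W(3) unfolding W'_def by linarith
    moreover have "y \<notin> W'" using W(2) e unfolding W'_def P_def by auto
    ultimately obtain e' where "e' \<in> E" "y \<in> e'" "e' \<inter> W' = {}" using strong by blast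
    then have "P i (e' - {y}) \<and> (e' - {y}) \<inter> (\<Union>j\<in>J. e j) = {}"
      unfolding P_def W'_def by (auto simp: insert_absorb)
    then show "\<exists>S'. P i S' \<and> S' \<inter> (\<Union>j\<in>J. e j) = {}" by blast
  qed simp
  then obtain e where e: "\<forall>i\<in>{1..n}. P i (e i)" "\<forall>i\<in>{1..n}. \<forall>j\<in>{1..n}. i \<noteq> j \<longrightarrow> e i \<inter> e j = {}" by auto
  define S where "S = insert y (\<Union>i\<in>{1..n}. insert y (e i))"
  have "embeds E (expansion r (star_graph n)) S"
    unfolding S_def by (rule embeds_star) (use e E in \<open>auto simp: P_def\<close>)
  moreover have "S \<inter> W = {}" using e W(2) by (auto simp: S_def P_def)
  moreover have "finite (\<Union>i\<in>{1..n}. insert y (e i))" "card (\<Union>i\<in>{1..n}. insert y (e i)) \<le> n * r"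
  proof -
    have "finite (insert y (e i)) \<and> card (insert y (e i)) \<le> r" if "i \<in> {1..n}" for i
    proof -
      have *: "insert y (e i) \<in> E" using e(1) that by (simp add: P_def)
      show ?thesis using fin[OF *] E(1)[OF *] by simp
    qed
    then show "finite (\<Union>i\<in>{1..n}. insert y (e i))" "card (\<Union>i\<in>{1..n}. insert y (e i)) \<le> n * r"
      using finite_card_UN_le[of "{1..n}" n "\<lambda>i. insert y (e i)" r] by auto
  qed
  moreover from this have "finite S" "card S \<le> Suc (n * r)" unfolding S_def by (auto simp: card_insert_if)
  ultimately show ?thesis by blast
qed

section \<open>Hypergraphs in which all extension numbers are large\<close>

definition ext :: "'a set set \<Rightarrow> 'a set \<Rightarrow> 'a set" where
  "ext E A = {v. v \<notin> A \<and> insert v A \<in> E}"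

text \<open>A lower bound on the positive codegrees: only sets obtained from an edge by removing a
  vertex are constrained.\<close>

definition full :: "nat \<Rightarrow> 'a set set \<Rightarrow> bool" where
  "full d E \<longleftrightarrow> (\<forall>e\<in>E. \<forall>x\<in>e. d \<le> card (ext E (e - {x})))"

text \<open>The vertices of \<open>e\<close> in \<open>W\<close> are exchanged one at a time for
  extensions outside \<open>W\<close>. Those of \<open>A\<close> are never touched, and fewer than
  \<open>N\<close> forbidden vertices leave a choice each time.\<close>

lemma full_avoid:
  assumes full: "full N E" and fin: "\<And>e. e \<in> E \<Longrightarrow> finite e"
    and W: "finite W" "card W < N" "W \<inter> A = {}" and e: "e \<in> E" "A \<subseteq> e"
  shows "\<exists>e'\<in>E. A \<subseteq> e' \<and> e' \<inter> W = {}"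
  using e
proof (induction "card (e \<inter> W)" arbitrary: e rule: less_induct)
  case less
  show ?case
  proof (cases "e \<inter> W = {}")
    case True
    then show ?thesis using less.prems by blast
  next
    case False
    then obtain x where x: "x \<in> e" "x \<in> W" by blast
    have "N \<le> card (ext E (e - {x}))" using full less.prems(1) x unfolding full_def by blast
    then have "\<not> ext E (e - {x}) \<subseteq> W" using W card_mono[of W "ext E (e - {x})"] by auto
    then obtain v where v: "v \<notin> W" "insert v (e - {x}) \<in> E" by (auto simp: ext_def)
    have "insert v (e - {x}) \<inter> W \<subset> e \<inter> W" using x v by auto
    then have "card (insert v (e - {x}) \<inter> W) < card (e \<inter> W)" using W(1) by (intro psubset_card_mono) auto
    moreover have "A \<subseteq> insert v (e - {x})" using less.prems(2) x W(3) by auto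
    ultimately show ?thesis using less.hyps v(2) by blast
  qed
qed

text \<open>As \<open>r \<ge> 3\<close>, an edge through \<open>a\<close> and \<open>b\<close> has a
  third vertex \<open>z\<close>. An edge through \<open>a\<close> and \<open>z\<close> that avoids
  \<open>b\<close> is the first step, and the old edge, which contains \<open>z\<close> and
  \<open>b\<close>, keeps the induction going.\<close>

lemma full_lpath:
  assumes full: "full N E" and E: "\<And>e. e \<in> E \<Longrightarrow> card e = r" and r: "r \<ge> 3"
    and "e \<in> E" "a \<in> e" "b \<in> e" "a \<noteq> b" "finite W" "a \<notin> W" "b \<notin> W" "n \<ge> 1" "card W + n * r < N"
  shows "\<exists>S. lpath E n a b S \<and> S \<inter> W = {}"
proof -
  have fin: "finite e" if "e \<in> E" for e using E[OF that] r by (intro card_ge_0_finite) simp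
  note avoid = full_avoid[OF full fin]
  show ?thesis using assms(4-)
  proof (induction n arbitrary: e a W)
    case (Suc n)
    have "\<exists>e'\<in>E. {a, b} \<subseteq> e' \<and> e' \<inter> W = {}"
      using Suc.prems by (intro avoid[of W _ e]) auto
    then obtain e' where e': "e' \<in> E" "a \<in> e'" "b \<in> e'" "e' \<inter> W = {}" by blast
    show ?case
    proof (cases "n = 0")
      case True
      then show ?thesis using lpath.single[OF e'(1-3)] Suc.prems(4) e'(4) by auto
    next
      case False
      have "\<not> e' \<subseteq> {a, b}"
        using card_mono[of "{a, b}" e'] E[OF e'(1)] r Suc.prems(4) by auto
      then obtain z where z: "z \<in> e'" "z \<noteq> a" "z \<noteq> b" by blast
      have zW: "z \<notin> W" using z e' by blast
      have "\<exists>e1\<in>E. {a, z} \<subseteq> e1 \<and> e1 \<inter> insert b W = {}"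
        using Suc.prems e' z zW r by (intro avoid[of _ _ e']) (auto simp: card_insert_if)
      then obtain e1 where e1: "e1 \<in> E" "a \<in> e1" "z \<in> e1" "e1 \<inter> insert b W = {}" by blast
      define W' where "W' = W \<union> (e1 - {z})"
      have "card W' \<le> card W + r"
        unfolding W'_def using card_Un_le[of W "e1 - {z}"] card_Diff1_le[of e1 z] E[OF e1(1)] by linarith
      then have "\<exists>S. lpath E n z b S \<and> S \<inter> W' = {}"
        using e' z e1 zW Suc.prems False fin[OF e1(1)]
        by (intro Suc.IH[of e' z W']) (auto simp: W'_def)
      then obtain S where S: "lpath E n z b S" "S \<inter> W' = {}" by blast
      have "e1 \<inter> S = {z}" using S(2) lpath_ends[OF S(1)] e1(3) unfolding W'_def by blast
      then have "lpath E (Suc n) a b (e1 \<union> S)" using e1 z S(1) by (intro lpath.step) auto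
      moreover have "(e1 \<union> S) \<inter> W = {}" using S(2) e1(4) by (auto simp: W'_def)
      ultimately show ?thesis by blast
    qed
  qed simp
qed

text \<open>A cycle of any length arises by joining two vertices of an edge by a loose path that
  avoids the rest of the edge. \<open>N\<close> leaves room for all earlier components and the
  current one; \<open>U\<close> is empty because every vertex can be replaced.\<close>

lemma (in expanded_union) embeds_F_of_full:
  assumes E: "\<And>e. e \<in> E \<Longrightarrow> card e = r" and "E \<noteq> {}"
    and N: "N > (k + p) * (L * r) + 2 * (L * r)" and full: "full N E"
  shows "embeds E F UNIV"
proof (rule embeds_F_of_cycles[where U = "{}"])
  have fin: "finite e" if "e \<in> E" for e using E[OF that] r by (intro card_ge_0_finite) simp
  note avoid = full_avoid[OF full fin]
  obtain e0 where e0: "e0 \<in> E" using assms by blast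
  fix W :: "'a set" and n
  assume W: "finite W" "card W \<le> (k + p) * (L * r)"
  obtain e where e: "e \<in> E" "e \<inter> W = {}" using avoid[of W "{}" e0] W N e0 by auto
  {
    assume n: "5 \<le> n" "n \<le> L"
    have nr: "n * r \<le> L * r" using n by simp
    obtain a b where ab: "a \<in> e" "b \<in> e" "a \<noteq> b"
      using E[OF e(1)] r by (metis card_le_Suc0_iff_eq fin e(1) not_numeral_le_zero numeral_le_one_iff One_nat_def le_trans semiring_norm(70))
    define W' where "W' = W \<union> (e - {a, b})"
    have "card (e - {a, b}) \<le> r" using E[OF e(1)] fin[OF e(1)] card_mono[of e "e - {a, b}"] by auto
    then have "card W' \<le> card W + r"
      unfolding W'_def using card_Un_le[of W "e - {a, b}"] by linarith
    moreover have "r + (n - 1) * r = n * r" using n by (cases n) auto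
    ultimately have "card W' + (n - 1) * r < N" using W(2) N nr by linarith
    then have "\<exists>S. lpath E (n - 1) a b S \<and> S \<inter> W' = {}"
      using n ab e W fin[OF e(1)] by (intro full_lpath[OF full E r e(1)]) (auto simp: W'_def)
    then obtain S where S: "lpath E (n - 1) a b S" "S \<inter> W' = {}" by blast
    have "e \<inter> S = {a, b}" using S(2) lpath_ends[OF S(1)] ab unfolding W'_def by blast
    then have "lcycle E n (S \<union> e)" unfolding lcycle_def using S e by blast
    moreover have "(S \<union> e) \<inter> W = {}" using S(2) e(2) unfolding W'_def by blast
    ultimately show "\<exists>S. lcycle E n S \<and> S \<inter> W = {} \<and> card (S \<inter> {}) \<le> 2" by (metis card.empty inf_bot_right zero_le)
  }
  {
    assume n: "n < L"
    have nr: "n * r + r \<le> L * r" using n by (metis Suc_leI mult_Suc mult_le_mono1 add.commute)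
    have "e \<noteq> {}" using E[OF e(1)] r by auto
    then obtain y where y: "y \<in> e" by blast
    have "\<exists>S. embeds E (expansion r (star_graph n)) S \<and> S \<inter> W = {} \<and> finite S \<and> card S \<le> Suc (n * r)"
    proof (rule star_of_strong[where y = y and B = "N - 1"])
      show "\<exists>e\<in>E. y \<in> e \<and> e \<inter> W' = {}" if "finite W'" "card W' \<le> N - 1" "y \<notin> W'" for W'
        using avoid[of W' "{y}" e] that e(1) y N by auto
    qed (use E r y e W N nr in auto)
    then show "\<exists>S. embeds E (expansion r (star_graph n)) S \<and> S \<inter> W = {} \<and> finite S \<and> card S \<le> L * r"
      using nr r by force
  }
qed (use E in auto)


section \<open>Reservoirs of linked vertices\<close>

lemma lpath_rev: "lpath E n a b S \<Longrightarrow> lpath E n b a S"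
proof (induction rule: lpath.induct)
  case (single e a b)
  then show ?case by (auto intro: lpath.single)
next
  case (step e a b S n c)
  have "b \<in> e" using step.hyps(4) by blast
  then have "lpath E (Suc 0) b a e" using step.hyps(1-3) by (intro lpath.single) auto
  then have "lpath E (n + Suc 0) c a (S \<union> e)"
    using step.hyps(4) step.IH by (intro lpath_concat) (auto simp: Int_commute)
  then show ?case by (simp add: Un_commute)
qed

lemma lpath_2:
  assumes "e1 \<in> E" "e2 \<in> E" "a \<in> e1" "b \<in> e2" "e1 \<inter> e2 = {x}" "a \<noteq> x" "b \<noteq> x"
  shows "lpath E 2 a b (e1 \<union> e2)"
proof -
  have "x \<in> e1" "x \<in> e2" using assms(5) by blast+
  then have "lpath E (Suc 0 + Suc 0) a b (e1 \<union> e2)"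
    using assms by (intro lpath_concat lpath.single) auto
  then show ?thesis by (simp add: numeral_2_eq_2)
qed

lemma lpath_3:
  assumes "e1 \<in> E" "e2 \<in> E" "e3 \<in> E" "a \<in> e1" "b \<in> e3" "e1 \<inter> e2 = {x}" "e2 \<inter> e3 = {z}" "e1 \<inter> e3 = {}"
    "a \<noteq> x" "b \<noteq> z"
  shows "lpath E 3 a b (e1 \<union> e2 \<union> e3)"
proof -
  have *: "x \<in> e1" "x \<in> e2" "z \<in> e2" "z \<in> e3" using assms(6,7) by blast+
  then have "x \<noteq> z" using assms(8) by blast
  have "lpath E 2 a z (e1 \<union> e2)" using assms * \<open>x \<noteq> z\<close> by (intro lpath_2) auto
  moreover have "lpath E (Suc 0) z b e3" using assms * by (intro lpath.single) auto
  moreover have "(e1 \<union> e2) \<inter> e3 = {z}" using assms(7,8) by (auto simp: Int_Un_distrib2)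
  ultimately have "lpath E (2 + Suc 0) a b (e1 \<union> e2 \<union> e3)" by (rule lpath_concat)
  then show ?thesis by (simp add: numeral_3_eq_3 numeral_2_eq_2)
qed

text \<open>A reservoir \<open>Y\<close> of vertices any two of which are joined by a loose path of length two avoiding
  a prescribed small set. The path into \<open>y'\<close> may be forced through a companion of \<open>y'\<close>: then
  \<open>\<rho> y'\<close> consists of this companion, and it has to be kept free as well.\<close>

locale linked =
  fixes E :: "'a set set" and r B :: nat and Y :: "'a set" and \<rho> :: "'a \<Rightarrow> 'a set"
  assumes E: "\<And>e. e \<in> E \<Longrightarrow> card e = r" and r: "r \<ge> 3"
    and rho: "\<And>y. finite (\<rho> y) \<and> card (\<rho> y) \<le> 1"
    and new: "\<And>W. finite W \<Longrightarrow> card W \<le> B \<Longrightarrow> \<exists>y\<in>Y. y \<notin> W \<and> \<rho> y \<inter> W = {}"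
    and two: "\<And>W y y'. finite W \<Longrightarrow> card W \<le> B \<Longrightarrow> y \<in> Y \<Longrightarrow> y' \<in> Y \<Longrightarrow> y \<noteq> y' \<Longrightarrow> y \<notin> \<rho> y' \<Longrightarrow>
      y \<notin> W \<Longrightarrow> y' \<notin> W \<Longrightarrow> \<rho> y' \<inter> W = {} \<Longrightarrow> \<exists>S. lpath E 2 y y' S \<and> S \<inter> W = {}"
begin

lemma fin: "e \<in> E \<Longrightarrow> finite e"
  using E[of e] r by (intro card_ge_0_finite) simp

text \<open>Links of length two are concatenated through fresh reservoir vertices. Every earlier
  link has to leave \<open>y'\<close> and its companion free for the last one. The budget per link
  is \<open>2 * r\<close> for its vertices and 3 for \<open>y\<close>, \<open>y'\<close> and
  \<open>\<rho> y'\<close>.\<close>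

lemma chain:
  assumes "n \<ge> 1" "finite W" "card W + n * (2 * r + 3) \<le> B" "y \<in> Y" "y' \<in> Y" "y \<noteq> y'" "y \<notin> \<rho> y'"
      "y \<notin> W" "y' \<notin> W" "\<rho> y' \<inter> W = {}"
  shows "\<exists>S. lpath E (2 * n) y y' S \<and> S \<inter> W = {}"
  using assms
proof (induction n arbitrary: y W)
  case (Suc n)
  show ?case
  proof (cases "n = 0")
    case True
    then show ?thesis using two[of W y y'] Suc.prems by auto
  next
    case False
    define W1 where "W1 = W \<union> ({y, y'} \<union> \<rho> y')"
    have "card ({y, y'} \<union> \<rho> y') \<le> 3"
      using card_Un_le[of "{y, y'}" "\<rho> y'"] rho[of y'] card_insert_le_m1[of 2 "{y'}" y] by auto
    then have W1: "finite W1" "card W1 \<le> card W + 3"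
      using card_Un_le[of W "{y, y'} \<union> \<rho> y'"] rho[of y'] Suc.prems(2) unfolding W1_def by auto
    have "card W1 \<le> B" using W1(2) Suc.prems(3) by simp
    then obtain z where z: "z \<in> Y" "z \<notin> W1" "\<rho> z \<inter> W1 = {}" using new[OF W1(1)] by blast
    define W2 where "W2 = W \<union> ({y'} \<union> \<rho> y')"
    have "W2 \<subseteq> W1" by (auto simp: W1_def W2_def)
    then have W2: "finite W2" "card W2 \<le> B" "W2 \<subseteq> W1"
      using W1(1) \<open>card W1 \<le> B\<close> card_mono[of W1 W2] by (auto intro: finite_subset)
    have "y \<notin> W2" using Suc.prems by (auto simp: W2_def)
    moreover have "y \<notin> \<rho> z" "y \<noteq> z" "z \<notin> W2" "\<rho> z \<inter> W2 = {}" using z W2(3) by (auto simp: W1_def)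
    ultimately obtain S1 where S1: "lpath E 2 y z S1" "S1 \<inter> W2 = {}"
      using two[OF W2(1,2) Suc.prems(4) z(1)] by blast
    define W3 where "W3 = W \<union> (S1 - {z})"
    have S1c: "finite S1" "card S1 \<le> 2 * r" using lpath_finite[OF S1(1)] lpath_card[OF S1(1) E] fin by auto
    then have "card (S1 - {z}) \<le> 2 * r" using card_Diff1_le[of S1 z] by linarith
    then have "card W3 \<le> card W + 2 * r"
      using card_Un_le[of W "S1 - {z}"] unfolding W3_def by linarith
    then have "\<exists>S. lpath E (2 * n) z y' S \<and> S \<inter> W3 = {}"
      using Suc.prems z S1 S1c False
      by (intro Suc.IH[of W3 z]) (auto simp: W3_def W1_def W2_def)
    then obtain S where S: "lpath E (2 * n) z y' S" "S \<inter> W3 = {}" by blast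
    have "S1 \<inter> S = {z}" using S(2) lpath_ends[OF S1(1)] lpath_ends[OF S(1)] unfolding W3_def by blast
    then have "lpath E (2 + 2 * n) y y' (S1 \<union> S)" using S1(1) S(1) by (intro lpath_concat)
    moreover have "(S1 \<union> S) \<inter> W = {}" using S(2) S1(2) unfolding W3_def W2_def by blast
    ultimately show ?thesis by auto
  qed
qed simp

text \<open>The cycle is closed by a chain back to \<open>y\<close>, so the first link already has
  to spare the companion of \<open>y\<close>.\<close>

lemma even_cycle:
  assumes W: "finite W" "card W + (n + 2) * (2 * r + 3) \<le> B" and n: "n \<ge> 1"
  shows "\<exists>S. lcycle E (2 * n + 2) S \<and> S \<inter> W = {}"
proof -
  obtain y where y: "y \<in> Y" "y \<notin> W" "\<rho> y \<inter> W = {}" using new[OF W(1)] W(2) by fastforce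
  define W1 where "W1 = W \<union> ({y} \<union> \<rho> y)"
  have "card ({y} \<union> \<rho> y) \<le> 2" using card_Un_le[of "{y}" "\<rho> y"] rho[of y] by auto
  then have W1: "finite W1" "card W1 \<le> card W + 2"
    using card_Un_le[of W "{y} \<union> \<rho> y"] rho[of y] W(1) unfolding W1_def by auto
  then have "card W1 \<le> B" using W(2) by simp
  then obtain y' where y': "y' \<in> Y" "y' \<notin> W1" "\<rho> y' \<inter> W1 = {}" using new[OF W1(1)] by blast
  \<comment> \<open>\<open>y\<close> is the start of the first link and must stay allowed, even if
    it should lie in \<open>\<rho> y\<close>.\<close>
  define W2 where "W2 = W \<union> (\<rho> y - {y})"
  have "W2 \<subseteq> W1" by (auto simp: W1_def W2_def)
  then have W2: "finite W2" "card W2 \<le> B"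
    using W1(1) \<open>card W1 \<le> B\<close> card_mono[of W1 W2] by (auto intro: finite_subset)
  have "y \<noteq> y'" "y \<notin> \<rho> y'" "y \<notin> W2" "y' \<notin> W2" "\<rho> y' \<inter> W2 = {}"
    using y y' by (auto simp: W1_def W2_def)
  then obtain S2 where S2: "lpath E 2 y y' S2" "S2 \<inter> W2 = {}"
    using two[OF W2 y(1) y'(1)] by blast
  define W3 where "W3 = W \<union> (S2 - {y, y'})"
  have S2c: "finite S2" "card S2 \<le> 2 * r" using lpath_finite[OF S2(1)] lpath_card[OF S2(1) E] fin by auto
  then have "card (S2 - {y, y'}) \<le> 2 * r" using card_mono[of S2 "S2 - {y, y'}"] by auto
  then have W3: "card W3 \<le> card W + 2 * r"
    using card_Un_le[of W "S2 - {y, y'}"] unfolding W3_def by linarith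
  have "\<rho> y \<inter> W3 = {}"
    using y(3) S2(2) unfolding W3_def W2_def by blast
  then have "\<exists>S. lpath E (2 * n) y' y S \<and> S \<inter> W3 = {}"
    using W W3 y y' \<open>y \<noteq> y'\<close> S2c(1) n
    by (intro chain) (auto simp: W3_def W1_def)
  then obtain S where S: "lpath E (2 * n) y' y S" "S \<inter> W3 = {}" by blast
  have "S2 \<inter> S = {y, y'}"
    using S(2) lpath_ends[OF S2(1)] lpath_ends[OF S(1)] unfolding W3_def by blast
  then have "lcycle E (2 + 2 * n) (S2 \<union> S)" using S2(1) S(1) n by (intro lcycle_join) auto
  moreover have "(S2 \<union> S) \<inter> W = {}" using S(2) S2(2) unfolding W3_def W2_def by blast
  ultimately show ?thesis by (metis add.commute)
qed

text \<open>Links of length two give the even lengths. One link of length three changes the parity;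
  closed by at least one further link it gives the odd lengths from 5 on. Only the link of length
  three may meet \<open>U\<close>.\<close>

lemma cycles:
  assumes U: "finite U"
    and three: "\<And>W. finite W \<Longrightarrow> card W \<le> B \<Longrightarrow> card (W \<inter> U) \<le> b \<Longrightarrow>
      \<exists>y y' S. y \<in> Y \<and> y' \<in> Y \<and> lpath E 3 y y' S \<and> S \<inter> W = {} \<and> y \<notin> \<rho> y' \<and> \<rho> y' \<inter> (W \<union> U \<union> S) = {} \<and>
        y \<notin> U \<and> y' \<notin> U \<and> card (S \<inter> U) \<le> 2"
    and W: "finite W" "card W + card U + (n + 2) * (2 * r + 3) \<le> B" "card (W \<inter> U) \<le> b" and n: "n \<ge> 5"
  shows "\<exists>S. lcycle E n S \<and> S \<inter> W = {} \<and> card (S \<inter> U) \<le> 2"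
proof (cases "even n")
  case True
  then obtain h where h: "n = 2 * h" by (elim evenE)
  have hn: "h - 1 + 2 \<le> n + 2" using h n by linarith
  have "card (W \<union> U) \<le> card W + card U" by (rule card_Un_le)
  moreover have "(h - 1 + 2) * (2 * r + 3) \<le> (n + 2) * (2 * r + 3)" using hn by (rule mult_right_mono) simp
  ultimately have "card (W \<union> U) + (h - 1 + 2) * (2 * r + 3) \<le> B" using W(2) by linarith
  then obtain S where S: "lcycle E (2 * (h - 1) + 2) S" "S \<inter> (W \<union> U) = {}"
    using even_cycle[of "W \<union> U" "h - 1"] W(1) U h n by force
  have "2 * (h - 1) + 2 = n" using h n by simp
  moreover have "S \<inter> U = {}" "S \<inter> W = {}" using S(2) by blast+
  ultimately show ?thesis using S(1) by (metis card.empty zero_le)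
next
  case False
  define h where "h = (n - 3) div 2"
  have h: "n = 3 + 2 * h" "h \<ge> 1" using False n unfolding h_def by presburger+
  have "card W \<le> B" using W(2) by linarith
  then obtain y y' S where S: "y \<in> Y" "y' \<in> Y" "lpath E 3 y y' S" "S \<inter> W = {}" "y \<notin> \<rho> y'"
    "\<rho> y' \<inter> (W \<union> U \<union> S) = {}" "y \<notin> U" "y' \<notin> U" "card (S \<inter> U) \<le> 2"
    using three[OF W(1) _ W(3)] by blast
  define W' where "W' = W \<union> U \<union> (S - {y, y'})"
  have Sc: "finite S" "card S \<le> 3 * r" using lpath_finite[OF S(3)] lpath_card[OF S(3) E] fin by auto
  then have "card (S - {y, y'}) \<le> 3 * r" using card_mono[of S "S - {y, y'}"] by auto
  then have "card W' \<le> card W + card U + 3 * r"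
    using card_Un_le[of "W \<union> U" "S - {y, y'}"] card_Un_le[of W U] unfolding W'_def by linarith
  moreover have "(h + 2) * (2 * r + 3) \<le> (n + 2) * (2 * r + 3)" using h(1) by (intro mult_right_mono) auto
  ultimately have "card W' + h * (2 * r + 3) \<le> B" using W(2) by (simp add: algebra_simps)
  moreover have "finite W'" using Sc W(1) U by (auto simp: W'_def)
  moreover have "y \<noteq> y'" "y \<in> S" "y' \<in> S" using lpath_ends[OF S(3)] by auto
  ultimately have "\<exists>S'. lpath E (2 * h) y y' S' \<and> S' \<inter> W' = {}"
    using S h(2) by (intro chain) (auto simp: W'_def)
  then obtain S' where S': "lpath E (2 * h) y y' S'" "S' \<inter> W' = {}" by blast
  have "S \<inter> S' = {y, y'}"
    using S'(2) lpath_ends[OF S(3)] lpath_ends[OF S'(1)] unfolding W'_def by blast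
  then have "lcycle E (3 + 2 * h) (S \<union> S')"
    using S(3) lpath_rev[OF S'(1)] h(2) by (intro lcycle_join) auto
  moreover have "(S \<union> S') \<inter> U = S \<inter> U" "(S \<union> S') \<inter> W = {}" using S'(2) S(4) unfolding W'_def by blast+
  ultimately show ?thesis using h(1) S(9) by metis
qed

end


section \<open>Coloured grids\<close>

text \<open>The colours \<open>v i\<close> are the \<open>t + 1\<close> extensions; \<open>I\<close>
  may contain further colours. The lower bound on \<open>card (Y j)\<close> accounts for
  \<open>B\<close> vertices forbidden directly and at most \<open>B\<close> more through each
  colour.\<close>

locale colour_grid =
  fixes E :: "'a set set" and r q B t :: nat and Y :: "nat \<Rightarrow> 'a set" and I :: "'i set"
    and c :: "'i \<Rightarrow> (nat \<Rightarrow> 'a) \<Rightarrow> 'a" and v :: "nat \<Rightarrow> 'i"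
  assumes E: "\<And>e. e \<in> E \<Longrightarrow> card e = r" and r: "r \<ge> 3" and q: "r = Suc q"
    and I: "finite I" and vI: "\<And>i. i \<le> t \<Longrightarrow> v i \<in> I"
    and card_Y: "\<And>j. j < q \<Longrightarrow> B * Suc (card I) < card (Y j)"
    and hom: "\<And>i j. i \<in> I \<Longrightarrow> j < q \<Longrightarrow> indep_coord q Y (c i) j \<or> dep_coord q Y (c i) j"
    and inj: "\<And>f. f \<in> PiE {..<q} Y \<Longrightarrow> inj_on f {..<q}"
    and v_edge: "\<And>f i. f \<in> PiE {..<q} Y \<Longrightarrow> i \<le> t \<Longrightarrow> insert (c (v i) f) (f ` {..<q}) \<in> E"
    and v_notin: "\<And>f i. f \<in> PiE {..<q} Y \<Longrightarrow> i \<le> t \<Longrightarrow> c (v i) f \<notin> f ` {..<q}"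
    and v_inj: "\<And>f i i'. f \<in> PiE {..<q} Y \<Longrightarrow> i \<le> t \<Longrightarrow> i' \<le> t \<Longrightarrow> i \<noteq> i' \<Longrightarrow> c (v i) f \<noteq> c (v i') f"
begin

abbreviation "Grid \<equiv> PiE {..<q} Y"

abbreviation indep_on :: "'i \<Rightarrow> nat \<Rightarrow> bool" where "indep_on i j \<equiv> indep_coord q Y (c i) j"

abbreviation dep_on :: "'i \<Rightarrow> nat \<Rightarrow> bool" where "dep_on i j \<equiv> dep_coord q Y (c i) j"

definition const :: "'i \<Rightarrow> bool" where "const i \<longleftrightarrow> (\<forall>j<q. indep_on i j)"

text \<open>A good vertex in a single coordinate on which a colour depends already keeps the value
  of that colour off \<open>W\<close>, whatever the other coordinates are.\<close>

definition good :: "'a set \<Rightarrow> nat \<Rightarrow> 'a \<Rightarrow> bool" where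
  "good W j a \<longleftrightarrow> a \<in> Y j \<and> a \<notin> W \<and> (\<forall>i\<in>I. dep_on i j \<longrightarrow> (\<forall>f\<in>Grid. f j = a \<longrightarrow> c i f \<notin> W))"

definition edge :: "nat \<Rightarrow> (nat \<Rightarrow> 'a) \<Rightarrow> 'a set" where
  "edge i f = insert (c (v i) f) (f ` {..<q})"

lemma q2: "q \<ge> 2"
  using q r by simp

lemma fin: "e \<in> E \<Longrightarrow> finite e"
  using E[of e] r by (intro card_ge_0_finite) simp

lemma edge_in: "f \<in> Grid \<Longrightarrow> i \<le> t \<Longrightarrow> edge i f \<in> E"
  unfolding edge_def by (rule v_edge)

lemma finite_Y: "j < q \<Longrightarrow> finite (Y j)"
  using card_Y[of j] by (intro card_ge_0_finite) simp

text \<open>A colour that determines the coordinate takes a given value for at most one vertex of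
  the part, so every element of \<open>W\<close> spoils at most one.\<close>

lemma card_bad:
  assumes "dep_on i j" "finite W"
  shows "finite {a. \<exists>f\<in>Grid. f j = a \<and> c i f \<in> W}" "card {a. \<exists>f\<in>Grid. f j = a \<and> c i f \<in> W} \<le> card W"
proof -
  define A where "A = {a. \<exists>f\<in>Grid. f j = a \<and> c i f \<in> W}"
  have "\<forall>a\<in>A. \<exists>f. f \<in> Grid \<and> f j = a \<and> c i f \<in> W" by (auto simp: A_def)
  then obtain g where g: "\<And>a. a \<in> A \<Longrightarrow> g a \<in> Grid \<and> g a j = a \<and> c i (g a) \<in> W" by metis
  have inj: "inj_on (\<lambda>a. c i (g a)) A"
    using assms(1) g unfolding inj_on_def dep_coord_def by metis
  have sub: "(\<lambda>a. c i (g a)) ` A \<subseteq> W" using g by auto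
  show "finite {a. \<exists>f\<in>Grid. f j = a \<and> c i f \<in> W}"
    using inj_on_finite[OF inj sub assms(2)] by (simp add: A_def)
  show "card {a. \<exists>f\<in>Grid. f j = a \<and> c i f \<in> W} \<le> card W"
    using card_inj_on_le[OF inj sub assms(2)] by (simp add: A_def)
qed

lemma ex_good:
  assumes W: "finite W" "card W \<le> B" and j: "j < q"
  shows "\<exists>a. good W j a"
proof -
  define bad where "bad i = {a. \<exists>f\<in>Grid. f j = a \<and> c i f \<in> W}" for i
  define D where "D = {i \<in> I. dep_on i j}"
  have D: "finite D" "card D \<le> card I" using I by (auto simp: D_def intro: card_mono)
  have "finite (bad i) \<and> card (bad i) \<le> B" if "i \<in> D" for i
    using card_bad[of i j W] that W unfolding D_def bad_def by auto
  then have UN: "finite (\<Union>i\<in>D. bad i)" "card (\<Union>i\<in>D. bad i) \<le> card I * B"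
    using finite_card_UN_le[OF D, of bad B] by auto
  have "card (W \<union> (\<Union>i\<in>D. bad i)) \<le> B + card I * B"
    using card_Un_le[of W "\<Union>i\<in>D. bad i"] UN W by linarith
  then have "card (W \<union> (\<Union>i\<in>D. bad i)) < card (Y j)" using card_Y[OF j] by (simp add: mult.commute)
  then have "\<not> Y j \<subseteq> W \<union> (\<Union>i\<in>D. bad i)"
    using card_mono[of "W \<union> (\<Union>i\<in>D. bad i)" "Y j"] UN W by auto
  then obtain a where "a \<in> Y j" "a \<notin> W" "\<And>i. i \<in> D \<Longrightarrow> a \<notin> bad i" by blast
  then have "good W j a" unfolding good_def D_def bad_def by auto
  then show ?thesis by blast
qed

lemma good_in: "good W j a \<Longrightarrow> a \<in> Y j" "good W j a \<Longrightarrow> a \<notin> W"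
  by (auto simp: good_def)

lemma good_avoid: "good W j (f j) \<Longrightarrow> i \<in> I \<Longrightarrow> dep_on i j \<Longrightarrow> f \<in> Grid \<Longrightarrow> c i f \<notin> W"
  by (auto simp: good_def)

lemma nonconst_avoid:
  assumes "i \<in> I" "\<not> const i" "f \<in> Grid" "\<And>j. j < q \<Longrightarrow> good W j (f j)"
  shows "c i f \<notin> W"
proof -
  obtain j where "j < q" "\<not> indep_on i j" using assms(2) by (auto simp: const_def)
  then have "dep_on i j" using hom assms(1) by blast
  then show ?thesis using good_avoid assms \<open>j < q\<close> by blast
qed

lemma extend:
  assumes W: "finite W" "card W \<le> B" and g: "\<And>j. j \<in> P \<Longrightarrow> j < q \<Longrightarrow> g j \<in> Y j"
  shows "\<exists>f\<in>Grid. (\<forall>j<q. j \<in> P \<longrightarrow> f j = g j) \<and> (\<forall>j<q. j \<notin> P \<longrightarrow> good W j (f j))"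
proof -
  have "\<forall>j. \<exists>a. j < q \<longrightarrow> good W j a" using ex_good[OF W] by blast
  then obtain h where h: "\<And>j. j < q \<Longrightarrow> good W j (h j)" by metis
  define f where "f = (\<lambda>j\<in>{..<q}. if j \<in> P then g j else h j)"
  have "(if j \<in> P then g j else h j) \<in> Y j" if "j < q" for j
    using g[OF _ that] good_in(1)[OF h[OF that]] by simp
  then have "f \<in> Grid" unfolding f_def by (simp add: restrict_PiE_iff)
  then show ?thesis using h by (intro bexI[of _ f]) (simp_all add: f_def)
qed

lemma extend0:
  assumes "finite W" "card W \<le> B"
  shows "\<exists>f. f \<in> Grid \<and> (\<forall>j<q. good W j (f j))"
proof -
  have "\<exists>f\<in>Grid. (\<forall>j<q. j \<in> {} \<longrightarrow> f j = undefined) \<and> (\<forall>j<q. j \<notin> {} \<longrightarrow> good W j (f j))"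
    by (rule extend[OF assms]) simp
  then obtain f where "f \<in> Grid" "\<forall>j<q. j \<notin> {} \<longrightarrow> good W j (f j)"
    by (elim bexE conjE) (rule that)
  then show ?thesis by (intro exI[of _ f]) simp
qed

lemma extend2:
  assumes "finite W" "card W \<le> B" "j < q" "j' < q" "j = j' \<Longrightarrow> a = a'" "a \<in> Y j" "a' \<in> Y j'"
  shows "\<exists>f. f \<in> Grid \<and> f j = a \<and> f j' = a' \<and> (\<forall>i<q. i \<noteq> j \<longrightarrow> i \<noteq> j' \<longrightarrow> good W i (f i))"
proof -
  have "\<exists>f\<in>Grid. (\<forall>i<q. i \<in> {j, j'} \<longrightarrow> f i = (if i = j then a else a')) \<and>
      (\<forall>i<q. i \<notin> {j, j'} \<longrightarrow> good W i (f i))"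
    using assms(3-) by (intro extend[OF assms(1,2)]) auto
  then obtain f where f: "f \<in> Grid" "\<forall>i<q. i \<in> {j, j'} \<longrightarrow> f i = (if i = j then a else a')"
    "\<forall>i<q. i \<notin> {j, j'} \<longrightarrow> good W i (f i)" by (elim bexE conjE) (rule that)
  have "f j = a" "f j' = a'" using f(2) assms(3-5) by auto
  then show ?thesis using f(1,3) by (intro exI[of _ f]) simp
qed

lemma extend1:
  assumes "finite W" "card W \<le> B" "j < q" "a \<in> Y j"
  shows "\<exists>f. f \<in> Grid \<and> f j = a \<and> (\<forall>i<q. i \<noteq> j \<longrightarrow> good W i (f i))"
proof -
  obtain f where "f \<in> Grid" "f j = a" "\<forall>i<q. i \<noteq> j \<longrightarrow> i \<noteq> j \<longrightarrow> good W i (f i)"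
    using extend2[OF assms(1,2,3,3) refl assms(4,4)] by (elim exE conjE) (rule that)
  then show ?thesis by (intro exI[of _ f]) simp
qed

text \<open>Vertices of two different parts always occur in a common transversal, and transversals
  are injective.\<close>

lemma disjoint_Y:
  assumes "j < q" "j' < q" "j \<noteq> j'" "a \<in> Y j" "a \<in> Y j'"
  shows False
proof -
  obtain f where f: "f \<in> Grid" "f j = a" "f j' = a"
    using extend2[of "{}" j j' a a] assms by (metis card.empty finite.emptyI le0)
  then have "f j = f j'" by simp
  then show False using inj[OF f(1)] assms by (auto dest: inj_onD)
qed

text \<open>The coordinates are switched from \<open>f\<close> to \<open>g\<close> one at a time,
  through the hybrids \<open>h n\<close>.\<close>

lemma agree:
  assumes f: "f \<in> Grid" and g: "g \<in> Grid" and ind: "\<And>j. j < q \<Longrightarrow> f j \<noteq> g j \<Longrightarrow> indep_on i j"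
  shows "c i f = c i g"
proof -
  define h where "h n j = (if j < n then g j else f j)" for n j
  have h: "h n \<in> Grid" if "n \<le> q" for n
    using f g that by (auto simp: h_def PiE_def extensional_def Pi_def)
  have "c i (h n) = c i f" if "n \<le> q" for n
    using that
  proof (induction n)
    case 0
    then show ?case by (simp add: h_def)
  next
    case (Suc n)
    have eq: "h (Suc n) = (h n)(n := g n)" by (auto simp: h_def)
    have "c i (h (Suc n)) = c i (h n)"
    proof (cases "f n = g n")
      case True
      then have "h (Suc n) = h n" by (auto simp: h_def less_Suc_eq)
      then show ?thesis by simp
    next
      case False
      then have "indep_on i n" using ind Suc.prems by simp
      moreover have "g n \<in> Y n" using PiE_mem[OF g, of n] Suc.prems by simp
      ultimately show ?thesis unfolding eq indep_coord_def using h[of n] Suc.prems by simp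
    qed
    then show ?case using Suc by simp
  qed
  moreover have "h q = g"
  proof
    fix j show "h q j = g j" using f g by (cases "j < q") (simp_all add: h_def PiE_def extensional_def)
  qed
  ultimately show ?thesis by (metis order_refl)
qed

definition cval :: "'i \<Rightarrow> 'a" where "cval i = c i (SOME f. f \<in> Grid)"

lemma const_cval:
  assumes "const i" "f \<in> Grid" shows "c i f = cval i"
proof -
  have "(SOME f. f \<in> Grid) \<in> Grid" using assms(2) someI_ex[of "\<lambda>f. f \<in> Grid"] by auto
  then show ?thesis unfolding cval_def using assms by (intro agree) (auto simp: const_def)
qed

definition Z :: "'a set" where "Z = (\<Union>j<q. Y j)"

text \<open>Every vertex of \<open>Z\<close> lies on a transversal, and an extension never belongs
  to the set that it extends.\<close>

lemma cval_notin_Z: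
  assumes "const (v i)" "i \<le> t" shows "cval (v i) \<notin> Z"
proof
  assume "cval (v i) \<in> Z"
  then obtain j where j: "j < q" "cval (v i) \<in> Y j" by (auto simp: Z_def)
  obtain f where f: "f \<in> Grid" "f j = cval (v i)"
    using extend1[of "{}" j "cval (v i)"] j by (metis card.empty finite.emptyI le0)
  then show False using v_notin[OF f(1) assms(2)] const_cval[OF assms(1) f(1)] j(1) by force
qed

lemma cval_inj:
  assumes "const (v i)" "const (v i')" "i \<le> t" "i' \<le> t" "cval (v i) = cval (v i')"
  shows "i = i'"
proof -
  obtain f where f: "f \<in> Grid" using extend0[of "{}"] by (metis card.empty finite.emptyI le0)
  show ?thesis using v_inj[OF f assms(3,4)] const_cval[OF assms(1) f] const_cval[OF assms(2) f] assms(5) by auto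
qed

lemma ex_Z: "finite W \<Longrightarrow> card W \<le> B \<Longrightarrow> \<exists>z\<in>Z. z \<notin> W"
  using ex_good[of W 0] q2 good_in unfolding Z_def by force

text \<open>Colour classes that are constant act as core vertices: all transversals lie in their link.\<close>

lemma core_edge:
  assumes i: "const (v i)" "i \<le> t" and W: "finite W" "card W \<le> B" "cval (v i) \<notin> W" and a: "a \<in> Z" "a \<notin> W"
  shows "\<exists>e\<in>E. a \<in> e \<and> cval (v i) \<in> e \<and> e \<inter> W = {}"
proof -
  obtain j where j: "j < q" "a \<in> Y j" using a(1) by (auto simp: Z_def)
  obtain f where f: "f \<in> Grid" "f j = a" "\<forall>j'<q. j' \<noteq> j \<longrightarrow> good W j' (f j')"
    using extend1[OF W(1,2) j] by (elim exE conjE) (rule that)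
  have "f j' \<notin> W" if "j' < q" for j' using f(2,3) a(2) that good_in(2) by (cases "j' = j") auto
  then have "edge i f \<inter> W = {}" unfolding edge_def using W(3) const_cval[OF i(1) f(1)] by auto
  moreover have "a \<in> edge i f" "cval (v i) \<in> edge i f"
    unfolding edge_def using f(2) j(1) const_cval[OF i(1) f(1)] by auto
  ultimately show ?thesis using edge_in[OF f(1) i(2)] by blast
qed

lemma core_link:
  assumes i: "const (v i)" "i \<le> t" and W: "finite W" "card W + r + 1 \<le> B" "cval (v i) \<notin> W"
    and a: "a \<in> Z" "a' \<in> Z" "a \<noteq> a'" "a \<notin> W" "a' \<notin> W"
  shows "\<exists>S. lpath E 2 a a' S \<and> S \<inter> W = {}"
proof -
  define u where "u = cval (v i)"
  have u: "u \<noteq> a" "u \<noteq> a'" using cval_notin_Z[OF i] a unfolding u_def by auto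
  have "card (insert a' W) \<le> Suc (card W)" by (rule card_insert_le_m1) auto
  then obtain e1 where e1: "e1 \<in> E" "a \<in> e1" "u \<in> e1" "e1 \<inter> insert a' W = {}"
    using core_edge[OF i, of "insert a' W" a] W a u unfolding u_def by auto
  define W2 where "W2 = W \<union> (e1 - {u})"
  have "card (e1 - {u}) \<le> r" using E[OF e1(1)] card_Diff1_le[of e1 u] by simp
  then have W2: "finite W2" "card W2 \<le> B"
    using card_Un_le[of W "e1 - {u}"] W fin[OF e1(1)] unfolding W2_def by auto
  obtain e2 where e2: "e2 \<in> E" "a' \<in> e2" "u \<in> e2" "e2 \<inter> W2 = {}"
    using core_edge[OF i W2, of a'] W a u e1 unfolding u_def W2_def by auto
  have "e1 \<inter> e2 = {u}" unfolding Int_eq_singleton_iff using e1(3) e2(3,4) unfolding W2_def by blast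
  then have "lpath E 2 a a' (e1 \<union> e2)" using e1 e2 u by (intro lpath_2) auto
  moreover have "(e1 \<union> e2) \<inter> W = {}" using e1(4) e2(4) unfolding W2_def by blast
  ultimately show ?thesis by blast
qed

text \<open>Each core vertex carries two consecutive edges, the most that a vertex of a loose path
  can cover; so \<open>card T\<close> of them suffice for \<open>2 * card T\<close> edges.\<close>

lemma core_path:
  assumes "finite T" "T \<noteq> {}" "\<And>i. i \<in> T \<Longrightarrow> i \<le> t \<and> const (v i) \<and> cval (v i) \<notin> W"
    "finite W" "card W + card T * (2 * r + 4) \<le> B" "a \<in> Z" "a' \<in> Z" "a \<noteq> a'" "a \<notin> W" "a' \<notin> W"
  shows "\<exists>S. lpath E (2 * card T) a a' S \<and> S \<inter> W = {}"
  using assms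
proof (induction T arbitrary: a W rule: finite_induct)
  case (insert i T)
  have cT: "card (insert i T) = Suc (card T)" using insert.hyps by simp
  have i: "const (v i)" "i \<le> t" "cval (v i) \<notin> W" using insert.prems(2) by auto
  show ?case
  proof (cases "T = {}")
    case True
    then show ?thesis using core_link[OF i(1,2), of W a a'] insert.prems i(3) by simp
  next
    case False
    have cW2: "card (insert a (insert a' W)) \<le> card W + 2"
      using card_insert_le_m1[of "Suc (card W) + 1" "insert a' W" a] card_insert_le_m1[of "Suc (card W)" W a'] by simp
    then obtain z where z: "z \<in> Z" "z \<notin> W" "z \<noteq> a" "z \<noteq> a'"
      using ex_Z[of "insert a (insert a' W)"] insert.prems(3,4) cT by auto
    \<comment> \<open>The first link must not consume the core vertices reserved for the later
      ones.\<close>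
    define W1 where "W1 = insert a' (W \<union> (\<lambda>i. cval (v i)) ` T)"
    have "card ((\<lambda>i. cval (v i)) ` T) \<le> card T" using insert.hyps(1) by (rule card_image_le)
    then have "card W1 \<le> card W + card T + 1"
      using card_Un_le[of W "(\<lambda>i. cval (v i)) ` T"] card_insert_le_m1[of "card W + card T + 1" "W \<union> (\<lambda>i. cval (v i)) ` T" a']
      unfolding W1_def by simp
    then have cW1: "card W1 + r + 1 \<le> B" using insert.prems(4) cT by (simp add: algebra_simps)
    have TZ: "cval (v i') \<notin> Z" if "i' \<in> insert i T" for i' using cval_notin_Z insert.prems(2) that by blast
    have "cval (v i) \<notin> (\<lambda>i. cval (v i)) ` T"
    proof
      assume "cval (v i) \<in> (\<lambda>i. cval (v i)) ` T"
      then obtain i' where i': "i' \<in> T" "cval (v i) = cval (v i')" by blast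
      then have "i = i'" using cval_inj[of i i'] i insert.prems(2)[of i'] by simp
      then show False using i'(1) insert.hyps(2) by simp
    qed
    then have "cval (v i) \<notin> W1" using i(3) TZ[of i] insert.prems(6) unfolding W1_def by auto
    moreover have "a \<notin> W1" "z \<notin> W1" using insert.prems z TZ unfolding W1_def by auto
    ultimately obtain S1 where S1: "lpath E 2 a z S1" "S1 \<inter> W1 = {}"
      using core_link[OF i(1,2), of W1 a z] cW1 insert.prems(3,5) insert.hyps(1) z unfolding W1_def by auto
    define W3 where "W3 = W \<union> (S1 - {z})"
    have S1c: "finite S1" "card S1 \<le> 2 * r" using lpath_finite[OF S1(1)] lpath_card[OF S1(1) E] fin by auto
    then have "card (S1 - {z}) \<le> 2 * r" using card_Diff1_le[of S1 z] by linarith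
    then have "card W3 \<le> card W + 2 * r" using card_Un_le[of W "S1 - {z}"] unfolding W3_def by linarith
    then have W3: "finite W3" "card W3 + card T * (2 * r + 4) \<le> B"
      using insert.prems(3,4) S1c cT unfolding W3_def by auto
    have T3: "i' \<le> t \<and> const (v i') \<and> cval (v i') \<notin> W3" if "i' \<in> T" for i'
    proof -
      have "cval (v i') \<in> W1" using that unfolding W1_def by blast
      then have "cval (v i') \<notin> S1" using S1(2) by blast
      then show ?thesis using insert.prems(2) that unfolding W3_def by auto
    qed
    have aW3: "a' \<notin> W3" using insert.prems(9) S1(2) unfolding W3_def W1_def by blast
    have zW3: "z \<notin> W3" using z unfolding W3_def by simp
    obtain S where S: "lpath E (2 * card T) z a' S" "S \<inter> W3 = {}"
      using insert.IH[OF False T3 W3 z(1) insert.prems(6) z(4) zW3 aW3] by auto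
    have "S1 \<inter> S = {z}" unfolding Int_eq_singleton_iff
      using S(2) lpath_ends[OF S1(1)] lpath_ends[OF S(1)] unfolding W3_def by blast
    then have "lpath E (2 + 2 * card T) a a' (S1 \<union> S)" using S1(1) S(1) by (intro lpath_concat)
    moreover have "(S1 \<union> S) \<inter> W = {}" using S(2) S1(2) unfolding W3_def W1_def by blast
    ultimately show ?thesis using cT by auto
  qed
qed simp

lemma edge_avoid:
  assumes i: "i \<le> t" and c: "c (v i) f \<notin> W" and f: "\<And>j. j < q \<Longrightarrow> f j \<notin> W"
  shows "edge i f \<inter> W = {}"
  unfolding edge_def using c f by auto

text \<open>Supplies the one or two edges of a component that its core vertices do not cover. A
  nonconstant colour depends on some coordinate \<open>j\<close>; two transversals share a vertex in
  another coordinate \<open>a\<close>, and a good choice in \<open>j\<close> makes the second colour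
  value new.\<close>

lemma colour_link:
  assumes i: "i \<le> t" and W: "finite W" "card W + 2 * r + 3 \<le> B" "const (v i) \<Longrightarrow> cval (v i) \<notin> W"
  shows "\<exists>x\<in>Z. \<exists>x'\<in>Z. \<exists>S. lpath E 1 x x' S \<and> S \<inter> W = {}"
    "\<exists>x\<in>Z. \<exists>x'\<in>Z. \<exists>S. lpath E 2 x x' S \<and> S \<inter> W = {}"
proof -
  have cW: "card W \<le> B" using W(2) by simp
  obtain f where f: "f \<in> Grid" "\<forall>j<q. good W j (f j)"
    using extend0[OF W(1) cW] by (elim exE conjE) (rule that)
  note f(2)[rule_format]
  note f = f(1) this
  have fW: "f j \<in> Z" "f j \<notin> W" if "j < q" for j using f(2)[OF that] good_in that unfolding Z_def by blast+
  have cf: "c (v i) f \<notin> W"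
    using nonconst_avoid[OF vI[OF i] _ f] const_cval[OF _ f(1)] W(3) by metis
  have e: "edge i f \<inter> W = {}" using edge_avoid[OF i cf] fW by blast
  have f01: "f 0 \<in> edge i f" "f 1 \<in> edge i f" "f 0 \<noteq> f 1"
    using q2 inj[OF f(1)] unfolding edge_def by (auto dest: inj_onD)
  then have "lpath E 1 (f 0) (f 1) (edge i f)"
    using lpath.single[OF edge_in[OF f(1) i]] by simp
  then show "\<exists>x\<in>Z. \<exists>x'\<in>Z. \<exists>S. lpath E 1 x x' S \<and> S \<inter> W = {}"
    using e fW(1)[of 0] fW(1)[of 1] q2 by auto
  show "\<exists>x\<in>Z. \<exists>x'\<in>Z. \<exists>S. lpath E 2 x x' S \<and> S \<inter> W = {}"
  proof (cases "const (v i)")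
    case True
    have "card W + r + 1 \<le> B" using W(2) by simp
    then have "\<exists>S. lpath E 2 (f 0) (f 1) S \<and> S \<inter> W = {}"
      using core_link[OF True i W(1) _ W(3)[OF True], of "f 0" "f 1"] fW[of 0] fW[of 1] f01 q2 by auto
    then show ?thesis using fW(1)[of 0] fW(1)[of 1] q2 by auto
  next
    case False
    then obtain j where j: "j < q" "dep_on (v i) j" using hom vI[OF i] unfolding const_def by blast
    obtain a where a: "a < q" "a \<noteq> j" using q2 that[of 0] that[of 1] by (cases "j = 0") auto
    define W2 where "W2 = W \<union> edge i f"
    have W2: "finite W2" "card W2 \<le> B"
      using W card_Un_le[of W "edge i f"] fin E edge_in[OF f(1) i] unfolding W2_def by auto
    have "f a \<in> Y a" using PiE_mem[OF f(1), of a] a(1) by simp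
    then obtain g where g: "g \<in> Grid" "g a = f a" "\<forall>j<q. j \<noteq> a \<longrightarrow> good W2 j (g j)"
      using extend1[OF W2 a(1)] by metis
    note g(3)[rule_format]
    note g = g(1,2) this
    have cg: "c (v i) g \<notin> W2" using good_avoid[OF g(3) vI[OF i] j(2) g(1)] j(1) a(2) by simp
    have gW2: "g j \<notin> W2" if "j < q" "j \<noteq> a" for j using g(3)[OF that] good_in(2) by blast
    have "edge i f \<inter> edge i g = {f a}" unfolding Int_eq_singleton_iff
    proof (intro conjI ballI impI)
      show "f a \<in> edge i f" using a(1) by (simp add: edge_def)
      have "g a \<in> edge i g" using a(1) by (simp add: edge_def)
      then show "f a \<in> edge i g" using g(2) by simp
      fix x assume x: "x \<in> edge i f" "x \<in> edge i g"
      show "x = f a"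
      proof (rule ccontr)
        assume "x \<noteq> f a"
        then have "x \<notin> W2" using x(2) cg gW2 g(2) unfolding edge_def by auto
        then show False using x(1) unfolding W2_def by blast
      qed
    qed
    moreover have "f j \<in> edge i f" "g j \<in> edge i g" using j(1) unfolding edge_def by auto
    moreover have "f j \<noteq> f a" "g j \<noteq> f a"
      using inj[OF f(1)] inj[OF g(1)] g(2) a j(1) unfolding inj_on_def by (metis lessThan_iff)+
    ultimately have "lpath E 2 (f j) (g j) (edge i f \<union> edge i g)"
      using edge_in f(1) g(1) i by (intro lpath_2) auto
    moreover have "(edge i f \<union> edge i g) \<inter> W = {}"
    proof -
      have "g j \<notin> W" if "j < q" for j using gW2[OF that] g(2) fW(2)[OF a(1)] unfolding W2_def by (cases "j = a") auto
      then have "edge i g \<inter> W = {}" using edge_avoid[OF i, of g W] cg unfolding W2_def by blast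
      then show ?thesis using e by blast
    qed
    moreover have "g j \<in> Z" using PiE_mem[OF g(1), of j] j(1) unfolding Z_def by blast
    ultimately show ?thesis using fW(1)[OF j(1)] by blast
  qed
qed

end

section \<open>At most one nonconstant colour\<close>

lemma ex_partition:
  assumes "finite J" "finite X" "card X = (\<Sum>i\<in>J. n i)"
  shows "\<exists>A. (\<forall>i\<in>J. A i \<subseteq> X \<and> card (A i) = n i) \<and> (\<forall>i\<in>J. \<forall>j\<in>J. i \<noteq> j \<longrightarrow> A i \<inter> A j = {})"
  using assms
proof (induction J arbitrary: X rule: finite_induct)
  case (insert i J)
  then obtain D where D: "D \<subseteq> X" "card D = n i" by (metis le_add1 obtain_subset_with_card_n sum.insert)
  have "card (X - D) = (\<Sum>i\<in>J. n i)"
    using D insert.prems insert.hyps by (simp add: card_Diff_subset finite_subset)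
  then obtain A where A: "\<forall>i\<in>J. A i \<subseteq> X - D \<and> card (A i) = n i"
      "\<forall>i\<in>J. \<forall>j\<in>J. i \<noteq> j \<longrightarrow> A i \<inter> A j = {}"
    using insert.IH[of "X - D"] insert.prems by auto
  have dis: "A j \<inter> D = {}" "D \<inter> A j = {}" if "j \<in> J" for j using A(1) that by blast+
  show ?case
  proof (intro exI[of _ "A(i := D)"] conjI ballI impI)
    fix j j' assume "j \<in> insert i J" "j' \<in> insert i J" "j \<noteq> j'"
    then show "(A(i := D)) j \<inter> (A(i := D)) j' = {}" using A(2) dis insert.hyps(2) by auto
  next
    fix j assume "j \<in> insert i J"
    then show "(A(i := D)) j \<subseteq> X" "card ((A(i := D)) j) = n j" using A(1) D insert.hyps(2) by auto
  qed
qed simp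

text \<open>The bound on \<open>B\<close> pays for all components with slack for the one under
  construction, for the values of constant colours, and for the sets of at most \<open>t + 1\<close>
  values that \<open>core_case\<close> keeps free.\<close>

locale union_grid = expanded_union r k p l ts Q + colour_grid E r q B t Y I c v
  for r k p l ts Q and E :: "'a set set" and q B t Y and I :: "'i set" and c v +
  assumes t: "t = (\<Sum>i=1..k. (l i + 1) div 2) + p - 1"
    and B: "(k + p + 9) * (L * (2 * r + 4)) + 2 * card I + 4 * t + 20 \<le> B"
begin

text \<open>The core vertices from \<open>T\<close> give a path with \<open>2 * card T\<close>
  edges, one or two fewer than \<open>l i\<close> depending on parity, and the colour
  \<open>v i0\<close> provides the missing edges. The component thus uses
  \<open>(l i + 1) div 2\<close> colours, of which one may be nonconstant.\<close>

lemma core_component: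
  assumes i: "i \<in> {1..k}" and T: "finite T" "card T = (l i + 1) div 2 - 1"
    "\<And>j. j \<in> T \<Longrightarrow> j \<le> t \<and> const (v j) \<and> cval (v j) \<notin> W"
    and i0: "i0 \<le> t" "i0 \<notin> T" "const (v i0) \<Longrightarrow> cval (v i0) \<notin> W"
    and W: "finite W" "card W + L * (2 * r + 4) + 4 * r + t + 9 \<le> B"
  shows "\<exists>S. embeds E (Q i) S \<and> S \<inter> W = {} \<and> finite S \<and> card S \<le> L * r"
proof -
  define n where "n = card T"
  have li: "5 \<le> l i" "l i < L" using l l_less_L i by auto
  have n: "n \<ge> 1" "l i = 2 * n + 1 \<or> l i = 2 * n + 2" "n < L"
    using T(2) li unfolding n_def by presburger+
  have Tne: "T \<noteq> {}" using n(1) unfolding n_def by auto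
  have "n * (2 * r + 4) \<le> L * (2 * r + 4)" using n(3) by (intro mult_right_mono) auto
  then have nB: "card W + n * (2 * r + 4) + 4 * r + t + 9 \<le> B" using W(2) by linarith
  define W1 where "W1 = W \<union> (\<lambda>j. cval (v j)) ` T"
  have "T \<subseteq> {..t}" using T(3) by auto
  then have "card T \<le> Suc t" using card_mono[of "{..t}" T] by simp
  then have "card ((\<lambda>j. cval (v j)) ` T) \<le> Suc t" using card_image_le[OF T(1)] le_trans by blast
  then have "card W1 \<le> card W + Suc t"
    using card_Un_le[of W "(\<lambda>j. cval (v j)) ` T"] unfolding W1_def by linarith
  then have W1: "finite W1" "card W1 + 2 * r + 3 \<le> B" using nB W(1) T(1) unfolding W1_def by auto
  have i0W: "cval (v i0) \<notin> W1" if "const (v i0)"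
    using i0 that cval_inj[OF that] T(3) unfolding W1_def by blast
  note links = colour_link[OF i0(1) W1 i0W]
  \<comment> \<open>The core path meets the link \<open>S\<close> at most in its ends
    \<open>x'\<close> and \<open>z\<close>. It therefore prolongs the link when \<open>z\<close> is
    a fresh vertex, and closes a cycle when \<open>z\<close> is the other end of the link.\<close>
  have close: "\<exists>S'. lpath E (2 * n) x' z S' \<and> S' \<inter> W = {} \<and> S \<inter> S' = S \<inter> {x', z}"
    if S: "lpath E d x x' S" "S \<inter> W1 = {}" "d \<le> 2" and z: "z \<in> Z" "z \<notin> W" "z \<noteq> x'" and x': "x' \<in> Z"
    for S d x x' z
  proof -
    define W2 where "W2 = W \<union> (S - {x', z})"
    have Sc: "finite S" "card S \<le> d * r" using lpath_finite[OF S(1)] lpath_card[OF S(1) E] fin by auto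
    have "d * r \<le> 2 * r" using S(3) by (rule mult_right_mono) simp
    moreover have "card (S - {x', z}) \<le> card S" using Sc by (intro card_mono) auto
    ultimately have "card W2 \<le> card W + 2 * r"
      using Sc(2) card_Un_le[of W "S - {x', z}"] unfolding W2_def by linarith
    then have W2: "finite W2" "card W2 + card T * (2 * r + 4) \<le> B"
      using nB Sc W(1) unfolding W2_def n_def by auto
    have "j \<le> t \<and> const (v j) \<and> cval (v j) \<notin> W2" if "j \<in> T" for j
      using T(3)[OF that] S(2) that unfolding W2_def W1_def by blast
    moreover have "x' \<in> S" using lpath_ends[OF S(1)] by blast
    then have "x' \<notin> W" using S(2) unfolding W1_def by blast
    then have "x' \<notin> W2" "z \<notin> W2" using z unfolding W2_def by auto
    ultimately obtain S' where S': "lpath E (2 * n) x' z S'" "S' \<inter> W2 = {}"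
      using core_path[OF T(1) Tne _ W2 x' z(1)] z(3) unfolding n_def by metis
    have "S \<inter> S' = S \<inter> {x', z}" using S'(2) lpath_ends[OF S'(1)] unfolding W2_def by blast
    then show ?thesis using S' unfolding W2_def by blast
  qed
  consider (path) "Q i = expansion r (path_graph (l i))"
    | (cycle) d where "Q i = expansion r (cycle_graph (l i))" "l i = d + 2 * n" "d = 1 \<or> d = 2"
    using Q_cases[OF i] n(2) by (metis add.commute)
  then show ?thesis
  proof cases
    case path
    obtain x x' S where S: "x \<in> Z" "x' \<in> Z" "lpath E 2 x x' S" "S \<inter> W1 = {}" using links(2) by blast
    have Sc: "finite S" "card S \<le> 2 * r" using lpath_finite[OF S(3)] lpath_card[OF S(3) E] fin by auto
    have "card (W \<union> S) \<le> B" using card_Un_le[of W S] Sc nB by linarith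
    then obtain z where z: "z \<in> Z" "z \<notin> W" "z \<notin> S" using ex_Z[of "W \<union> S"] Sc W(1) by auto
    have xS: "x' \<in> S" using lpath_ends[OF S(3)] by blast
    obtain S' where S': "lpath E (2 * n) x' z S'" "S' \<inter> W = {}" "S \<inter> S' = S \<inter> {x', z}"
      using close[OF S(3,4) _ z(1,2) _ S(2)] z xS by auto
    have "S \<inter> S' = {x'}" using S'(3) z(3) xS by auto
    then have "lpath E (2 + 2 * n) x z (S \<union> S')" using S(3) S'(1) by (intro lpath_concat)
    \<comment> \<open>For odd \<open>l i\<close> the path with \<open>2 * n + 2\<close> edges is one
      edge too long.\<close>
    then obtain y S'' where S'': "lpath E (l i) y z S''" "S'' \<subseteq> S \<union> S'"
      using lpath_shorten[of E "2 + 2 * n" x z "S \<union> S'" "l i"] n li by auto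
    have "finite S''" "card S'' \<le> l i * r" using lpath_finite[OF S''(1)] lpath_card[OF S''(1) E] fin by auto
    moreover have "l i * r \<le> L * r" using li by (intro mult_right_mono) auto
    moreover have "S'' \<inter> W = {}" using S''(2) S'(2) S(4) unfolding W1_def by blast
    moreover have "embeds E (Q i) S''" unfolding path using embeds_path[OF S''(1) E] expanded_union.r[OF expanded_union_axioms] by simp
    ultimately show ?thesis by (meson le_trans)
  next
    case cycle
    obtain x x' S where S: "x \<in> Z" "x' \<in> Z" "lpath E d x x' S" "S \<inter> W1 = {}"
      using links cycle(3) by metis
    have d: "d \<le> 2" using cycle(3) by auto
    have xx: "x \<in> S" "x' \<in> S" "x \<noteq> x'" using lpath_ends[OF S(3)] by blast+
    then have "x \<notin> W" using S(4) unfolding W1_def by blast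
    then obtain S' where S': "lpath E (2 * n) x' x S'" "S' \<inter> W = {}" "S \<inter> S' = S \<inter> {x', x}"
      using close[OF S(3,4) d S(1) _ _ S(2)] xx by auto
    have "S \<inter> S' = {x, x'}" using S'(3) xx by auto
    then have C: "lcycle E (l i) (S \<union> S')" unfolding cycle(2) using S(3) S'(1) n(1) by (intro lcycle_join) auto
    have "finite (S \<union> S')" "card (S \<union> S') \<le> l i * r" using lcycle_finite_card[OF C E] r li by auto
    moreover have "l i * r \<le> L * r" using li by (intro mult_right_mono) auto
    moreover have "(S \<union> S') \<inter> W = {}" using S'(2) S(4) unfolding W1_def by blast
    moreover have "embeds E (Q i) (S \<union> S')" unfolding cycle(1) using embeds_cycle[OF C E] r li by simp
    ultimately show ?thesis by (meson le_trans)
  qed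
qed

end


context union_grid
begin

text \<open>The \<open>t\<close> constant colours are just enough: component \<open>k\<close>
  receives one fewer than its covering number and takes \<open>v i0\<close> in addition, the other
  components receive their full covering number, and each star receives one colour for its
  centre.\<close>

lemma core_case:
  assumes i0: "i0 \<le> t" and cst: "\<And>i. i \<le> t \<Longrightarrow> i \<noteq> i0 \<Longrightarrow> const (v i)"
  shows "embeds E F UNIV"
proof -
  define h where "h i = (l i + 1) div 2" for i
  have h3: "h i \<ge> 3" if "i \<in> {1..k}" for i using l[OF that] unfolding h_def by linarith
  \<comment> \<open>Index 0 collects the centres of the stars; the unit missing at index
    \<open>k\<close> is the one subtracted in the definition of \<open>t\<close>.\<close>
  define n where "n i = (if i = 0 then p else if i = k then h k - 1 else h i)" for i
  have k1: "k \<in> {1..k}" using k by simp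
  have "(\<Sum>i\<in>{1..k}. n i) = n k + (\<Sum>i\<in>{1..k} - {k}. n i)" using k1 by (intro sum.remove) auto
  also have "(\<Sum>i\<in>{1..k} - {k}. n i) = (\<Sum>i\<in>{1..k} - {k}. h i)" by (intro sum.cong) (auto simp: n_def)
  finally have "(\<Sum>i\<in>{1..k}. n i) = h k - 1 + (\<Sum>i\<in>{1..k} - {k}. h i)" using k by (simp add: n_def)
  moreover have "(\<Sum>i\<in>{1..k}. h i) = h k + (\<Sum>i\<in>{1..k} - {k}. h i)" using k1 by (intro sum.remove) auto
  ultimately have "(\<Sum>i\<in>{1..k}. n i) + p = t" using t h3[OF k1] unfolding h_def by simp
  moreover have "{0..k} = insert 0 {1..k}" by auto
  ultimately have "(\<Sum>i\<in>{0..k}. n i) = t" by (simp add: n_def)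
  moreover have "card ({..t} - {i0}) = t" using i0 by simp
  ultimately obtain A where A: "\<forall>i\<in>{0..k}. A i \<subseteq> {..t} - {i0} \<and> card (A i) = n i"
      "\<forall>i\<in>{0..k}. \<forall>j\<in>{0..k}. i \<noteq> j \<longrightarrow> A i \<inter> A j = {}"
    using ex_partition[of "{0..k}" "{..t} - {i0}" n] by auto
  define A' where "A' i = (if i = k then insert i0 (A k) else A i)" for i
  have A0: "A 0 \<subseteq> {..t} - {i0}" "card (A 0) = p" using A(1) by (auto simp: n_def)
  have A'A0: "A' i \<inter> A 0 = {}" if "i \<in> {1..k}" for i
    using A(1) A(2)[rule_format, of i 0] A0(1) that unfolding A'_def by auto
  have A'_dis: "A' i \<inter> A' j = {}" if "i \<in> {1..k}" "j \<in> {1..k}" "i \<noteq> j" for i j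
    using A(1) A(2)[rule_format, of i j] that unfolding A'_def by auto
  have "\<exists>x T. x \<le> t \<and> finite T \<and> card T = h i - 1 \<and> x \<notin> T \<and> T \<subseteq> {..t} - {i0} \<and> insert x T = A' i"
    if i: "i \<in> {1..k}" for i
  proof (cases "i = k")
    case True
    have "A k \<subseteq> {..t} - {i0}" "card (A k) = h k - 1" using A(1) k by (auto simp: n_def)
    then show ?thesis using True i0 finite_subset[of "A k" "{..t}"]
      by (intro exI[of _ i0] exI[of _ "A k"]) (auto simp: A'_def)
  next
    case False
    have Ai: "A i \<subseteq> {..t} - {i0}" "card (A i) = h i" using A(1) i False by (auto simp: n_def)
    then have "A i \<noteq> {}" using h3[OF i] by auto
    then obtain x where x: "x \<in> A i" by blast
    have "finite (A i)" using Ai(1) finite_subset by blast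
    then show ?thesis using False Ai x
      by (intro exI[of _ x] exI[of _ "A i - {x}"]) (auto simp: A'_def)
  qed
  then obtain x T where xT: "\<And>i. i \<in> {1..k} \<Longrightarrow> x i \<le> t \<and> finite (T i) \<and> card (T i) = h i - 1 \<and> x i \<notin> T i \<and>
    T i \<subseteq> {..t} - {i0} \<and> insert (x i) (T i) = A' i" by metis
  define Avoid where "Avoid D = (\<lambda>j. cval (v j)) ` {j. j \<le> t \<and> const (v j) \<and> j \<notin> D}" for D
  have Avoid: "finite (Avoid D)" "card (Avoid D) \<le> t + 1" for D
  proof -
    have "{j. j \<le> t \<and> const (v j) \<and> j \<notin> D} \<subseteq> {..t}" by auto
    then have *: "finite {j. j \<le> t \<and> const (v j) \<and> j \<notin> D}" "card {j. j \<le> t \<and> const (v j) \<and> j \<notin> D} \<le> t + 1"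
      using finite_subset card_mono[of "{..t}" "{j. j \<le> t \<and> const (v j) \<and> j \<notin> D}"] by auto
    show "finite (Avoid D)" using * unfolding Avoid_def by simp
    show "card (Avoid D) \<le> t + 1" unfolding Avoid_def using card_image_le[OF *(1)] *(2) le_trans by blast
  qed
  have notAvoid: "cval (v j) \<notin> Avoid D" if "j \<le> t" "const (v j)" "j \<in> D" for j D
    using cval_inj[OF that(2) _ that(1)] that(3) unfolding Avoid_def by blast
  have inAvoid: "cval (v j) \<in> Avoid D" if "j \<le> t" "const (v j)" "j \<notin> D" for j D
    using that unfolding Avoid_def by blast
  have L1: "L \<ge> 1" unfolding L_def by simp
  define M where "M = L * (2 * r + 4)"
  have M: "L * r \<le> M" "4 * r \<le> 2 * M"
  proof -
    show "L * r \<le> M" unfolding M_def by (intro mult_left_mono) auto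
    have "2 * r \<le> L * (2 * r + 4)" using L1 by (metis le_add1 le_trans mult_1 mult_le_mono1)
    then show "4 * r \<le> 2 * M" unfolding M_def by linarith
  qed
  have BM: "k * M + p * M + 9 * M + 4 * t + 20 \<le> B" using B unfolding M_def by (simp add: algebra_simps)
  define P where "P i S \<longleftrightarrow> embeds E (Q i) S \<and> finite S \<and> card S \<le> L * r \<and> S \<inter> Avoid (A' i) = {}" for i S
  have "\<exists>S. (\<forall>i\<in>{1..k}. P i (S i)) \<and> (\<forall>i\<in>{1..k}. \<forall>j\<in>{1..k}. i \<noteq> j \<longrightarrow> S i \<inter> S j = {})"
  proof (rule disjoint_choice)
    fix J S i assume J: "J \<subseteq> {1..k}" and i: "i \<in> {1..k} - J" and S: "\<And>j. j \<in> J \<Longrightarrow> P j (S j)"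
    have cJ: "card J \<le> k" "finite J" using card_mono[OF _ J] J finite_subset by auto
    have S1: "finite (\<Union>j\<in>J. S j)" "card (\<Union>j\<in>J. S j) \<le> k * (L * r)"
      using finite_card_UN_le[OF cJ(2,1), of S "L * r"] S by (auto simp: P_def)
    define W where "W = (\<Union>j\<in>J. S j) \<union> Avoid (A' i)"
    have "k * (L * r) \<le> k * M" using M(1) by (rule mult_left_mono) simp
    then have "card W \<le> k * M + t + 1"
      using card_Un_le[of "\<Union>j\<in>J. S j" "Avoid (A' i)"] S1(2) Avoid(2)[of "A' i"] unfolding W_def by linarith
    then have W: "finite W" "card W + L * (2 * r + 4) + 4 * r + t + 9 \<le> B"
      using S1(1) Avoid(1) BM M(2) unfolding W_def M_def[symmetric] by auto
    have free: "cval (v j) \<notin> W" if j: "j \<in> A' i" "j \<le> t" "const (v j)" for j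
    proof -
      have "cval (v j) \<notin> S j'" if "j' \<in> J" for j'
      proof -
        have "j' \<in> {1..k}" "i \<noteq> j'" using J i that by auto
        then have "j \<notin> A' j'" using A'_dis[of i j'] j(1) i by blast
        then have "cval (v j) \<in> Avoid (A' j')" using inAvoid j by blast
        then show ?thesis using S[OF that] unfolding P_def by auto
      qed
      then show ?thesis using notAvoid[OF j(2,3,1)] unfolding W_def by auto
    qed
    have ik: "i \<in> {1..k}" using i by blast
    note xTi = xT[OF ik]
    have TA: "T i \<subseteq> A' i" "x i \<in> A' i" using xTi by auto
    have "\<exists>S'. embeds E (Q i) S' \<and> S' \<inter> W = {} \<and> finite S' \<and> card S' \<le> L * r"
    proof (rule core_component[OF ik _ _ _ _ _ _ W])
      show "finite (T i)" "card (T i) = (l i + 1) div 2 - 1" "x i \<le> t" "x i \<notin> T i"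
        using xTi by (auto simp: h_def)
      show "cval (v (x i)) \<notin> W" if "const (v (x i))" using free[OF TA(2)] xTi that by blast
      fix j assume "j \<in> T i"
      then have "j \<le> t" "j \<noteq> i0" "j \<in> A' i" using xTi TA by auto
      then show "j \<le> t \<and> const (v j) \<and> cval (v j) \<notin> W" using cst free by blast
    qed
    then obtain S' where "embeds E (Q i) S'" "S' \<inter> W = {}" "finite S'" "card S' \<le> L * r" by blast
    then have "P i S' \<and> S' \<inter> (\<Union>j\<in>J. S j) = {}" unfolding P_def W_def by blast
    then show "\<exists>S'. P i S' \<and> S' \<inter> (\<Union>j\<in>J. S j) = {}" by (rule exI)
  qed simp
  then obtain S where S: "\<forall>i\<in>{1..k}. P i (S i)" "\<forall>i\<in>{1..k}. \<forall>j\<in>{1..k}. i \<noteq> j \<longrightarrow> S i \<inter> S j = {}"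
    by (elim exE conjE) (rule that)
  define W1 where "W1 = (\<Union>i\<in>{1..k}. S i)"
  have W1: "finite W1" "card W1 \<le> k * (L * r)"
    unfolding W1_def using finite_card_UN_le[of "{1..k}" k S "L * r"] S(1) by (auto simp: P_def)
  have "finite (A 0)" using A0(1) finite_subset by blast
  then obtain \<beta> where \<beta>: "bij_betw \<beta> {1..p} (A 0)"
    using finite_same_card_bij[of "{1..p}" "A 0"] A0(2) by auto
  define P' where "P' i S \<longleftrightarrow> embeds E (expansion r (star_graph (ts i))) S \<and> finite S \<and> card S \<le> L * r \<and>
    S \<inter> W1 = {} \<and> S \<inter> Avoid {\<beta> i} = {}" for i S
  have "\<exists>S. (\<forall>i\<in>{1..p}. P' i (S i)) \<and> (\<forall>i\<in>{1..p}. \<forall>j\<in>{1..p}. i \<noteq> j \<longrightarrow> S i \<inter> S j = {})"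
  proof (rule disjoint_choice)
    fix J S' i assume J: "J \<subseteq> {1..p}" and i: "i \<in> {1..p} - J" and S': "\<And>j. j \<in> J \<Longrightarrow> P' j (S' j)"
    have cJ: "card J \<le> p" "finite J" using card_mono[OF _ J] J finite_subset by auto
    have S1: "finite (\<Union>j\<in>J. S' j)" "card (\<Union>j\<in>J. S' j) \<le> p * (L * r)"
      using finite_card_UN_le[OF cJ(2,1), of S' "L * r"] S' by (auto simp: P'_def)
    define W where "W = W1 \<union> (\<Union>j\<in>J. S' j) \<union> Avoid {\<beta> i}"
    have "k * (L * r) \<le> k * M" "p * (L * r) \<le> p * M" using M(1) by (auto intro: mult_left_mono)
    then have cW: "card W \<le> k * M + p * M + t + 1"
      using card_Un_le[of "W1 \<union> (\<Union>j\<in>J. S' j)" "Avoid {\<beta> i}"] card_Un_le[of W1 "\<Union>j\<in>J. S' j"]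
        S1(2) W1(2) Avoid(2)[of "{\<beta> i}"] unfolding W_def by linarith
    have W: "finite W" using W1 S1 Avoid unfolding W_def by auto
    have \<beta>i: "\<beta> i \<in> A 0" using \<beta> i by (auto simp: bij_betw_def)
    then have \<beta>t: "\<beta> i \<le> t" "const (v (\<beta> i))" using A0(1) cst by auto
    define y where "y = cval (v (\<beta> i))"
    have "y \<notin> W1"
    proof -
      have "y \<notin> S j" if j: "j \<in> {1..k}" for j
      proof -
        have "\<beta> i \<notin> A' j" using A'A0[OF j] \<beta>i by blast
        then have "y \<in> Avoid (A' j)" unfolding y_def using inAvoid \<beta>t by blast
        then show ?thesis using S(1) j unfolding P_def by auto
      qed
      then show ?thesis unfolding W1_def by auto
    qed
    moreover have "y \<notin> S' j" if j: "j \<in> J" for j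
    proof -
      have "\<beta> i \<noteq> \<beta> j" using \<beta> i j J unfolding bij_betw_def inj_on_def by blast
      then have "y \<in> Avoid {\<beta> j}" unfolding y_def using inAvoid \<beta>t by blast
      then show ?thesis using S'[OF j] unfolding P'_def by auto
    qed
    moreover have "y \<notin> Avoid {\<beta> i}" unfolding y_def using notAvoid \<beta>t by blast
    ultimately have yW: "y \<notin> W" unfolding W_def by auto
    have tsL: "ts i < L" using ts_less_L i by blast
    have tsr: "ts i * r \<le> L * r" using tsL by simp
    have "\<exists>S. embeds E (expansion r (star_graph (ts i))) S \<and> S \<inter> W = {} \<and> finite S \<and> card S \<le> Suc (ts i * r)"
    proof (rule star_of_strong[OF E _ _ W yW])
      show "card W + ts i * r \<le> B" using cW BM M(1) tsr by linarith
      fix W' :: "'a set" assume W': "finite W'" "card W' \<le> B" "y \<notin> W'"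
      obtain z where z: "z \<in> Z" "z \<notin> W'" using ex_Z[OF W'(1,2)] by blast
      show "\<exists>e\<in>E. y \<in> e \<and> e \<inter> W' = {}"
        using core_edge[OF \<beta>t(2,1) W'(1,2) _ z] W'(3) unfolding y_def by blast
    qed (use r in auto)
    then obtain S'' where S'': "embeds E (expansion r (star_graph (ts i))) S''" "S'' \<inter> W = {}"
      "finite S''" "card S'' \<le> Suc (ts i * r)" by blast
    have "Suc (ts i * r) \<le> Suc (ts i) * r" using r by simp
    also have "\<dots> \<le> L * r" using tsL by (intro mult_right_mono) auto
    finally have "P' i S'' \<and> S'' \<inter> (\<Union>j\<in>J. S' j) = {}" unfolding P'_def using S'' unfolding W_def by auto
    then show "\<exists>S''. P' i S'' \<and> S'' \<inter> (\<Union>j\<in>J. S' j) = {}" by (rule exI)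
  qed simp
  then obtain S' where S': "\<forall>i\<in>{1..p}. P' i (S' i)" "\<forall>i\<in>{1..p}. \<forall>j\<in>{1..p}. i \<noteq> j \<longrightarrow> S' i \<inter> S' j = {}"
    by (elim exE conjE) (rule that)
  show ?thesis
    by (rule embeds_F[of E S S']) (use S S' in \<open>auto simp: P_def P'_def W1_def\<close>)
qed

end


section \<open>Links from nonconstant colours\<close>

lemma lpath_first_edge: "lpath E n a b S \<Longrightarrow> \<exists>e\<in>E. a \<in> e \<and> e \<subseteq> S"
  by (cases rule: lpath.cases) auto

lemma (in linked) strong:
  assumes "finite W" "Suc (card W) \<le> B" "y \<in> Y" "y \<notin> W"
  shows "\<exists>e\<in>E. y \<in> e \<and> e \<inter> W = {}"
proof -
  have "finite (insert y W)" "card (insert y W) \<le> B" using assms by (auto simp: card_insert_if)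
  then obtain y' where y': "y' \<in> Y" "y' \<notin> insert y W" "\<rho> y' \<inter> insert y W = {}" using new by blast
  then have "y \<noteq> y'" "y \<notin> \<rho> y'" "y' \<notin> W" "\<rho> y' \<inter> W = {}" by auto
  moreover have "card W \<le> B" using assms by simp
  ultimately obtain S where S: "lpath E 2 y y' S" "S \<inter> W = {}"
    using two[of W y y'] assms y'(1) by blast
  show ?thesis using lpath_first_edge[OF S(1)] S(2) by blast
qed

context union_grid
begin

text \<open>All of \<open>I\<close> is taken and not just the colours \<open>v i\<close>, since the
  extensions of extensions added later may be constant as well.\<close>

definition U :: "'a set" where "U = cval ` {i \<in> I. const i}"

definition M :: nat where "M = L * (2 * r + 4)"

text \<open>Smaller than \<open>B\<close>, so that a link which has to avoid \<open>Bl\<close>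
  vertices can also avoid \<open>U\<close> and its own earlier vertices within the budget
  \<open>B\<close>.\<close>

definition Bl :: nat where "Bl = (k + p) * M + 3 * M + card I"

lemma U: "finite U" "card U \<le> card I"
proof -
  show "finite U" unfolding U_def using I by simp
  have "card U \<le> card {i \<in> I. const i}" unfolding U_def using I by (intro card_image_le) simp
  also have "\<dots> \<le> card I" using I by (intro card_mono) auto
  finally show "card U \<le> card I" .
qed

lemma M: "L * r \<le> M" "2 * r + 4 \<le> M"
proof -
  show "L * r \<le> M" unfolding M_def by (intro mult_left_mono) auto
  have "1 * (2 * r + 4) \<le> L * (2 * r + 4)" unfolding L_def by (intro mult_right_mono) auto
  then show "2 * r + 4 \<le> M" unfolding M_def by simp
qed

lemma Bl: "Bl + 12 * r + 24 + card I \<le> B"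
  using B M(2) unfolding Bl_def M_def[symmetric] by (simp add: algebra_simps)

text \<open>Each summand is at least 3 because \<open>l i \<ge> 5\<close>. Earlier cycles occupy at
  most \<open>2 * (k - 1)\<close> values of \<open>U\<close>, which leaves at least 3 of
  \<open>t + 1\<close> extensions, enough to exclude two further vertices.\<close>

lemma t_ge: "t \<ge> 3 * k - 1"
proof -
  have "(\<Sum>i=1..k. 3) \<le> (\<Sum>i=1..k. (l i + 1) div 2)"
  proof (rule sum_mono)
    fix i assume "i \<in> {1..k}"
    then show "3 \<le> (l i + 1) div 2" using l[of i] by linarith
  qed
  then show ?thesis using t by simp
qed

lemma embeds_F_of_linked:
  assumes "linked E r Bl Y' \<rho>"
    and three: "\<And>W. finite W \<Longrightarrow> card W \<le> Bl \<Longrightarrow> card (W \<inter> U) \<le> 2 * (k - 1) \<Longrightarrow>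
      \<exists>y y' S. y \<in> Y' \<and> y' \<in> Y' \<and> lpath E 3 y y' S \<and> S \<inter> W = {} \<and> y \<notin> \<rho> y' \<and> \<rho> y' \<inter> (W \<union> U \<union> S) = {} \<and>
        y \<notin> U \<and> y' \<notin> U \<and> card (S \<inter> U) \<le> 2"
  shows "embeds E F UNIV"
proof -
  interpret lk: linked E r Bl Y' \<rho> by (rule assms(1))
  have kM: "(k + p) * (L * r) \<le> (k + p) * M" using M(1) by (rule mult_left_mono) simp
  show ?thesis
  proof (rule embeds_F_of_cycles[OF E])
    fix W :: "'a set" and n
    assume W: "finite W" "card W \<le> (k + p) * (L * r)" "card (W \<inter> U) \<le> 2 * (k - 1)" and n: "5 \<le> n" "n \<le> L"
    have "(n + 2) * (2 * r + 3) \<le> (L + 2) * (2 * r + 4)" using n(2) by (intro mult_mono) auto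
    also have "\<dots> = M + 2 * (2 * r + 4)" unfolding M_def by (simp add: algebra_simps)
    also have "\<dots> \<le> 3 * M" using M(2) by simp
    finally have n3: "(n + 2) * (2 * r + 3) \<le> 3 * M" .
    have "card W \<le> (k + p) * M" using W(2) kM by (rule le_trans)
    from add_mono[OF add_mono[OF this U(2)] n3] have "card W + card U + (n + 2) * (2 * r + 3) \<le> Bl"
      unfolding Bl_def by (simp only: ac_simps)
    then show "\<exists>S. lcycle E n S \<and> S \<inter> W = {} \<and> card (S \<inter> U) \<le> 2"
      using lk.cycles[OF U(1) three W(1) _ W(3) n(1)] by blast
  next
    fix W :: "'a set" and n
    assume W: "finite W" "card W \<le> (k + p) * (L * r)" and n: "n < L"
    have "card W \<le> Bl" using W(2) kM unfolding Bl_def by linarith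
    then obtain y where y: "y \<in> Y'" "y \<notin> W" using lk.new[OF W(1)] by blast
    have nr: "Suc (n * r) \<le> L * r"
    proof -
      have "Suc (n * r) \<le> Suc n * r" using r by simp
      also have "\<dots> \<le> L * r" using n by (intro mult_right_mono) auto
      finally show ?thesis .
    qed
    have "\<exists>S. embeds E (expansion r (star_graph n)) S \<and> S \<inter> W = {} \<and> finite S \<and> card S \<le> Suc (n * r)"
    proof (rule star_of_strong[OF E _ _ W(1) y(2)])
      show "card W + n * r \<le> Bl - 1" using W(2) kM nr M unfolding Bl_def by linarith
      fix W' :: "'a set" assume W': "finite W'" "card W' \<le> Bl - 1" "y \<notin> W'"
      have "Bl \<ge> 1" using M(2) unfolding Bl_def by linarith
      then show "\<exists>e\<in>E. y \<in> e \<and> e \<inter> W' = {}" using lk.strong[OF W'(1) _ y(1) W'(3)] W'(2) by simp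
    qed (use r in auto)
    then show "\<exists>S. embeds E (expansion r (star_graph n)) S \<and> S \<inter> W = {} \<and> finite S \<and> card S \<le> L * r"
      using nr le_trans by blast
  qed
qed

text \<open>Nonconstant colours miss \<open>W\<close> because every coordinate is good. Only values
  in \<open>X\<close> and \<open>W' \<inter> U\<close> have to be excluded, at most \<open>t\<close>
  of them against \<open>t + 1\<close> distinct candidates.\<close>

lemma pick:
  assumes f: "f \<in> Grid" "\<And>j. j < q \<Longrightarrow> good W j (f j)" and u: "\<And>h. h \<le> t \<Longrightarrow> u h \<in> I"
    "\<And>h h'. h \<le> t \<Longrightarrow> h' \<le> t \<Longrightarrow> h \<noteq> h' \<Longrightarrow> c (u h) f \<noteq> c (u h') f"
    and X: "finite X" "finite W'" "W' \<subseteq> W" "card X + card (W' \<inter> U) \<le> t"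
  shows "\<exists>h\<le>t. c (u h) f \<notin> W' \<union> X"
proof (rule ccontr)
  assume "\<not> ?thesis"
  then have all: "c (u h) f \<in> W' \<union> X" if "h \<le> t" for h using that by blast
  have "(\<lambda>h. c (u h) f) ` {..t} \<subseteq> X \<union> (W' \<inter> U)"
  proof
    fix z assume "z \<in> (\<lambda>h. c (u h) f) ` {..t}"
    then obtain h where h: "h \<le> t" "z = c (u h) f" by auto
    show "z \<in> X \<union> (W' \<inter> U)"
    proof (cases "z \<in> X")
      case False
      then have zW: "z \<in> W'" using all[OF h(1)] h(2) by blast
      then have "const (u h)" using nonconst_avoid[OF u(1)[OF h(1)] _ f] h(2) X(3) by blast
      then have "z \<in> U" unfolding U_def h(2) const_cval[OF \<open>const (u h)\<close> f(1)] using u(1)[OF h(1)] by blast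
      then show ?thesis using zW by blast
    qed simp
  qed
  then have "card ((\<lambda>h. c (u h) f) ` {..t}) \<le> card (X \<union> (W' \<inter> U))" using X by (intro card_mono) auto
  moreover have "card ((\<lambda>h. c (u h) f) ` {..t}) = Suc t"
    using u(2) by (subst card_image) (auto simp: inj_on_def)
  moreover have "card (X \<union> (W' \<inter> U)) \<le> t" using card_Un_le[of X "W' \<inter> U"] X(4) by linarith
  ultimately show False by linarith
qed

lemma card_Un_le_add: "card A \<le> a \<Longrightarrow> card B' \<le> b \<Longrightarrow> a + b \<le> d \<Longrightarrow> card (A \<union> B') \<le> d"
  using card_Un_le[of A B'] by linarith

text \<open>Vertices prescribed in coordinates \<open>a\<close> and \<open>b\<close> leave
  coordinate \<open>j\<close> free, and with it the colour. Hence a vertex of \<open>Y a\<close> and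
  one of \<open>Y b\<close> always share an edge avoiding a small set, and two such edges form a
  link of length two.\<close>

lemma large_r_case:
  assumes q3: "q \<ge> 3" and i: "i \<le> t" "\<not> const (v i)"
  shows "embeds E F UNIV"
proof -
  obtain j where j: "j < q" "dep_on (v i) j" using i hom vI unfolding const_def by blast
  obtain a b where ab: "a < q" "b < q" "a \<noteq> b" "a \<noteq> j" "b \<noteq> j"
  proof (cases "j = 0")
    case True
    then show thesis using that[of 1 2] q3 by auto
  next
    case False
    show thesis
    proof (cases "j = 1")
      case True
      then show thesis using that[of 0 2] q3 by auto
    next
      case False
      then show thesis using that[of 0 1] \<open>j \<noteq> 0\<close> q3 by auto
    qed
  qed
  have pair_edge: "\<exists>e\<in>E. y \<in> e \<and> x \<in> e \<and> e \<inter> W = {}"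
    if W: "finite W" "card W \<le> B" and yx: "y \<in> Y a" "x \<in> Y b" "y \<notin> W" "x \<notin> W" for W y x
  proof -
    obtain f where f: "f \<in> Grid" "f a = y" "f b = x" "\<forall>i<q. i \<noteq> a \<longrightarrow> i \<noteq> b \<longrightarrow> good W i (f i)"
      using extend2[OF W ab(1,2) _ yx(1,2)] ab(3) by metis
    have "good W j (f j)" using f(4) j(1) ab(4,5) by simp
    then have "c (v i) f \<notin> W" using good_avoid[OF _ vI[OF i(1)] j(2) f(1)] by simp
    moreover have "f j' \<notin> W" if "j' < q" for j'
      using f(2-4) yx that good_in(2) by (cases "j' = a"; cases "j' = b") auto
    ultimately have "edge i f \<inter> W = {}" using edge_avoid[OF i(1)] by blast
    moreover have "f a \<in> edge i f" "f b \<in> edge i f" using ab unfolding edge_def by auto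
    ultimately show ?thesis using edge_in[OF f(1) i(1)] f(2,3) by blast
  qed
  have Bl_le: "Bl + 12 * r + 24 + card I \<le> B" by (rule Bl)
  have lk: "linked E r Bl (Y a) (\<lambda>_. {})"
  proof
    fix W :: "'a set" assume W: "finite W" "card W \<le> Bl"
    have "card W \<le> B" using W Bl_le by linarith
    then obtain y where "good W a y" using ex_good[of W a] W(1) ab(1) by auto
    then show "\<exists>y\<in>Y a. y \<notin> W \<and> {} \<inter> W = {}" using good_in[of W a y] by auto
    fix y y' assume y: "y \<in> Y a" "y' \<in> Y a" "y \<noteq> y'" "y \<notin> W" "y' \<notin> W"
    have "card (W \<union> {y, y'}) \<le> B"
      using W(2) Bl_le by (intro card_Un_le_add[of _ Bl _ 2]) (auto simp: card_insert_if)
    then obtain x where "good (W \<union> {y, y'}) b x" using ex_good[of "W \<union> {y, y'}" b] ab(2) W(1) by auto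
    then have x: "x \<in> Y b" "x \<notin> W" "x \<noteq> y" "x \<noteq> y'" using good_in[of "W \<union> {y, y'}" b x] by auto
    have "card (insert y' W) \<le> B" using W Bl_le by (simp add: card_insert_if)
    then obtain e1 where e1: "e1 \<in> E" "y \<in> e1" "x \<in> e1" "e1 \<inter> insert y' W = {}"
      using pair_edge[of "insert y' W" y x] W(1) y x by blast
    define W2 where "W2 = W \<union> (e1 - {x})"
    have "card (e1 - {x}) \<le> r" using E[OF e1(1)] card_Diff1_le[of e1 x] by simp
    then have "card W2 \<le> B" unfolding W2_def using W(2) Bl_le by (intro card_Un_le_add[of _ Bl _ r]) auto
    moreover have "finite W2" using W(1) fin[OF e1(1)] unfolding W2_def by simp
    moreover have "y' \<notin> W2" "x \<notin> W2" using y(5) e1(4) x(2) unfolding W2_def by auto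
    ultimately obtain e2 where e2: "e2 \<in> E" "y' \<in> e2" "x \<in> e2" "e2 \<inter> W2 = {}"
      using pair_edge[of W2 y' x] y(2) x(1) by blast
    have "e1 \<inter> e2 = {x}" unfolding Int_eq_singleton_iff using e1(3) e2(3,4) unfolding W2_def by blast
    then have "lpath E 2 y y' (e1 \<union> e2)" using e1 e2 x by (intro lpath_2) auto
    moreover have "(e1 \<union> e2) \<inter> W = {}" using e1(4) e2(4) unfolding W2_def by blast
    ultimately show "\<exists>S. lpath E 2 y y' S \<and> S \<inter> W = {}" by blast
  qed (use E r in auto)
  show ?thesis
  proof (rule embeds_F_of_linked[OF lk])
    fix W :: "'a set" assume W: "finite W" "card W \<le> Bl" "card (W \<inter> U) \<le> 2 * (k - 1)"
    define W0 where "W0 = W \<union> U"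
    have W0: "finite W0" "card W0 \<le> Bl + card I"
      unfolding W0_def using W U by (auto intro!: card_Un_le_add[of _ Bl _ "card I"])
    have W0B: "card W0 \<le> B" using W0 Bl_le by linarith
    obtain f where f: "f \<in> Grid" "\<forall>j<q. good W0 j (f j)"
      using extend0[OF W0(1) W0B] by (elim exE conjE) (rule that)
    \<comment> \<open>If the colour depends on \<open>j\<close> only, all transversals through
      \<open>f j\<close> have the value \<open>\<gamma>\<close>, which then lies in the first edge
      \<open>e1\<close>. The middle edge \<open>e2\<close> therefore uses a different
      extension.\<close>
    define \<gamma> where "\<gamma> = c (v i) f"
    have "card {\<gamma>} + card (W \<inter> U) \<le> t" using W(3) t_ge k by simp
    moreover have "W \<subseteq> W0" unfolding W0_def by blast
    ultimately obtain h where h: "h \<le> t" "c (v h) f \<notin> W \<union> {\<gamma>}"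
      using pick[of f W0 v "{\<gamma>}" W] f vI v_inj[OF f(1)] W(1) by blast
    define \<omega> where "\<omega> = c (v h) f"
    define e2 where "e2 = edge h f"
    have e2: "e2 \<in> E" unfolding e2_def using edge_in f(1) h(1) by blast
    have fW0: "f j' \<notin> W0" if "j' < q" for j' using f(2) that good_in(2) by blast
    have "good W0 j (f j)" using f(2) j(1) by blast
    then have \<gamma>W0: "\<gamma> \<notin> W0" unfolding \<gamma>_def using good_avoid[OF _ vI[OF i(1)] j(2) f(1)] by simp
    have \<gamma>e2: "\<gamma> \<notin> e2"
      using v_notin[OF f(1) i(1)] h(2) unfolding e2_def edge_def \<gamma>_def by auto
    define W1 where "W1 = W0 \<union> insert \<gamma> e2"
    have "card (insert \<gamma> e2) \<le> r + 1" using E[OF e2] fin[OF e2] by (simp add: card_insert_if)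
    then have "card W1 \<le> Bl + card I + r + 1"
      unfolding W1_def by (intro card_Un_le_add[OF W0(2)]) auto
    moreover have "finite W1" unfolding W1_def using W0(1) fin[OF e2] by simp
    ultimately have W1: "finite W1" "card W1 \<le> Bl + card I + r + 1" by auto
    have "card W1 \<le> B" using W1 Bl_le by linarith
    moreover have "f j \<in> Y j" using f(2) j(1) good_in(1) by blast
    ultimately obtain g where g: "g \<in> Grid" "g j = f j" "\<forall>i<q. i \<noteq> j \<longrightarrow> good W1 i (g i)"
      using extend1[OF W1(1) _ j(1)] by metis
    define e1 where "e1 = edge i g"
    have e1: "e1 \<in> E" unfolding e1_def using edge_in g(1) i(1) by blast
    have cg: "c (v i) g \<notin> W0 \<union> e2"
    proof (cases "\<exists>j'<q. j' \<noteq> j \<and> dep_on (v i) j'")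
      case True
      then obtain j' where "j' < q" "j' \<noteq> j" "dep_on (v i) j'" by blast
      moreover from this have "good W1 j' (g j')" using g(3) by blast
      ultimately have "c (v i) g \<notin> W1" using good_avoid[OF _ vI[OF i(1)] _ g(1)] by simp
      then show ?thesis unfolding W1_def by blast
    next
      case False
      have "c (v i) g = c (v i) f"
      proof (rule agree[OF g(1) f(1)])
        fix j' assume "j' < q" "g j' \<noteq> f j'"
        then show "indep_on (v i) j'" using False g(2) hom[OF vI[OF i(1)], of j'] by metis
      qed
      then show ?thesis using \<gamma>W0 \<gamma>e2 unfolding \<gamma>_def by simp
    qed
    have gW1: "g j' \<notin> W1" if "j' < q" "j' \<noteq> j" for j' using g(3) that good_in(2) by blast
    have fj: "f j \<in> e1" "f j \<in> e2"
    proof -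
      have "g j \<in> e1" using j(1) unfolding e1_def edge_def by blast
      then show "f j \<in> e1" using g(2) by simp
      show "f j \<in> e2" using j(1) unfolding e2_def edge_def by blast
    qed
    have e12: "e1 \<inter> e2 = {f j}" unfolding Int_eq_singleton_iff
    proof (intro conjI ballI impI fj)
      fix x assume x: "x \<in> e1" "x \<in> e2"
      show "x = f j"
      proof (rule ccontr)
        assume ne: "x \<noteq> f j"
        have "x \<noteq> c (v i) g" using cg x(2) by blast
        then obtain j' where "j' < q" "x = g j'" using x(1) unfolding e1_def edge_def by auto
        then show False using gW1[of j'] x(2) ne g(2) unfolding W1_def by auto
      qed
    qed
    have e1W0: "e1 \<inter> W0 = {}"
    proof -
      have "g j' \<notin> W0" if "j' < q" for j'
        using gW1[OF that] g(2) fW0[OF j(1)] unfolding W1_def by (cases "j' = j") auto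
      then show ?thesis unfolding e1_def using edge_avoid[OF i(1)] cg by blast
    qed
    have fb: "f b \<in> e2" "f b \<noteq> f j" "f b \<in> Y b"
    proof -
      show "f b \<in> e2" using ab(2) unfolding e2_def edge_def by blast
      show "f b \<noteq> f j" using inj[OF f(1)] ab(2,5) j(1) unfolding inj_on_def by (metis lessThan_iff)
      show "f b \<in> Y b" using f(2) ab(2) good_in(1) by blast
    qed
    have fbe1: "f b \<notin> e1" using e12 fb(1,2) unfolding Int_eq_singleton_iff by blast
    define W3 where "W3 = W0 \<union> (e1 \<union> e2)"
    have "card (e1 \<union> e2) \<le> r + r" using card_Un_le[of e1 e2] E[OF e1] E[OF e2] by simp
    then have "card W3 \<le> Bl + card I + (r + r)"
      unfolding W3_def by (intro card_Un_le_add[OF W0(2)]) auto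
    moreover have "finite W3" unfolding W3_def using W0(1) fin[OF e1] fin[OF e2] by simp
    ultimately have W3: "finite W3" "card W3 \<le> Bl + card I + (r + r)" by auto
    have W3B: "card W3 \<le> B" using W3(2) Bl_le by linarith
    obtain y' where "good W3 a y'" using ex_good[OF W3(1) W3B ab(1)] by blast
    then have y': "y' \<in> Y a" "y' \<notin> W3" using good_in[of W3 a y'] by auto
    have "card (W3 - {f b}) \<le> B" using W3B card_Diff1_le[of W3 "f b"] by linarith
    then obtain e3 where e3: "e3 \<in> E" "y' \<in> e3" "f b \<in> e3" "e3 \<inter> (W3 - {f b}) = {}"
      using pair_edge[of "W3 - {f b}" y' "f b"] W3(1) y' fb(3) by blast
    have e23: "e2 \<inter> e3 = {f b}" unfolding Int_eq_singleton_iff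
      using fb(1) e3(3,4) unfolding W3_def by blast
    have e13: "e1 \<inter> e3 = {}" using fbe1 e3(4) unfolding W3_def by blast
    define y where "y = g a"
    have y: "y \<in> e1" "y \<in> Y a" "y \<noteq> f j"
    proof -
      show "y \<in> e1" using ab(1) unfolding y_def e1_def edge_def by blast
      show "y \<in> Y a" unfolding y_def using g(3) ab(1,4) good_in(1) by blast
      show "y \<noteq> f j" using inj[OF g(1)] ab(1,4) j(1) g(2) unfolding inj_on_def y_def by (metis lessThan_iff)
    qed
    have y'e: "y' \<noteq> f b" using y'(2) fb(1) unfolding W3_def by blast
    \<comment> \<open>The path enters the middle edge in coordinate \<open>j\<close> and leaves it
      in coordinate \<open>b\<close>; this breaks the parity of the links between \<open>Y a\<close>
      and \<open>Y b\<close>.\<close>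
    define S where "S = e1 \<union> e2 \<union> e3"
    have S: "lpath E 3 y y' S"
      unfolding S_def using e1 e2 e3(1) y(1) e3(2) e12 e23 e13 y(3) y'e by (rule lpath_3)
    have fbW0: "f b \<notin> W0" using fW0 ab(2) by blast
    have e3W0: "e3 \<inter> W0 = {}" using e3(4) fbW0 unfolding W3_def by blast
    have "e2 \<inter> W = {}"
      unfolding e2_def using edge_avoid[OF h(1), of f W] h(2) fW0 unfolding W0_def by blast
    then have SW: "S \<inter> W = {}" using e1W0 e3W0 unfolding S_def W0_def by blast
    have "e2 \<inter> U \<subseteq> {\<omega>}" using fW0 unfolding e2_def edge_def \<omega>_def W0_def by auto
    then have "S \<inter> U \<subseteq> {\<omega>}" using e1W0 e3W0 unfolding S_def W0_def by blast
    then have "card (S \<inter> U) \<le> card {\<omega>}" by (intro card_mono) auto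
    then have SU: "card (S \<inter> U) \<le> 2" by simp
    have "y \<notin> U" "y' \<notin> U" using y(1) e1W0 y'(2) unfolding W0_def W3_def by blast+
    then show "\<exists>y y' S. y \<in> Y a \<and> y' \<in> Y a \<and> lpath E 3 y y' S \<and> S \<inter> W = {} \<and> y \<notin> {} \<and>
        {} \<inter> (W \<union> U \<union> S) = {} \<and> y \<notin> U \<and> y' \<notin> U \<and> card (S \<inter> U) \<le> 2"
      using y(2) y'(1) S SW SU by (intro exI[of _ y] exI[of _ y'] exI[of _ S]) simp
  qed
qed

end


text \<open>The colour \<open>w i j h\<close> sends a transversal \<open>f\<close> to the \<open>h\<close>-th extension of the set obtained
  from \<open>f\<close> by replacing its \<open>j\<close>-th vertex by the \<open>i\<close>-th extension of \<open>f\<close>.\<close>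

locale union_grid_ext = union_grid r k p l ts Q E q B t Y I c v
  for r k p l ts Q and E :: "'a set set" and q B t Y and I :: "'i set" and c v +
  fixes w :: "nat \<Rightarrow> nat \<Rightarrow> nat \<Rightarrow> 'i"
  assumes wI: "\<And>i j h. i \<le> t \<Longrightarrow> j < q \<Longrightarrow> h \<le> t \<Longrightarrow> w i j h \<in> I"
    and w_edge: "\<And>f i j h. f \<in> PiE {..<q} Y \<Longrightarrow> i \<le> t \<Longrightarrow> j < q \<Longrightarrow> h \<le> t \<Longrightarrow>
      insert (c (w i j h) f) (insert (c (v i) f) (f ` ({..<q} - {j}))) \<in> E"
    and w_notin: "\<And>f i j h. f \<in> PiE {..<q} Y \<Longrightarrow> i \<le> t \<Longrightarrow> j < q \<Longrightarrow> h \<le> t \<Longrightarrow>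
      c (w i j h) f \<notin> insert (c (v i) f) (f ` ({..<q} - {j}))"
    and w_inj: "\<And>f i j h h'. f \<in> PiE {..<q} Y \<Longrightarrow> i \<le> t \<Longrightarrow> j < q \<Longrightarrow> h \<le> t \<Longrightarrow> h' \<le> t \<Longrightarrow> h \<noteq> h' \<Longrightarrow>
      c (w i j h) f \<noteq> c (w i j h') f"

section \<open>Rank three: grids with two coordinates\<close>

locale pair_grid = union_grid_ext r k p l ts Q E q B t Y I c v w
  for r k p l ts Q and E :: "'a set set" and q B t Y and I :: "'i set" and c v w +
  fixes j j' :: nat
  assumes q2: "q = 2" and jj: "j < q" "j' < q" "j \<noteq> j'"
begin

definition pr :: "'a \<Rightarrow> 'a \<Rightarrow> nat \<Rightarrow> 'a" where "pr x y = (\<lambda>i\<in>{..<q}. if i = j then x else y)"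

definition C :: "'i \<Rightarrow> 'a \<Rightarrow> 'a \<Rightarrow> 'a" where "C i x y = c i (pr x y)"

lemma Bl_le: "Bl + 40 + card I \<le> B"
  using Bl r by linarith

lemma coords: "{..<q} = {j, j'}" "{..<q} - {j} = {j'}" "{..<q} - {j'} = {j}"
  using q2 jj by auto

lemma lt_q: "i < q \<longleftrightarrow> i = j \<or> i = j'"
  using coords(1) by auto

lemma pr_eq: "pr x y j = x" "pr x y j' = y" "pr x y ` {..<q} = {x, y}" "pr x y ` {j} = {x}" "pr x y ` {j'} = {y}"
  using jj unfolding coords by (auto simp: pr_def coords)

lemma pr_Grid: "x \<in> Y j \<Longrightarrow> y \<in> Y j' \<Longrightarrow> pr x y \<in> Grid"
  unfolding pr_def by (subst restrict_PiE_iff) (auto simp: coords jj)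

lemma C_edge: "x \<in> Y j \<Longrightarrow> y \<in> Y j' \<Longrightarrow> i \<le> t \<Longrightarrow> {C (v i) x y, x, y} \<in> E"
  using v_edge[OF pr_Grid, of x y i] unfolding C_def pr_eq .

lemma C_notin: "x \<in> Y j \<Longrightarrow> y \<in> Y j' \<Longrightarrow> i \<le> t \<Longrightarrow> C (v i) x y \<noteq> x \<and> C (v i) x y \<noteq> y"
  using v_notin[OF pr_Grid, of x y i] unfolding C_def pr_eq by auto

lemma C_inj: "x \<in> Y j \<Longrightarrow> y \<in> Y j' \<Longrightarrow> i \<le> t \<Longrightarrow> i' \<le> t \<Longrightarrow> i \<noteq> i' \<Longrightarrow> C (v i) x y \<noteq> C (v i') x y"
  using v_inj[OF pr_Grid, of x y i i'] unfolding C_def .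

lemma good_x: "good W j x \<Longrightarrow> y \<in> Y j' \<Longrightarrow> i \<in> I \<Longrightarrow> dep_on i j \<Longrightarrow> C i x y \<notin> W"
  using good_avoid[of W j "pr x y" i] good_in(1)[of W j x] pr_Grid[of x y] pr_eq(1)[of x y] unfolding C_def by simp

lemma good_y: "good W j' y \<Longrightarrow> x \<in> Y j \<Longrightarrow> i \<in> I \<Longrightarrow> dep_on i j' \<Longrightarrow> C i x y \<notin> W"
  using good_avoid[of W j' "pr x y" i] good_in(1)[of W j' y] pr_Grid[of x y] pr_eq(2)[of x y] unfolding C_def by simp

lemma C_indep_y:
  assumes "indep_on i j'" "x \<in> Y j" "y \<in> Y j'" "y' \<in> Y j'"
  shows "C i x y = C i x y'"
  unfolding C_def
proof (rule agree)
  fix i' assume "i' < q" "pr x y i' \<noteq> pr x y' i'"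
  then show "indep_on i i'" using assms(1) pr_eq lt_q by metis
qed (use assms pr_Grid in auto)

lemma C_indep_x:
  assumes "indep_on i j" "x \<in> Y j" "x' \<in> Y j" "y \<in> Y j'"
  shows "C i x y = C i x' y"
  unfolding C_def
proof (rule agree)
  fix i' assume "i' < q" "pr x y i' \<noteq> pr x' y i'"
  then show "indep_on i i'" using assms(1) pr_eq lt_q by metis
qed (use assms pr_Grid in auto)

lemma C_dep_y:
  assumes "dep_on i j'" "x \<in> Y j" "y \<in> Y j'" "y' \<in> Y j'" "y \<noteq> y'"
  shows "C i x y \<noteq> C i x y'"
  using assms pr_Grid[of x y] pr_Grid[of x y'] pr_eq(2)[of x y] pr_eq(2)[of x y']
  unfolding C_def dep_coord_def by metis

lemma dep_not_indep: "dep_on i j \<Longrightarrow> \<not> indep_on i j"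
proof
  assume dep: "dep_on i j" and ind: "indep_on i j"
  have "card (Y j) > 1" using card_Y[OF jj(1)] Bl_le by simp
  then obtain x x' where x: "x \<in> Y j" "x' \<in> Y j" "x \<noteq> x'"
    by (metis One_nat_def card_le_Suc0_iff_eq finite_Y jj(1) not_le)
  obtain y where y: "y \<in> Y j'" using card_Y[OF jj(2)] by fastforce
  have "C i x y = C i x' y" using C_indep_x[OF ind x(1,2) y] .
  moreover have "C i x y \<noteq> C i x' y"
    using dep x pr_Grid[of x y] pr_Grid[of x' y] pr_eq(1)[of x y] pr_eq(1)[of x' y] y
    unfolding C_def dep_coord_def by metis
  ultimately show False by simp
qed

text \<open>With \<open>x\<close> exchanged for the extension of the pair, there is an edge through
  that extension and \<open>y\<close> for each of \<open>t + 1\<close> third vertices.\<close>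

lemma wy:
  assumes "x \<in> Y j" "y \<in> Y j'" "i \<le> t" "h \<le> t"
  shows "{C (w i j h) x y, C (v i) x y, y} \<in> E" "C (w i j h) x y \<noteq> C (v i) x y" "C (w i j h) x y \<noteq> y"
  using w_edge[OF pr_Grid[OF assms(1,2)] assms(3) jj(1) assms(4)]
    w_notin[OF pr_Grid[OF assms(1,2)] assms(3) jj(1) assms(4)]
  unfolding coords(2) pr_eq C_def by auto

lemma wx:
  assumes "x \<in> Y j" "y \<in> Y j'" "i \<le> t" "h \<le> t"
  shows "{C (w i j' h) x y, C (v i) x y, x} \<in> E" "C (w i j' h) x y \<noteq> C (v i) x y" "C (w i j' h) x y \<noteq> x"
  using w_edge[OF pr_Grid[OF assms(1,2)] assms(3) jj(2) assms(4)]
    w_notin[OF pr_Grid[OF assms(1,2)] assms(3) jj(2) assms(4)]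
  unfolding coords(3) pr_eq C_def by auto

lemma pick_w:
  assumes g: "good W j x" "good W j' y" and i: "i \<le> t" and j'': "j'' < q"
    and X: "finite X" "finite W'" "W' \<subseteq> W" "card X + card (W' \<inter> U) \<le> t"
  obtains h where "h \<le> t" "C (w i j'' h) x y \<notin> W'" "C (w i j'' h) x y \<notin> X"
proof -
  have G: "pr x y \<in> Grid" using g good_in(1) pr_Grid by blast
  have "good W i' (pr x y i')" if "i' < q" for i'
    using that g unfolding lt_q by (auto simp: pr_eq)
  then have "\<exists>h\<le>t. c (w i j'' h) (pr x y) \<notin> W' \<union> X"
    using wI[OF i j''] w_inj[OF G i j''] X by (intro pick[OF G]) auto
  then show thesis using that unfolding C_def by blast
qed

lemma xy_ne: "x \<in> Y j \<Longrightarrow> y \<in> Y j' \<Longrightarrow> x \<noteq> y"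
  using disjoint_Y[OF jj] by blast

text \<open>As the colour depends on both coordinates, the edges over \<open>x\<close>,
  \<open>y\<close> and over \<open>x\<close>, \<open>y'\<close> can be made to meet in
  \<open>x\<close> only. For length three, the way from \<open>x\<close> to \<open>y'\<close> leads
  through the value \<open>g\<close> of this pair, by edges over \<open>{g, x}\<close> and
  \<open>{g, y'}\<close>. Their third vertices may be constant values, whence the bound 2 on
  \<open>card (S \<inter> U)\<close>.\<close>

lemma injective_colour_case:
  assumes i: "i \<le> t" and dep: "dep_on (v i) j" "dep_on (v i) j'"
  shows "embeds E F UNIV"
proof -
  have vi: "v i \<in> I" using vI i by blast
  have lk: "linked E r Bl (Y j') (\<lambda>_. {})"
  proof
    fix W :: "'a set" assume W: "finite W" "card W \<le> Bl"
    have "card W \<le> B" using W Bl_le by linarith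
    then obtain y where "good W j' y" using ex_good[of W j'] W(1) jj(2) by auto
    then show "\<exists>y\<in>Y j'. y \<notin> W \<and> {} \<inter> W = {}" using good_in[of W j' y] by auto
    fix y y' assume y: "y \<in> Y j'" "y' \<in> Y j'" "y \<noteq> y'" "y \<notin> W" "y' \<notin> W"
    have "card (W \<union> {y, y'}) \<le> B"
      using W(2) Bl_le by (intro card_Un_le_add[of _ Bl _ 2]) (auto simp: card_insert_if)
    then obtain x where x: "good (W \<union> {y, y'}) j x" using ex_good[of "W \<union> {y, y'}" j] W(1) jj(1) by auto
    have xY: "x \<in> Y j" "x \<notin> W \<union> {y, y'}" using good_in[OF x] by auto
    have cW: "C (v i) x y \<notin> W \<union> {y, y'}" "C (v i) x y' \<notin> W \<union> {y, y'}"
      using good_x[OF x _ vi dep(1)] y by auto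
    have ne: "C (v i) x y \<noteq> C (v i) x y'" using C_dep_y[OF dep(2) xY(1) y(1-3)] .
    have "{C (v i) x y, x, y} \<inter> {C (v i) x y', x, y'} = {x}"
      using cW ne y xY C_notin[OF xY(1) y(1) i] C_notin[OF xY(1) y(2) i] by auto
    then have "lpath E 2 y y' ({C (v i) x y, x, y} \<union> {C (v i) x y', x, y'})"
      using C_edge[OF xY(1) _ i] y xY by (intro lpath_2[where x = x]) auto
    moreover have "({C (v i) x y, x, y} \<union> {C (v i) x y', x, y'}) \<inter> W = {}" using cW y xY by auto
    ultimately show "\<exists>S. lpath E 2 y y' S \<and> S \<inter> W = {}" by blast
  qed (use E r in auto)
  show ?thesis
  proof (rule embeds_F_of_linked[OF lk])
    fix W :: "'a set" assume W: "finite W" "card W \<le> Bl" "card (W \<inter> U) \<le> 2 * (k - 1)"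
    define W0 where "W0 = W \<union> U"
    have W0: "finite W0" "card W0 \<le> Bl + card I" "W \<subseteq> W0"
      unfolding W0_def using W U by (auto intro!: card_Un_le_add[of _ Bl _ "card I"])
    have W0B: "card W0 \<le> B" using W0 Bl_le by linarith
    obtain x where x: "good W0 j x" using ex_good[OF W0(1) W0B jj(1)] by blast
    obtain y' where y': "good W0 j' y'" using ex_good[OF W0(1) W0B jj(2)] by blast
    have xY: "x \<in> Y j" "x \<notin> W0" and yY: "y' \<in> Y j'" "y' \<notin> W0" using good_in x y' by blast+
    define g where "g = C (v i) x y'"
    have gW0: "g \<notin> W0" unfolding g_def using good_x[OF x yY(1) vi dep(1)] .
    have gn: "g \<noteq> x" "g \<noteq> y'" unfolding g_def using C_notin[OF xY(1) yY(1) i] by auto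
    have "card {x} + card (W \<inter> U) \<le> t" using W(3) t_ge k by simp
    then obtain h where h: "h \<le> t" "C (w i j h) x y' \<notin> W" "C (w i j h) x y' \<notin> {x}"
      using pick_w[OF x y' i jj(1) _ W(1) W0(3), of "{x}"] by auto
    define z' where "z' = C (w i j h) x y'"
    have z': "{z', g, y'} \<in> E" "z' \<noteq> g" "z' \<noteq> y'" "z' \<notin> W" "z' \<noteq> x"
      using wy[OF xY(1) yY(1) i h(1)] h(2,3) unfolding z'_def g_def by auto
    have "card {y', z'} + card (W \<inter> U) \<le> t" using W(3) t_ge k z'(3) by (simp add: card_insert_if)
    then obtain h' where h': "h' \<le> t" "C (w i j' h') x y' \<notin> W" "C (w i j' h') x y' \<notin> {y', z'}"
      using pick_w[OF x y' i jj(2) _ W(1) W0(3), of "{y', z'}"] by auto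
    define z where "z = C (w i j' h') x y'"
    have z: "{z, g, x} \<in> E" "z \<noteq> g" "z \<noteq> x" "z \<notin> W" "z \<noteq> y'" "z \<noteq> z'"
      using wx[OF xY(1) yY(1) i h'(1)] h'(2,3) unfolding z_def g_def by auto
    define W1 where "W1 = W0 \<union> {x, y', g, z, z'}"
    have "card W1 \<le> B"
      unfolding W1_def using Bl_le by (intro card_Un_le_add[OF W0(2), of _ 5]) (auto simp: card_insert_if)
    then obtain y where y: "good W1 j' y" using ex_good[of W1 j'] W0(1) jj(2) unfolding W1_def by auto
    have yY': "y \<in> Y j'" "y \<notin> W1" using good_in[OF y] by auto
    define u where "u = C (v i) x y"
    have u: "{u, x, y} \<in> E" "u \<noteq> x" "u \<noteq> y" "u \<notin> W1"
      using C_edge[OF xY(1) yY'(1) i] C_notin[OF xY(1) yY'(1) i] good_y[OF y xY(1) vi dep(2)]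
      unfolding u_def by auto
    define S where "S = {u, x, y} \<union> {z, g, x} \<union> {z', g, y'}"
    have xy: "x \<noteq> y" "x \<noteq> y'" using xy_ne xY(1) yY(1) yY'(1) by blast+
    have uy: "u \<notin> W0" "u \<noteq> y'" "u \<noteq> g" "u \<noteq> z" "u \<noteq> z'" "y \<notin> W0" "y \<noteq> y'" "y \<noteq> g" "y \<noteq> z" "y \<noteq> z'"
      using u(4) yY'(2) unfolding W1_def by auto
    have "lpath E 3 y y' S" unfolding S_def
    proof (rule lpath_3[where x = x and z = g])
      show "{u, x, y} \<inter> {z, g, x} = {x}" using uy gn z(2,3) xy by auto
      show "{z, g, x} \<inter> {z', g, y'} = {g}" using z z' gn xy by auto
      show "{u, x, y} \<inter> {z', g, y'} = {}" using uy u gn z' xy by auto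
    qed (use u z z' gn xy in auto)
    moreover have "S \<inter> W = {}" using uy xY yY gW0 z(4) z'(4) W0(3) unfolding S_def by blast
    moreover have "card (S \<inter> U) \<le> 2"
    proof -
      have "U \<subseteq> W0" unfolding W0_def by blast
      then have "S \<inter> U \<subseteq> {z, z'}" using uy xY yY gW0 unfolding S_def by blast
      then have "card (S \<inter> U) \<le> card {z, z'}" by (intro card_mono) auto
      then show ?thesis using z(6) by simp
    qed
    moreover have "y \<notin> U" "y' \<notin> U" using uy(6) yY(2) unfolding W0_def by auto
    ultimately show "\<exists>y y' S. y \<in> Y j' \<and> y' \<in> Y j' \<and> lpath E 3 y y' S \<and> S \<inter> W = {} \<and> y \<notin> {} \<and>
        {} \<inter> (W \<union> U \<union> S) = {} \<and> y \<notin> U \<and> y' \<notin> U \<and> card (S \<inter> U) \<le> 2"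
      using yY(1) yY'(1) by (intro exI[of _ y] exI[of _ y'] exI[of _ S]) simp
  qed
qed

text \<open>The first colour pairs each \<open>x\<close> with a twin, so that the two cannot be separated; the second
  colour provides the way out of \<open>x\<close>.\<close>

lemma twin_case:
  assumes i: "i1 \<le> t" "i2 \<le> t" "i1 \<noteq> i2" and d1: "dep_on (v i1) j" "indep_on (v i1) j'"
    and d2: "dep_on (v i2) j \<and> indep_on (v i2) j' \<or> indep_on (v i2) j \<and> dep_on (v i2) j'"
  shows "embeds E F UNIV"
proof -
  have vi: "v i1 \<in> I" "v i2 \<in> I" using vI i by blast+
  obtain x0 where "good {} j x0" using ex_good[of "{}" j] jj(1) by auto
  then have x0: "x0 \<in> Y j" using good_in by blast
  \<comment> \<open>If the second colour ignores \<open>x\<close>, its value is tied to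
    \<open>y\<close> and no choice of \<open>x\<close> can move it, so it becomes the companion of
    \<open>y\<close>. Otherwise a good \<open>x\<close> keeps the value free.\<close>
  define \<rho> where "\<rho> y = (if indep_on (v i2) j then {C (v i2) x0 y} else {})" for y
  have rho_eq: "\<rho> y = {C (v i2) x y}" if "indep_on (v i2) j" "x \<in> Y j" "y \<in> Y j'" for x y
    using that C_indep_x[OF that(1) x0 that(2,3)] unfolding \<rho>_def by simp
  have rho_new: "\<rho> y \<inter> W = {}" if "good W j' y" for W y
    using good_y[OF that x0 vi(2)] d2 dep_not_indep[of "v i2"] unfolding \<rho>_def by auto
  have lk: "linked E r Bl (Y j') \<rho>"
  proof
    fix W :: "'a set" assume W: "finite W" "card W \<le> Bl"
    have "card W \<le> B" using W Bl_le by linarith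
    then obtain y where y: "good W j' y" using ex_good[of W j'] W(1) jj(2) by auto
    then show "\<exists>y\<in>Y j'. y \<notin> W \<and> \<rho> y \<inter> W = {}" using good_in[of W j' y] rho_new[OF y] by auto
    fix y y' assume y: "y \<in> Y j'" "y' \<in> Y j'" "y \<noteq> y'" "y \<notin> \<rho> y'" "y \<notin> W" "y' \<notin> W" "\<rho> y' \<inter> W = {}"
    have "card (W \<union> {y, y'}) \<le> B"
      using W(2) Bl_le by (intro card_Un_le_add[of _ Bl _ 2]) (auto simp: card_insert_if)
    then obtain x where x: "good (W \<union> {y, y'}) j x" using ex_good[of "W \<union> {y, y'}" j] W(1) jj(1) by auto
    have xY: "x \<in> Y j" "x \<notin> W \<union> {y, y'}" using good_in[OF x] by auto
    define a where "a = C (v i1) x y"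
    define b where "b = C (v i2) x y'"
    have a: "a \<notin> W \<union> {y, y'}" "{a, x, y} \<in> E" "a \<noteq> x"
      unfolding a_def using good_x[OF x _ vi(1) d1(1)] y C_edge[OF xY(1) _ i(1)] C_notin[OF xY(1) _ i(1)] by auto
    have b: "{b, x, y'} \<in> E" "b \<noteq> x" "b \<noteq> y'"
      unfolding b_def using y C_edge[OF xY(1) _ i(2)] C_notin[OF xY(1) _ i(2)] by auto
    have bW: "b \<notin> W \<union> {y}"
    proof (cases "dep_on (v i2) j")
      case True
      then show ?thesis using good_x[OF x y(2) vi(2)] unfolding b_def by blast
    next
      case False
      then have "\<rho> y' = {b}" using d2 rho_eq[OF _ xY(1) y(2)] unfolding b_def by blast
      then show ?thesis using y(4,7) by auto
    qed
    have "a = C (v i1) x y'" unfolding a_def using C_indep_y[OF d1(2) xY(1) y(1,2)] .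
    then have "a \<noteq> b" unfolding b_def using C_inj[OF xY(1) y(2) i] by simp
    then have "{a, x, y} \<inter> {b, x, y'} = {x}" using a b bW y xY by auto
    then have "lpath E 2 y y' ({a, x, y} \<union> {b, x, y'})"
      using a b xY by (intro lpath_2[where x = x]) auto
    moreover have "({a, x, y} \<union> {b, x, y'}) \<inter> W = {}" using a bW y xY by auto
    ultimately show "\<exists>S. lpath E 2 y y' S \<and> S \<inter> W = {}" by blast
  qed (use E r in \<open>auto simp: \<rho>_def\<close>)
  show ?thesis
  proof (rule embeds_F_of_linked[OF lk])
    fix W :: "'a set" assume W: "finite W" "card W \<le> Bl" "card (W \<inter> U) \<le> 2 * (k - 1)"
    define W0 where "W0 = W \<union> U"
    have W0: "finite W0" "card W0 \<le> Bl + card I" "W \<subseteq> W0"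
      unfolding W0_def using W U by (auto intro!: card_Un_le_add[of _ Bl _ "card I"])
    have W0B: "card W0 \<le> B" using W0 Bl_le by linarith
    obtain x where x: "good W0 j x" using ex_good[OF W0(1) W0B jj(1)] by blast
    obtain y1 where y1: "good W0 j' y1" using ex_good[OF W0(1) W0B jj(2)] by blast
    have xY: "x \<in> Y j" "x \<notin> W0" and y1Y: "y1 \<in> Y j'" "y1 \<notin> W0" using good_in x y1 by blast+
    define g where "g = C (v i1) x y1"
    define d where "d = C (v i2) x y1"
    have g_eq: "C (v i1) x y = g" if "y \<in> Y j'" for y
      unfolding g_def using C_indep_y[OF d1(2) xY(1) that y1Y(1)] .
    have g: "g \<notin> W0" "g \<noteq> x" "g \<noteq> y1"
      unfolding g_def using good_x[OF x y1Y(1) vi(1) d1(1)] C_notin[OF xY(1) y1Y(1) i(1)] by auto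
    have d: "d \<notin> W0" "d \<noteq> x" "d \<noteq> y1" "d \<noteq> g"
      unfolding d_def g_def
      using good_x[OF x y1Y(1) vi(2)] good_y[OF y1 xY(1) vi(2)] d2 C_notin[OF xY(1) y1Y(1) i(2)]
        C_inj[OF xY(1) y1Y(1) i] by auto
    \<comment> \<open>\<open>d\<close> is the possible companion of the end \<open>y1\<close> and
      has to stay off the path, so \<open>z\<close> must differ from it.\<close>
    have "card {x, d} + card (W \<inter> U) \<le> t" using W(3) t_ge k d(2) by (simp add: card_insert_if)
    then obtain h where h: "h \<le> t" "C (w i1 j h) x y1 \<notin> W" "C (w i1 j h) x y1 \<notin> {x, d}"
      using pick_w[OF x y1 i(1) jj(1) _ W(1) W0(3), of "{x, d}"] by auto
    define z where "z = C (w i1 j h) x y1"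
    have z: "{z, g, y1} \<in> E" "z \<noteq> g" "z \<noteq> y1" "z \<notin> W" "z \<noteq> x" "z \<noteq> d"
      using wy[OF xY(1) y1Y(1) i(1) h(1)] h(2,3) unfolding z_def g_def by auto
    define W1 where "W1 = W0 \<union> {x, y1, g, d, z}"
    have W1B: "card W1 \<le> Bl + card I + 5"
      unfolding W1_def by (intro card_Un_le_add[OF W0(2), of _ 5]) (auto simp: card_insert_if)
    have "card W1 \<le> B" using W1B Bl_le by linarith
    then obtain y2 where y2: "good W1 j' y2" using ex_good[of W1 j'] W0(1) jj(2) unfolding W1_def by auto
    have y2Y: "y2 \<in> Y j'" "y2 \<notin> W1" using good_in[OF y2] by auto
    have "card (W1 \<union> {y2}) \<le> B" using Bl_le by (intro card_Un_le_add[OF W1B, of _ 1]) auto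
    then obtain y where y: "good (W1 \<union> {y2}) j' y"
      using ex_good[of "W1 \<union> {y2}" j'] W0(1) jj(2) unfolding W1_def by auto
    have yY: "y \<in> Y j'" "y \<notin> W1" "y \<noteq> y2" using good_in[OF y] by auto
    define u where "u = C (v i2) x y"
    have u: "{u, x, y} \<in> E" "u \<noteq> x" "u \<noteq> y"
      using C_edge[OF xY(1) yY(1) i(2)] C_notin[OF xY(1) yY(1) i(2)] unfolding u_def by auto
    have uW: "u \<notin> W0 \<union> {z, g, y1, y2}" "indep_on (v i2) j \<Longrightarrow> u \<noteq> d"
    proof -
      have "u \<notin> W0 \<union> {z, g, y1, y2} \<and> (indep_on (v i2) j \<longrightarrow> u \<noteq> d)"
        using d2
      proof
        assume "dep_on (v i2) j \<and> indep_on (v i2) j'"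
        then have dep: "dep_on (v i2) j" "indep_on (v i2) j'" by auto
        have "u = d" unfolding u_def d_def using C_indep_y[OF dep(2) xY(1) yY(1) y1Y(1)] .
        moreover have "d = C (v i2) x y2" unfolding d_def using C_indep_y[OF dep(2) xY(1) y1Y(1) y2Y(1)] .
        then have "d \<noteq> y2" using C_notin[OF xY(1) y2Y(1) i(2)] by simp
        moreover have "\<not> indep_on (v i2) j" using dep_not_indep[OF dep(1)] .
        ultimately show ?thesis using d z by auto
      next
        assume "indep_on (v i2) j \<and> dep_on (v i2) j'"
        then have "u \<notin> W1 \<union> {y2}" unfolding u_def using good_y[OF y xY(1) vi(2)] by blast
        then show ?thesis unfolding W1_def by auto
      qed
      then show "u \<notin> W0 \<union> {z, g, y1, y2}" "indep_on (v i2) j \<Longrightarrow> u \<noteq> d" by auto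
    qed
    \<comment> \<open>The middle edge leads from \<open>x\<close> to its twin \<open>g\<close>: the
      first colour ignores the second coordinate, so \<open>g\<close> extends every pair containing
      \<open>x\<close>.\<close>
    have e2: "{g, x, y2} \<in> E" using C_edge[OF xY(1) y2Y(1) i(1)] g_eq[OF y2Y(1)] by simp
    define S where "S = {u, x, y} \<union> {g, x, y2} \<union> {z, g, y1}"
    have xy: "x \<noteq> y" "x \<noteq> y1" "x \<noteq> y2" using xy_ne xY(1) yY(1) y1Y(1) y2Y(1) by blast+
    have uy: "u \<notin> W0" "u \<noteq> y1" "u \<noteq> y2" "u \<noteq> g" "u \<noteq> z" using uW by auto
    have yy: "y \<notin> W0" "y \<noteq> y1" "y \<noteq> g" "y \<noteq> z" "y \<noteq> d" "y2 \<notin> W0" "y2 \<noteq> y1" "y2 \<noteq> g" "y2 \<noteq> z" "y2 \<noteq> d"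
      using yY y2Y unfolding W1_def by auto
    have "lpath E 3 y y1 S" unfolding S_def
    proof (rule lpath_3[where x = x and z = g])
      show "{u, x, y} \<inter> {g, x, y2} = {x}" using uy yy yY xy g by auto
      show "{g, x, y2} \<inter> {z, g, y1} = {g}" using z g yy xy by auto
      show "{u, x, y} \<inter> {z, g, y1} = {}" using uy u g z xy yy by auto
    qed (use u z e2 g xy in auto)
    moreover have "S \<inter> W = {}" using uy xY yy y1Y g z(4) W0(3) unfolding S_def by blast
    moreover have "card (S \<inter> U) \<le> 2"
    proof -
      have "U \<subseteq> W0" unfolding W0_def by blast
      then have "S \<inter> U \<subseteq> {z}" using uy xY yy y1Y g unfolding S_def by blast
      then have "card (S \<inter> U) \<le> card {z}" by (intro card_mono) auto
      then show ?thesis by simp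
    qed
    moreover have "y \<notin> U" "y1 \<notin> U" using yy y1Y(2) unfolding W0_def by auto
    moreover have "y \<notin> \<rho> y1" "\<rho> y1 \<inter> (W \<union> U \<union> S) = {}"
    proof -
      have "y \<notin> \<rho> y1 \<and> \<rho> y1 \<inter> (W0 \<union> S) = {}"
      proof (cases "indep_on (v i2) j")
        case True
        have "\<rho> y1 = {d}" unfolding d_def using rho_eq[OF True xY(1) y1Y(1)] .
        then show ?thesis using d z yy uW(2)[OF True] unfolding S_def by auto
      next
        case False
        then show ?thesis by (simp add: \<rho>_def)
      qed
      then show "y \<notin> \<rho> y1" "\<rho> y1 \<inter> (W \<union> U \<union> S) = {}" unfolding W0_def by auto
    qed
    ultimately show "\<exists>y y' S. y \<in> Y j' \<and> y' \<in> Y j' \<and> lpath E 3 y y' S \<and> S \<inter> W = {} \<and> y \<notin> \<rho> y' \<and>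
        \<rho> y' \<inter> (W \<union> U \<union> S) = {} \<and> y \<notin> U \<and> y' \<notin> U \<and> card (S \<inter> U) \<le> 2"
      using yY(1) y1Y(1) by (intro exI[of _ y] exI[of _ y1] exI[of _ S]) simp
  qed
qed

end

text \<open>With three or more coordinates one nonconstant colour is enough for links. With two,
  either some colour depends on both, or two nonconstant colours depend on one coordinate each, and
  \<open>j\<close> is named after the first of them.\<close>

lemma (in union_grid_ext) embeds_F_of_grid: "embeds E F UNIV"
proof -
  consider (core) i0 where "i0 \<le> t" "\<And>i. i \<le> t \<Longrightarrow> i \<noteq> i0 \<Longrightarrow> const (v i)"
    | (two) i1 i2 where "i1 \<le> t" "i2 \<le> t" "i1 \<noteq> i2" "\<not> const (v i1)" "\<not> const (v i2)"
    by (metis le0)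
  then show ?thesis
  proof cases
    case core
    then show ?thesis by (rule core_case)
  next
    case two
    show ?thesis
    proof (cases "q \<ge> 3")
      case True
      then show ?thesis using large_r_case two by blast
    next
      case False
      then have q: "q = 2" using q2 by simp
      have lt: "i < q \<longleftrightarrow> i = 0 \<or> i = 1" for i using q by auto
      show ?thesis
      proof (cases "\<exists>i\<le>t. dep_on (v i) 0 \<and> dep_on (v i) 1")
        case True
        then obtain i where i: "i \<le> t" "dep_on (v i) 0" "dep_on (v i) 1" by blast
        interpret pg: pair_grid r k p l ts Q E q B t Y I c v w 0 1
          by unfold_locales (use q in auto)
        show ?thesis using pg.injective_colour_case[OF i] .
      next
        case False
        have one: "\<exists>j j'. {j, j'} = {0, 1::nat} \<and> dep_on (v i) j \<and> indep_on (v i) j'"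
          if i: "i \<le> t" "\<not> const (v i)" for i
        proof -
          obtain j where "j < q" "\<not> indep_on (v i) j" using i(2) unfolding const_def by auto
          then have j: "j < q" "dep_on (v i) j" using hom[OF vI[OF i(1)], of j] by auto
          have jj: "j < q" "1 - j < q" "{j, 1 - j} = {0, 1}" using j(1) lt[of j] q by auto
          have no: "\<not> (dep_on (v i) 0 \<and> dep_on (v i) 1)" using False i(1) by simp
          have "j = 0 \<or> j = 1" using j(1) lt by simp
          then have "\<not> dep_on (v i) (1 - j)"
          proof
            assume "j = 0"
            then show ?thesis using no j(2) by simp
          next
            assume "j = 1"
            then show ?thesis using no j(2) by simp
          qed
          then have "indep_on (v i) (1 - j)" using hom[OF vI[OF i(1)] jj(2)] by simp
          then show ?thesis using j(2) jj(3) by (intro exI[of _ j] exI[of _ "1 - j"]) simp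
        qed
        obtain j j' where j: "{j, j'} = {0, 1::nat}" "dep_on (v i1) j" "indep_on (v i1) j'"
          using one two by blast
        obtain a a' where a: "{a, a'} = {0, 1::nat}" "dep_on (v i2) a" "indep_on (v i2) a'"
          using one two by blast
        have "(a = j \<and> a' = j') \<or> (a = j' \<and> a' = j)" using j(1) a(1) by (auto simp: doubleton_eq_iff)
        then have d2: "dep_on (v i2) j \<and> indep_on (v i2) j' \<or> indep_on (v i2) j \<and> dep_on (v i2) j'"
          using a(2,3) by auto
        interpret pg: pair_grid r k p l ts Q E q B t Y I c v w j j'
          by unfold_locales (use q j(1) in \<open>auto simp: doubleton_eq_iff\<close>)
        show ?thesis using pg.twin_case[OF two(1-3) j(2,3) d2] .
      qed
    qed
  qed
qed


section \<open>The upper bound\<close>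

definition shadow :: "nat \<Rightarrow> 'a set set \<Rightarrow> 'a set set" where
  "shadow n K = {A. card A = n \<and> (\<exists>S\<in>K. A \<subseteq> S)}"

lemma finite_shadow:
  assumes "finite V" "\<And>S. S \<in> K \<Longrightarrow> S \<subseteq> V"
  shows "finite (shadow n K)"
proof -
  have "shadow n K \<subseteq> Pow V" using assms(2) unfolding shadow_def by blast
  then show ?thesis using assms(1) finite_subset by blast
qed

lemma full_extensions:
  assumes "full d E" and E: "\<And>e. e \<in> E \<Longrightarrow> card e = Suc q" and A: "A \<in> shadow q E"
  shows "d \<le> card (ext E A)"
proof -
  obtain e where e: "e \<in> E" "A \<subseteq> e" "card A = q" using A unfolding shadow_def by blast
  have "finite e" using E[OF e(1)] by (intro card_ge_0_finite) simp
  then have "card (e - A) = 1" using e E[OF e(1)] by (simp add: card_Diff_subset finite_subset)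
  then obtain x where "e - A = {x}" by (auto simp: card_1_singleton_iff)
  then have "A = e - {x}" "x \<in> e" using e(2) by auto
  then show ?thesis using assms(1) e(1) unfolding full_def by blast
qed

text \<open>The left summand indexes the extensions of a transversal, the right one the extensions
  obtained after one exchange.\<close>

definition colours :: "nat \<Rightarrow> nat \<Rightarrow> (nat + nat \<times> nat \<times> nat) set" where
  "colours t q = Inl ` {..t} \<union> Inr ` ({..t} \<times> {..<q} \<times> {..t})"

context expanded_union
begin

definition t where "t = (\<Sum>i=1..k. (l i + 1) div 2) + p - 1"

text \<open>The constants are fixed from the inside out: \<open>B\<close> from the components, the
  part size \<open>m\<close> from \<open>B\<close>, the Ramsey number \<open>M\<close> from
  \<open>m\<close>, and \<open>n0\<close> from \<open>\<epsilon>\<close> and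
  \<open>M\<close>.\<close>

lemma embeds_F_of_dense:
  assumes "\<epsilon> > (0::real)"
  shows "\<exists>n0. \<forall>(V :: 'a set) E. finite V \<longrightarrow> card V \<ge> n0 \<longrightarrow> (\<forall>e\<in>E. e \<subseteq> V \<and> card e = r) \<longrightarrow>
    full (t + 1) E \<longrightarrow> real (card (shadow (r - 1) E)) \<ge> \<epsilon> * real (card V) ^ (r - 1) \<longrightarrow> embeds E F UNIV"
proof -
  define q where "q = r - 1"
  have q: "r = Suc q" using r unfolding q_def by simp
  define I where "I = colours t q"
  have I: "finite I" unfolding I_def colours_def by simp
  define B where "B = (k + p + 9) * (L * (2 * r + 4)) + 2 * card I + 4 * t + 20"
  define m where "m = max 3 (Suc (B * Suc (card I)))"
  have m3: "3 \<le> m" unfolding m_def by simp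
  obtain M where M: "\<forall>(X :: nat \<Rightarrow> 'a set) (c :: nat + nat \<times> nat \<times> nat \<Rightarrow> (nat \<Rightarrow> 'a) \<Rightarrow> 'a). (\<forall>j<q. card (X j) = M) \<longrightarrow>
    (\<exists>Y. (\<forall>j<q. Y j \<subseteq> X j \<and> card (Y j) = m) \<and>
      (\<forall>i\<in>I. \<forall>j<q. indep_coord q Y (c i) j \<or> dep_coord q Y (c i) j))"
    using homogeneous_grid[OF I m3, of q] by (elim exE) (rule that)
  obtain n0 where n0: "\<forall>(V :: 'a set) T. finite V \<longrightarrow> card V \<ge> n0 \<longrightarrow> T \<subseteq> ({..<q} \<rightarrow>\<^sub>E V) \<longrightarrow>
    real (card T) \<ge> \<epsilon> * real (card V) ^ q \<longrightarrow>
    (\<exists>X. (\<forall>j<q. X j \<subseteq> V \<and> card (X j) = M) \<and> PiE {..<q} X \<subseteq> T)"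
    using dense_grid[OF assms, of q M] by (elim exE) (rule that)
  show ?thesis
  proof (intro exI[of _ n0] allI impI)
    fix V :: "'a set" and E
    assume V: "finite V" "n0 \<le> card V" and E: "\<forall>e\<in>E. e \<subseteq> V \<and> card e = r" and full: "full (t + 1) E"
      and dense: "\<epsilon> * real (card V) ^ (r - 1) \<le> real (card (shadow (r - 1) E))"
    have Er: "card e = r" if "e \<in> E" for e using E that by blast
    have Eq: "card e = Suc q" if "e \<in> E" for e using Er[OF that] q by simp
    \<comment> \<open>Every set of the shadow has at least one ordering, so the tuples inherit its
      density. Injectivity of the tuples separates the parts of the grid.\<close>
    define T where "T = {f \<in> {..<q} \<rightarrow>\<^sub>E V. inj_on f {..<q} \<and> f ` {..<q} \<in> shadow q E}"
    have T: "finite T" "T \<subseteq> ({..<q} \<rightarrow>\<^sub>E V)" using V(1) unfolding T_def by (auto simp: finite_PiE)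
    have "shadow q E \<subseteq> (\<lambda>f. f ` {..<q}) ` T"
    proof
      fix A assume A: "A \<in> shadow q E"
      then have cA: "card A = q" "A \<subseteq> V" using E unfolding shadow_def by auto
      then have "finite A" using V(1) finite_subset by blast
      then obtain f where f: "bij_betw f {..<q} A"
        using finite_same_card_bij[of "{..<q}" A] cA(1) by auto
      define g where "g = restrict f {..<q}"
      have "inj_on g {..<q}" "g ` {..<q} = A"
        using f unfolding g_def bij_betw_def inj_on_def by auto
      moreover have "g \<in> {..<q} \<rightarrow>\<^sub>E V"
        unfolding g_def restrict_PiE_iff using f cA(2) unfolding bij_betw_def by auto
      ultimately have "g \<in> T" "A = g ` {..<q}" using A unfolding T_def by auto
      then show "A \<in> (\<lambda>f. f ` {..<q}) ` T" by (intro image_eqI[of _ _ g])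
    qed
    then have "card (shadow q E) \<le> card ((\<lambda>f. f ` {..<q}) ` T)" using T(1) by (intro card_mono) auto
    also have "\<dots> \<le> card T" using T(1) by (rule card_image_le)
    finally have "real (card T) \<ge> \<epsilon> * real (card V) ^ q" using dense unfolding q_def by linarith
    from n0[rule_format, OF V T(2) this] obtain X
      where X: "\<forall>j<q. X j \<subseteq> V \<and> card (X j) = M" "PiE {..<q} X \<subseteq> T"
      by (elim exE conjE) (rule that)
    have "\<forall>A. \<exists>g. A \<in> shadow q E \<longrightarrow> inj_on g {..t} \<and> g ` {..t} \<subseteq> ext E A"
    proof
      fix A
      show "\<exists>g. A \<in> shadow q E \<longrightarrow> inj_on g {..t} \<and> g ` {..t} \<subseteq> ext E A"
      proof (cases "A \<in> shadow q E")
        case True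
        have "card {..t} \<le> card (ext E A)" using full_extensions[OF full Eq True] by simp
        moreover from this have "finite (ext E A)" by (intro card_ge_0_finite) simp
        ultimately have "\<exists>g. inj_on g {..t} \<and> g ` {..t} \<subseteq> ext E A"
          using card_le_inj[of "{..t}" "ext E A"] by auto
        then show ?thesis by auto
      qed simp
    qed
    then obtain nx where "\<forall>A. A \<in> shadow q E \<longrightarrow> inj_on (nx A) {..t} \<and> nx A ` {..t} \<subseteq> ext E A"
      by metis
    then have nx: "\<And>A. A \<in> shadow q E \<Longrightarrow> inj_on (nx A) {..t}"
      "\<And>A i. A \<in> shadow q E \<Longrightarrow> i \<le> t \<Longrightarrow> nx A i \<notin> A \<and> insert (nx A i) A \<in> E"
      unfolding ext_def by auto
    define c where "c i f = (case i of Inl i \<Rightarrow> nx (f ` {..<q}) i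
      | Inr (i, j, h) \<Rightarrow> nx (insert (nx (f ` {..<q}) i) (f ` ({..<q} - {j}))) h)"
      for i :: "nat + nat \<times> nat \<times> nat" and f :: "nat \<Rightarrow> 'a"
    have XM: "\<forall>j<q. card (X j) = M" using X(1) by blast
    from M[THEN spec, THEN spec[of _ c], THEN mp, OF XM] obtain Y where Y: "\<forall>j<q. Y j \<subseteq> X j \<and> card (Y j) = m"
      "\<forall>i\<in>I. \<forall>j<q. indep_coord q Y (c i) j \<or> dep_coord q Y (c i) j"
      by (elim exE conjE) (rule that)
    have GT: "f \<in> T" if "f \<in> PiE {..<q} Y" for f
    proof -
      have "PiE {..<q} Y \<subseteq> PiE {..<q} X" using Y(1) by (intro PiE_mono) auto
      then show ?thesis using that X(2) by blast
    qed
    have sh: "f ` {..<q} \<in> shadow q E" "inj_on f {..<q}" if "f \<in> PiE {..<q} Y" for f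
      using GT[OF that] unfolding T_def by auto
    have c1: "c (Inl i) f = nx (f ` {..<q}) i" for i f by (simp add: c_def)
    have c2: "c (Inr (i, j, h)) f = nx (insert (c (Inl i) f) (f ` ({..<q} - {j}))) h" for i j h f
      by (simp add: c_def)
    \<comment> \<open>Removing the vertex in coordinate \<open>j\<close> from the edge leaves a
      \<open>q\<close>-set of the shadow, which has \<open>t + 1\<close> extensions of its
      own.\<close>
    have sh2: "insert (c (Inl i) f) (f ` ({..<q} - {j})) \<in> shadow q E"
      if f: "f \<in> PiE {..<q} Y" and ij: "i \<le> t" "j < q" for f i j
    proof -
      have e: "insert (c (Inl i) f) (f ` {..<q}) \<in> E" "c (Inl i) f \<notin> f ` {..<q}"
        using nx(2)[OF sh(1)[OF f] ij(1)] unfolding c1 by auto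
      have "inj_on f ({..<q} - {j})" using sh(2)[OF f] by (rule inj_on_subset) auto
      then have "card (f ` ({..<q} - {j})) = q - 1" using ij(2) by (simp add: card_image)
      moreover have "c (Inl i) f \<notin> f ` ({..<q} - {j})" using e(2) by auto
      ultimately have "card (insert (c (Inl i) f) (f ` ({..<q} - {j}))) = q" using ij(2) by simp
      moreover have "insert (c (Inl i) f) (f ` ({..<q} - {j})) \<subseteq> insert (c (Inl i) f) (f ` {..<q})" by auto
      ultimately show ?thesis using e(1) unfolding shadow_def by blast
    qed
    interpret fg: union_grid_ext r k p l ts Q E q B t Y I c Inl "\<lambda>i j h. Inr (i, j, h)"
    proof
      fix e assume "e \<in> E" then show "card e = r" by (rule Er)
    next
      show "r = Suc q" by (rule q)
    next
      fix i assume "i \<le> t" then show "Inl i \<in> I" unfolding I_def colours_def by auto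
    next
      fix j assume "j < q"
      then have "card (Y j) = m" using Y(1) by blast
      then show "B * Suc (card I) < card (Y j)" unfolding m_def by linarith
    next
      fix f i assume f: "f \<in> PiE {..<q} Y" "i \<le> t"
      show "insert (c (Inl i) f) (f ` {..<q}) \<in> E" "c (Inl i) f \<notin> f ` {..<q}"
        using nx(2)[OF sh(1)[OF f(1)] f(2)] unfolding c1 by auto
      fix i' assume "i' \<le> t" "i \<noteq> i'"
      then show "c (Inl i) f \<noteq> c (Inl i') f"
        using nx(1)[OF sh(1)[OF f(1)]] f(2) unfolding c1 inj_on_def by auto
    next
      fix i j h assume "i \<le> t" "j < q" "h \<le> t"
      then show "Inr (i, j, h) \<in> I" unfolding I_def colours_def by auto
    next
      fix f i j h assume f: "f \<in> PiE {..<q} Y" "i \<le> t" "j < q" "h \<le> t"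
      show "insert (c (Inr (i, j, h)) f) (insert (c (Inl i) f) (f ` ({..<q} - {j}))) \<in> E"
        "c (Inr (i, j, h)) f \<notin> insert (c (Inl i) f) (f ` ({..<q} - {j}))"
        using nx(2)[OF sh2[OF f(1-3)] f(4)] unfolding c2[of i j h f] by auto
      fix h' assume "h' \<le> t" "h \<noteq> h'"
      then show "c (Inr (i, j, h)) f \<noteq> c (Inr (i, j, h')) f"
        using nx(1)[OF sh2[OF f(1-3)]] f(4) unfolding c2[of i j h f] c2[of i j h' f] inj_on_def by auto
    qed (use r I Y(2) sh(2) in \<open>auto simp: t_def B_def\<close>)
    show "embeds E F UNIV" by (rule fg.embeds_F_of_grid)
  qed
qed

end

text \<open>A set whose members are deleted leaves the shadow for good and takes at most
  \<open>d\<close> members with it, so every set of the original shadow is charged at most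
  once.\<close>

lemma clean_family:
  assumes "finite V" "\<And>S. S \<in> K \<Longrightarrow> S \<subseteq> V"
  shows "\<exists>K'\<subseteq>K. card (K - K') \<le> d * card (shadow n K) \<and> (\<forall>A\<in>shadow n K'. d < card {S \<in> K'. A \<subseteq> S})"
  using assms
proof (induction "card (shadow n K)" arbitrary: K rule: less_induct)
  case less
  have finK: "finite K" using less.prems finite_subset[of K "Pow V"] by auto
  show ?case
  proof (cases "\<forall>A\<in>shadow n K. d < card {S \<in> K. A \<subseteq> S}")
    case True
    then show ?thesis by (intro exI[of _ K]) auto
  next
    case False
    then obtain A where A: "A \<in> shadow n K" "card {S \<in> K. A \<subseteq> S} \<le> d" by auto
    define K1 where "K1 = {S \<in> K. \<not> A \<subseteq> S}"
    have fs: "finite (shadow n K)" using finite_shadow less.prems by blast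
    have "shadow n K1 \<subseteq> shadow n K - {A}" unfolding shadow_def K1_def by auto
    then have "card (shadow n K1) \<le> card (shadow n K - {A})" using fs by (intro card_mono) auto
    also have "\<dots> = card (shadow n K) - 1" using A(1) fs by simp
    finally have c1: "card (shadow n K1) \<le> card (shadow n K) - 1" .
    have pos: "card (shadow n K) > 0" using A(1) fs card_gt_0_iff by blast
    have lt: "card (shadow n K1) < card (shadow n K)" using c1 pos by linarith
    have "\<And>S. S \<in> K1 \<Longrightarrow> S \<subseteq> V" using less.prems unfolding K1_def by blast
    then obtain K' where K': "K' \<subseteq> K1" "card (K1 - K') \<le> d * card (shadow n K1)"
      "\<forall>A\<in>shadow n K'. d < card {S \<in> K'. A \<subseteq> S}"
      using less.hyps[OF lt less.prems(1)] by blast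
    have "K - K' = {S \<in> K. A \<subseteq> S} \<union> (K1 - K')" using K'(1) unfolding K1_def by auto
    then have "card (K - K') \<le> d + d * card (shadow n K1)"
      using card_Un_le[of "{S \<in> K. A \<subseteq> S}" "K1 - K'"] A(2) K'(2) by simp
    also have "\<dots> = d * Suc (card (shadow n K1))" by simp
    also have "\<dots> \<le> d * card (shadow n K)" using lt by (intro mult_left_mono) auto
    finally show ?thesis using K'(1,3) unfolding K1_def by blast
  qed
qed

text \<open>If the members of \<open>K\<close> containing \<open>A\<close> used at most
  \<open>d\<close> vertices outside \<open>A\<close>, each would be determined by its
  \<open>s - q\<close> vertices there, which gives too few members.\<close>

lemma full_of_degrees:
  assumes V: "finite V" "\<And>S. S \<in> K \<Longrightarrow> S \<subseteq> V \<and> card S = s" and s: "Suc q \<le> s"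
    and deg: "\<And>A. A \<in> shadow q K \<Longrightarrow> d choose (s - q) < card {S \<in> K. A \<subseteq> S}"
  shows "full (d + 1) (shadow (Suc q) K)"
  unfolding full_def
proof (intro ballI)
  fix e x assume e: "e \<in> shadow (Suc q) K" and x: "x \<in> e"
  define A where "A = e - {x}"
  obtain S0 where S0: "S0 \<in> K" "e \<subseteq> S0" "card e = Suc q" using e unfolding shadow_def by blast
  have cA: "card A = q" using S0(3) x unfolding A_def by simp
  have A: "A \<in> shadow q K" using S0 cA unfolding shadow_def A_def by blast
  define R where "R = \<Union> {S \<in> K. A \<subseteq> S} - A"
  have finR: "finite R" using V finite_subset[of R V] unfolding R_def by auto
  have "e \<subseteq> V" using S0(1,2) V(2) by blast
  then have finA: "finite A" using V(1) finite_subset unfolding A_def by blast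
  have sub: "R \<subseteq> ext (shadow (Suc q) K) A"
  proof
    fix y assume "y \<in> R"
    then obtain S where S: "S \<in> K" "A \<subseteq> S" "y \<in> S" "y \<notin> A" unfolding R_def by blast
    have "card (insert y A) = Suc q" using S(4) finA cA by simp
    then show "y \<in> ext (shadow (Suc q) K) A" using S unfolding ext_def shadow_def by auto
  qed
  have "ext (shadow (Suc q) K) A \<subseteq> V" using V(2) unfolding ext_def shadow_def by auto
  then have "card R \<le> card (ext (shadow (Suc q) K) A)"
    using sub V(1) finite_subset by (intro card_mono) auto
  moreover have "d + 1 \<le> card R"
  proof (rule ccontr)
    assume "\<not> d + 1 \<le> card R"
    then have "card R choose (s - q) \<le> d choose (s - q)" by (intro binomial_right_mono) simp
    have "inj_on (\<lambda>S. S - A) {S \<in> K. A \<subseteq> S}" by (auto simp: inj_on_def)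
    moreover have "(\<lambda>S. S - A) ` {S \<in> K. A \<subseteq> S} \<subseteq> {T. T \<subseteq> R \<and> card T = s - q}"
    proof
      fix T assume "T \<in> (\<lambda>S. S - A) ` {S \<in> K. A \<subseteq> S}"
      then obtain S where S: "S \<in> K" "A \<subseteq> S" "T = S - A" by blast
      have "card T = s - q" using S V(2)[OF S(1)] finA cA by (simp add: card_Diff_subset)
      moreover have "T \<subseteq> R" using S unfolding R_def by blast
      ultimately show "T \<in> {T. T \<subseteq> R \<and> card T = s - q}" by blast
    qed
    ultimately have "card {S \<in> K. A \<subseteq> S} \<le> card {T. T \<subseteq> R \<and> card T = s - q}"
      using finR by (intro card_inj_on_le) auto
    also have "\<dots> = card R choose (s - q)" using finR by (rule n_subsets)
    finally show False using deg[OF A] \<open>card R choose (s - q) \<le> d choose (s - q)\<close> by linarith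
  qed
  ultimately show "d + 1 \<le> card (ext (shadow (Suc q) K) (e - {x}))" unfolding A_def by linarith
qed

section \<open>Bounding the number of cliques\<close>

definition cliques :: "nat \<Rightarrow> nat \<Rightarrow> 'a hypergraph \<Rightarrow> 'a set set" where
  "cliques r s G = {S. S \<subseteq> verts G \<and> card S = s \<and> (\<forall>e\<subseteq>S. card e = r \<longrightarrow> e \<in> edges G)}"

text \<open>The first deletion costs the main term. The second one, among the survivors, must delete
  everything, since a nonempty rest would be full enough to contain \<open>F\<close>. So the
  survivors number at most \<open>D\<close> times the size of their shadow, and that shadow is
  sparse.\<close>

lemma (in expanded_union) card_cliques_le:
  assumes "\<epsilon> > (0::real)" and s: "s \<ge> r"
  shows "\<exists>n0. \<forall>G :: 'a hypergraph. r_graph r G \<longrightarrow> card (verts G) \<ge> n0 \<longrightarrow> \<not> embeds (edges G) F UNIV \<longrightarrow>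
    real (card (cliques r s G)) \<le>
      real (t choose (s - r + 1)) * real (card (verts G) choose (r - 1)) + \<epsilon> * real (card (verts G)) ^ (r - 1)"
proof -
  define q where "q = r - 1"
  have q: "r = Suc q" using r unfolding q_def by simp
  have sq: "s - q = s - r + 1" using s q by simp
  define N where "N = (k + p) * (L * r) + 2 * (L * r)"
  define D where "D = N choose (s - q)"
  \<comment> \<open>Chosen so that \<open>D * \<delta> \<le> \<epsilon>\<close>; the added 1 covers
    \<open>D = 0\<close>.\<close>
  define \<delta> where "\<delta> = \<epsilon> / (D + 1)"
  have \<delta>: "\<delta> > 0" unfolding \<delta>_def using assms by (simp add: add_pos_nonneg)
  obtain n0 where n0: "\<forall>(V :: 'a set) E. finite V \<longrightarrow> card V \<ge> n0 \<longrightarrow> (\<forall>e\<in>E. e \<subseteq> V \<and> card e = r) \<longrightarrow>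
    full (t + 1) E \<longrightarrow> real (card (shadow (r - 1) E)) \<ge> \<delta> * real (card V) ^ (r - 1) \<longrightarrow> embeds E F UNIV"
    using embeds_F_of_dense[OF \<delta>] by (elim exE) (rule that)
  show ?thesis
  proof (intro exI[of _ n0] allI impI)
    fix G :: "'a hypergraph"
    assume G: "r_graph r G" "n0 \<le> card (verts G)" and free: "\<not> embeds (edges G) F UNIV"
    define V where "V = verts G"
    have V: "finite V" using G(1) unfolding r_graph_def wf_hypergraph_def V_def by blast
    define K where "K = cliques r s G"
    have K: "S \<subseteq> V" "card S = s" "\<And>e. e \<subseteq> S \<Longrightarrow> card e = r \<Longrightarrow> e \<in> edges G" if "S \<in> K" for S
      using that unfolding K_def cliques_def V_def by auto
    have rsh: "shadow (Suc q) K' \<subseteq> edges G" if "K' \<subseteq> K" for K'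
      using that K(3) q unfolding shadow_def by blast
    have free': "\<not> embeds (shadow (Suc q) K') F UNIV" if "K' \<subseteq> K" for K'
      using free embeds_mono[OF _ rsh[OF that], of F UNIV UNIV] by auto
    define d where "d = t choose (s - q)"
    obtain K' where K': "K' \<subseteq> K" "card (K - K') \<le> d * card (shadow q K)"
      "\<forall>A\<in>shadow q K'. d < card {S \<in> K'. A \<subseteq> S}"
      using clean_family[OF V, of K d q] K(1) by blast
    have finK: "finite K" using K(1) V finite_subset[of K "Pow V"] by auto
    have K'V: "S \<subseteq> V \<and> card S = s" if "S \<in> K'" for S using K(1,2) K'(1) that by blast
    obtain K'' where K'': "K'' \<subseteq> K'" "card (K' - K'') \<le> D * card (shadow q K')"
      "\<forall>A\<in>shadow q K''. D < card {S \<in> K''. A \<subseteq> S}"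
      using clean_family[OF V, of K' D q] K'V by blast
    have "K'' = {}"
    proof (rule ccontr)
      assume "K'' \<noteq> {}"
      then obtain S where S: "S \<in> K''" by blast
      then have "card S = s" using K'V K''(1) by blast
      then obtain e where "e \<subseteq> S" "card e = Suc q" using s q by (metis obtain_subset_with_card_n)
      then have ne: "shadow (Suc q) K'' \<noteq> {}" using S unfolding shadow_def by blast
      have "S \<subseteq> V \<and> card S = s" if "S \<in> K''" for S using K'V K''(1) that by blast
      then have "full (N + 1) (shadow (Suc q) K'')"
        using K''(3) s q unfolding D_def by (intro full_of_degrees[OF V]) auto
      then have "embeds (shadow (Suc q) K'') F UNIV"
        using ne q by (intro embeds_F_of_full[where N = "N + 1"]) (auto simp: N_def shadow_def)
      then show False using free' K''(1) K'(1) by blast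
    qed
    then have cK': "card K' \<le> D * card (shadow q K')" using K''(2) by simp
    have "real (card (shadow q K')) < \<delta> * real (card V) ^ q"
    proof (rule ccontr)
      assume "\<not> ?thesis"
      then have big: "\<delta> * real (card V) ^ q \<le> real (card (shadow q K'))" by simp
      have "full (t + 1) (shadow (Suc q) K')"
        using K'(3) K'V s q unfolding d_def by (intro full_of_degrees[OF V]) auto
      \<comment> \<open>As \<open>s > q\<close>, a set of the shadow can be enlarged inside its
        clique to an edge.\<close>
      moreover have "shadow q K' \<subseteq> shadow q (shadow (Suc q) K')"
      proof
        fix A assume A: "A \<in> shadow q K'"
        then obtain S where S: "S \<in> K'" "A \<subseteq> S" "card A = q" unfolding shadow_def by blast
        have SV: "S \<subseteq> V" "card S = s" using K'V[OF S(1)] by auto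
        then have fS: "finite S" using V finite_subset by blast
        then have "A \<noteq> S" using S(3) SV(2) s q by auto
        then obtain x where x: "x \<in> S" "x \<notin> A" using S(2) by blast
        have "card (insert x A) = Suc q" using x S finite_subset[OF S(2) fS] by simp
        then have "insert x A \<in> shadow (Suc q) K'" using x S unfolding shadow_def by blast
        then show "A \<in> shadow q (shadow (Suc q) K')" using S(3) unfolding shadow_def by blast
      qed
      moreover have E': "\<forall>e\<in>shadow (Suc q) K'. e \<subseteq> V \<and> card e = r"
        using K'V q unfolding shadow_def by blast
      moreover have "finite (shadow q (shadow (Suc q) K'))"
        using finite_shadow[OF V] E' by blast
      ultimately have "card (shadow q K') \<le> card (shadow q (shadow (Suc q) K'))" by (intro card_mono) auto
      then have "\<delta> * real (card V) ^ (r - 1) \<le> real (card (shadow (r - 1) (shadow (Suc q) K')))"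
        using big unfolding q_def by linarith
      then have "embeds (shadow (Suc q) K') F UNIV"
        using n0[rule_format, OF V _ _ \<open>full (t + 1) (shadow (Suc q) K')\<close>] G(2) E' unfolding V_def by blast
      then show False using free' K'(1) by blast
    qed
    then have "real D * real (card (shadow q K')) \<le> real D * (\<delta> * real (card V) ^ q)"
      by (intro mult_left_mono) auto
    moreover have "real D * \<delta> \<le> \<epsilon>"
      unfolding \<delta>_def using assms(1) by (simp add: field_simps)
    then have "real D * \<delta> * real (card V) ^ q \<le> \<epsilon> * real (card V) ^ q" by (intro mult_right_mono) auto
    moreover have "real (card K') \<le> real D * real (card (shadow q K'))" using cK' by (metis of_nat_le_iff of_nat_mult)
    ultimately have 1: "real (card K') \<le> \<epsilon> * real (card V) ^ q" by (simp add: mult.assoc)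
    have "shadow q K \<subseteq> {A. A \<subseteq> V \<and> card A = q}" using K(1) unfolding shadow_def by blast
    then have "card (shadow q K) \<le> card {A. A \<subseteq> V \<and> card A = q}" using V by (intro card_mono) auto
    also have "\<dots> = card V choose q" using V by (rule n_subsets)
    finally have "card (K - K') \<le> d * (card V choose q)" using K'(2) by (meson le_trans mult_le_mono2)
    moreover have "card K = card (K - K') + card K'" using K'(1) finK
      by (metis card_Diff_subset card_mono finite_subset le_add_diff_inverse2)
    ultimately have "real (card K) \<le> real d * real (card V choose q) + real (card K')"
      by (metis of_nat_add of_nat_le_iff of_nat_mult add_le_cancel_right)
    then show "real (card (cliques r s G)) \<le>
      real (t choose (s - r + 1)) * real (card (verts G) choose (r - 1)) + \<epsilon> * real (card (verts G)) ^ (r - 1)"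
      using 1 unfolding K_def[symmetric] V_def[symmetric] d_def sq[symmetric] q_def[symmetric] by linarith
  qed
qed


section \<open>Copies, cliques and well-formedness\<close>

lemma Hypergraph_eq_iff: "G = H \<longleftrightarrow> verts G = verts H \<and> edges G = edges H"
  by (cases G; cases H) simp

text \<open>A copy of a complete \<open>r\<close>-graph is determined by its vertex set, because a
  bijection maps \<open>r\<close>-subsets onto \<open>r\<close>-subsets.\<close>

lemma num_copies_complete:
  assumes "r_graph r G"
  shows "num_copies (complete_r_graph r s) G = card (cliques r s G)"
proof -
  define K where "K S = Hypergraph S (nsets S r)" for S :: "'a set"
  have V: "finite (verts G)" using assms unfolding r_graph_def wf_hypergraph_def by blast
  have C: "complete_r_graph r s = Hypergraph {..<s} (nsets {..<s} r)"
    unfolding complete_r_graph_def nsets_def by (auto intro: finite_subset)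
  have "copies (complete_r_graph r s) G = K ` cliques r s G"
  proof (intro equalityI subsetI)
    fix H' assume "H' \<in> copies (complete_r_graph r s) G"
    then obtain f where H': "sub_hypergraph H' G" and f: "bij_betw f {..<s} (verts H')"
      "(\<lambda>e. f ` e) ` nsets {..<s} r = edges H'"
      unfolding copies_def hypergraph_iso_def C by auto
    have e: "edges H' = nsets (verts H') r"
      using bij_betw_nsets[OF f(1), of r] f(2) unfolding bij_betw_def by simp
    have sub: "verts H' \<subseteq> verts G" "edges H' \<subseteq> edges G" using H' unfolding sub_hypergraph_def by auto
    have "card (verts H') = s" using f(1) bij_betw_same_card by fastforce
    moreover have "finite (verts H')" using sub(1) V finite_subset by blast
    then have "\<forall>e\<subseteq>verts H'. card e = r \<longrightarrow> e \<in> edges G"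
      using sub(2) e unfolding nsets_def by (auto intro: finite_subset)
    ultimately have "verts H' \<in> cliques r s G" using sub(1) unfolding cliques_def by blast
    moreover have "H' = K (verts H')" unfolding K_def Hypergraph_eq_iff using e by simp
    ultimately show "H' \<in> K ` cliques r s G" by (rule rev_image_eqI)
  next
    fix H' assume "H' \<in> K ` cliques r s G"
    then obtain S where S: "H' = K S" "S \<subseteq> verts G" "card S = s" "\<forall>e\<subseteq>S. card e = r \<longrightarrow> e \<in> edges G"
      unfolding cliques_def by blast
    have fS: "finite S" using S(2) V finite_subset by blast
    then obtain f where f: "bij_betw f {..<s} S" using finite_same_card_bij[of "{..<s}" S] S(3) by auto
    then have "hypergraph_iso (complete_r_graph r s) H'"
      unfolding hypergraph_iso_def C S(1) K_def using bij_betw_nsets[OF f, of r]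
      by (intro exI[of _ f]) (auto simp: bij_betw_def)
    moreover have "sub_hypergraph H' G"
      unfolding sub_hypergraph_def wf_hypergraph_def S(1) K_def using fS S(2,4) by (auto simp: nsets_def)
    ultimately show "H' \<in> copies (complete_r_graph r s) G" unfolding copies_def by blast
  qed
  moreover have "inj_on K (cliques r s G)" unfolding K_def inj_on_def by auto
  ultimately show ?thesis unfolding num_copies_def by (simp add: card_image)
qed

lemma wf_disjoint_union: "wf_hypergraph G \<Longrightarrow> wf_hypergraph H \<Longrightarrow> wf_hypergraph (disjoint_union G H)"
  unfolding wf_hypergraph_def disjoint_union_def by (auto simp: subset_iff)

lemma wf_disjoint_Union:
  "finite I \<Longrightarrow> (\<And>i. i \<in> I \<Longrightarrow> wf_hypergraph (H i)) \<Longrightarrow> wf_hypergraph (disjoint_Union I H)"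
  unfolding wf_hypergraph_def disjoint_Union_def by auto

lemma wf_expansion: "wf_hypergraph H \<Longrightarrow> wf_hypergraph (expansion r H)"
  unfolding wf_hypergraph_def expansion_def using finite_subset[of "edges H" "Pow (verts H)"] by auto

lemma wf_path: "wf_hypergraph (path_graph l)"
  unfolding wf_hypergraph_def path_graph_def by auto

lemma wf_cycle: "wf_hypergraph (cycle_graph l)"
  unfolding wf_hypergraph_def cycle_graph_def by auto

lemma wf_star: "wf_hypergraph (star_graph l)"
  unfolding wf_hypergraph_def star_graph_def by auto

section \<open>The lower bound\<close>

text \<open>Without isolated vertices every image vertex lies in a host edge. This is what allows
  the upper bound to embed into \<open>UNIV\<close> instead of \<open>verts G\<close>.\<close>

definition no_isolated :: "'a hypergraph \<Rightarrow> bool" where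
  "no_isolated H \<longleftrightarrow> verts H \<subseteq> \<Union> (edges H)"

lemma embeds_no_isolated:
  assumes "no_isolated H" "embeds E H UNIV" "\<And>e. e \<in> E \<Longrightarrow> e \<subseteq> V"
  shows "embeds E H V"
proof -
  obtain f where f: "inj_on f (verts H)" "\<forall>e\<in>edges H. f ` e \<in> E" using assms(2) unfolding embeds_def by auto
  have "f x \<in> V" if x: "x \<in> verts H" for x
  proof -
    obtain e where "e \<in> edges H" "x \<in> e" using assms(1) x unfolding no_isolated_def by auto
    then show ?thesis using f(2) assms(3)[of "f ` e"] by auto
  qed
  then show ?thesis unfolding embeds_def using f by (intro exI[of _ f]) auto
qed

lemma no_isolatedI: "(\<And>x. x \<in> verts H \<Longrightarrow> \<exists>e\<in>edges H. x \<in> e) \<Longrightarrow> no_isolated H"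
  unfolding no_isolated_def by auto

lemma no_isolatedD: "no_isolated H \<Longrightarrow> x \<in> verts H \<Longrightarrow> \<exists>e\<in>edges H. x \<in> e"
  unfolding no_isolated_def by auto

lemma no_isolated_disjoint_union:
  assumes "no_isolated G" "no_isolated H"
  shows "no_isolated (disjoint_union G H)"
proof (rule no_isolatedI)
  fix x assume "x \<in> verts (disjoint_union G H)"
  then consider y where "x = Inl y" "y \<in> verts G" | y where "x = Inr y" "y \<in> verts H"
    by (auto simp: disjoint_union_def)
  then show "\<exists>e\<in>edges (disjoint_union G H). x \<in> e"
  proof cases
    case 1
    then obtain e where "e \<in> edges G" "y \<in> e" using no_isolatedD[OF assms(1)] by auto
    then show ?thesis using 1 by (intro bexI[of _ "Inl ` e"]) (auto simp: disjoint_union_def)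
  next
    case 2
    then obtain e where "e \<in> edges H" "y \<in> e" using no_isolatedD[OF assms(2)] by auto
    then show ?thesis using 2 by (intro bexI[of _ "Inr ` e"]) (auto simp: disjoint_union_def)
  qed
qed

lemma no_isolated_disjoint_Union:
  assumes "\<And>i. i \<in> I \<Longrightarrow> no_isolated (H i)"
  shows "no_isolated (disjoint_Union I H)"
proof (rule no_isolatedI)
  fix x assume "x \<in> verts (disjoint_Union I H)"
  then obtain i y where x: "x = (i, y)" "i \<in> I" "y \<in> verts (H i)" by (auto simp: disjoint_Union_def)
  obtain e where "e \<in> edges (H i)" "y \<in> e" using no_isolatedD[OF assms[OF x(2)] x(3)] by auto
  then show "\<exists>e\<in>edges (disjoint_Union I H). x \<in> e"
    using x by (intro bexI[of _ "Pair i ` e"]) (auto simp: disjoint_Union_def)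
qed

lemma no_isolated_expansion:
  assumes "no_isolated H"
  shows "no_isolated (expansion r H)"
proof (rule no_isolatedI)
  fix x assume "x \<in> verts (expansion r H)"
  then consider y where "x = Inl y" "y \<in> verts H" | e j where "x = Inr (e, j)" "e \<in> edges H" "j < r - 2"
    by (auto simp: expansion_def)
  then show "\<exists>e\<in>edges (expansion r H). x \<in> e"
  proof cases
    case 1
    then obtain e where "e \<in> edges H" "y \<in> e" using no_isolatedD[OF assms] by auto
    then show ?thesis using 1
      by (intro bexI[of _ "Inl ` e \<union> Inr ` ({e} \<times> {..<r - 2})"]) (auto simp: expansion_def)
  next
    case 2
    then show ?thesis
      by (intro bexI[of _ "Inl ` e \<union> Inr ` ({e} \<times> {..<r - 2})"]) (auto simp: expansion_def)
  qed
qed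

lemma no_isolated_path:
  assumes "l \<ge> 1" shows "no_isolated (path_graph l)"
proof -
  have "i \<in> \<Union> ((\<lambda>i. {i, Suc i}) ` {..<l})" if "i \<le> l" for i
  proof (cases "i < l")
    case False
    then have "i \<in> {i - 1, Suc (i - 1)}" "i - 1 < l" using that assms by auto
    then show ?thesis by blast
  qed auto
  then show ?thesis unfolding no_isolated_def path_graph_def by auto
qed

lemma no_isolated_cycle: "no_isolated (cycle_graph l)"
  unfolding no_isolated_def cycle_graph_def by auto

lemma no_isolated_star:
  assumes "l \<ge> 1" shows "no_isolated (star_graph l)"
proof -
  have "\<exists>e\<in>edges (star_graph l). i \<in> e" if "i \<le> l" for i
    using that assms by (intro bexI[of _ "{0, if i = 0 then 1 else i}"]) (auto simp: star_graph_def)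
  then show ?thesis by (intro no_isolatedI) (auto simp: star_graph_def)
qed

text \<open>A lower bound on the covering number, stated without a minimum so that it simply adds up
  over disjoint unions.\<close>

definition cover_ge :: "'a hypergraph \<Rightarrow> nat \<Rightarrow> bool" where
  "cover_ge H n \<longleftrightarrow> (\<forall>T. finite T \<longrightarrow> (\<forall>e\<in>edges H. e \<inter> T \<noteq> {}) \<longrightarrow> n \<le> card T)"

lemma cover_ge_disjoint_union:
  assumes "cover_ge G a" "cover_ge H b"
  shows "cover_ge (disjoint_union G H) (a + b)"
  unfolding cover_ge_def
proof (intro allI impI)
  fix T assume T: "finite T" "\<forall>e\<in>edges (disjoint_union G H). e \<inter> T \<noteq> {}"
  define A where "A = Inl -` T"
  define D where "D = Inr -` T"
  have AD: "finite A" "finite D" unfolding A_def D_def using T(1) by (auto intro: finite_vimageI)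
  have sub: "Inl ` A \<union> Inr ` D \<subseteq> T" unfolding A_def D_def by auto
  have "e \<inter> A \<noteq> {}" if "e \<in> edges G" for e
  proof -
    have "Inl ` e \<in> edges (disjoint_union G H)" using that unfolding disjoint_union_def by auto
    then have "Inl ` e \<inter> T \<noteq> {}" using T(2) by blast
    then obtain x where "x \<in> e" "Inl x \<in> T" by auto
    then show ?thesis by (auto simp: A_def)
  qed
  moreover have "e \<inter> D \<noteq> {}" if "e \<in> edges H" for e
  proof -
    have "Inr ` e \<in> edges (disjoint_union G H)" using that unfolding disjoint_union_def by auto
    then have "Inr ` e \<inter> T \<noteq> {}" using T(2) by blast
    then obtain x where "x \<in> e" "Inr x \<in> T" by auto
    then show ?thesis by (auto simp: D_def)
  qed
  ultimately have "a + b \<le> card A + card D" using assms AD unfolding cover_ge_def by (intro add_mono) auto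
  also have "\<dots> = card (Inl ` A \<union> Inr ` D)"
    using AD by (subst card_Un_disjoint) (auto simp: card_image)
  also have "\<dots> \<le> card T" using sub T(1) by (intro card_mono)
  finally show "a + b \<le> card T" .
qed

lemma cover_ge_disjoint_Union:
  assumes "finite I" "\<And>i. i \<in> I \<Longrightarrow> cover_ge (H i) (n i)"
  shows "cover_ge (disjoint_Union I H) (\<Sum>i\<in>I. n i)"
  unfolding cover_ge_def
proof (intro allI impI)
  fix T assume T: "finite T" "\<forall>e\<in>edges (disjoint_Union I H). e \<inter> T \<noteq> {}"
  define A where "A i = Pair i -` T" for i
  have A: "finite (A i)" for i unfolding A_def using T(1) by (auto intro: finite_vimageI simp: inj_on_def)
  have "n i \<le> card (A i)" if i: "i \<in> I" for i
  proof -
    have "e \<inter> A i \<noteq> {}" if "e \<in> edges (H i)" for e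
    proof -
      have "Pair i ` e \<in> edges (disjoint_Union I H)" using that i unfolding disjoint_Union_def by auto
      then have "Pair i ` e \<inter> T \<noteq> {}" using T(2) by blast
      then obtain x where "x \<in> e" "(i, x) \<in> T" by auto
      then show ?thesis by (auto simp: A_def)
    qed
    then show ?thesis using assms(2)[OF i] A unfolding cover_ge_def by auto
  qed
  then have "(\<Sum>i\<in>I. n i) \<le> (\<Sum>i\<in>I. card (A i))" by (rule sum_mono)
  also have "\<dots> = card (SIGMA i:I. A i)" using assms(1) A by simp
  also have "\<dots> \<le> card T" using T(1) by (intro card_mono) (auto simp: A_def)
  finally show "(\<Sum>i\<in>I. n i) \<le> card T" .
qed

lemma cover_ge_1: "edges H \<noteq> {} \<Longrightarrow> cover_ge H 1"
  unfolding cover_ge_def by (auto simp: Suc_le_eq card_gt_0_iff)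

text \<open>An original vertex meets at most two edges by assumption and a new vertex only one, so
  \<open>T\<close> covers at most \<open>2 * card T\<close> edges.\<close>

lemma cover_ge_expansion:
  assumes ed: "edges H = \<epsilon> ` I" "inj_on \<epsilon> I" "finite I" and deg: "\<And>x. card {i \<in> I. x \<in> \<epsilon> i} \<le> 2"
  shows "cover_ge (expansion r H) ((card I + 1) div 2)"
  unfolding cover_ge_def
proof (intro allI impI)
  fix T assume T: "finite T" "\<forall>e\<in>edges (expansion r H). e \<inter> T \<noteq> {}"
  define \<eta> where "\<eta> i = Inl ` \<epsilon> i \<union> Inr ` ({\<epsilon> i} \<times> {..<r - 2})" for i
  have "\<eta> i \<inter> T \<noteq> {}" if "i \<in> I" for i
    using T(2) that unfolding expansion_def ed \<eta>_def by auto
  then have "I \<subseteq> (\<Union>x\<in>T. {i \<in> I. x \<in> \<eta> i})" by blast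
  then have "card I \<le> card (\<Union>x\<in>T. {i \<in> I. x \<in> \<eta> i})" using T(1) ed(3) by (intro card_mono) auto
  also have "\<dots> \<le> (\<Sum>x\<in>T. card {i \<in> I. x \<in> \<eta> i})" using T(1) by (rule card_UN_le)
  also have "\<dots> \<le> (\<Sum>x\<in>T. 2)"
  proof (rule sum_mono)
    fix x
    show "card {i \<in> I. x \<in> \<eta> i} \<le> 2"
    proof (cases x)
      case (Inl y)
      then have "{i \<in> I. x \<in> \<eta> i} = {i \<in> I. y \<in> \<epsilon> i}" unfolding \<eta>_def by auto
      then show ?thesis using deg by simp
    next
      case (Inr z)
      have "i = i'" if "i \<in> {i \<in> I. x \<in> \<eta> i}" "i' \<in> {i \<in> I. x \<in> \<eta> i}" for i i'
      proof -
        have z: "fst z = \<epsilon> j" if "x \<in> \<eta> j" for j using that Inr by (auto simp: \<eta>_def)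
        have "\<epsilon> i = \<epsilon> i'" using z[of i] z[of i'] that by simp
        then show ?thesis using ed(2) that unfolding inj_on_def by simp
      qed
      then have "card {i \<in> I. x \<in> \<eta> i} \<le> 1" using ed(3) by (subst card_le_Suc0_iff_eq[unfolded One_nat_def[symmetric]]) auto
      then show ?thesis by simp
    qed
  qed
  finally show "(card I + 1) div 2 \<le> card T" by simp
qed

lemma cover_ge_path: "cover_ge (expansion r (path_graph l)) ((l + 1) div 2)"
proof -
  have "card {i \<in> {..<l}. x \<in> {i, Suc i}} \<le> 2" for x
  proof -
    have "{i \<in> {..<l}. x \<in> {i, Suc i}} \<subseteq> {x, x - 1}" by auto
    then have "card {i \<in> {..<l}. x \<in> {i, Suc i}} \<le> card {x, x - 1}" by (intro card_mono) auto
    also have "\<dots> \<le> 2" by (simp add: card_insert_if)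
    finally show ?thesis .
  qed
  then have "cover_ge (expansion r (path_graph l)) ((card {..<l} + 1) div 2)"
    by (intro cover_ge_expansion[where \<epsilon> = "\<lambda>i. {i, Suc i}"]) (auto simp: path_graph_def path_edges_inj)
  then show ?thesis by simp
qed

lemma cover_ge_cycle:
  assumes "l \<ge> 3" shows "cover_ge (expansion r (cycle_graph l)) ((l + 1) div 2)"
proof -
  have "card {i \<in> {..<l}. x \<in> {i, Suc i mod l}} \<le> 2" for x
  proof -
    have "{i \<in> {..<l}. x \<in> {i, Suc i mod l}} \<subseteq> {x, if x = 0 then l - 1 else x - 1}"
      by (auto simp: mod_Suc)
    then have "card {i \<in> {..<l}. x \<in> {i, Suc i mod l}} \<le> card {x, if x = 0 then l - 1 else x - 1}"
      by (intro card_mono) auto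
    also have "\<dots> \<le> 2" by (simp add: card_insert_if)
    finally show ?thesis .
  qed
  then have "cover_ge (expansion r (cycle_graph l)) ((card {..<l} + 1) div 2)"
    using cycle_edges_inj[OF assms]
    by (intro cover_ge_expansion[where \<epsilon> = "\<lambda>i. {i, Suc i mod l}"]) (auto simp: cycle_graph_def)
  then show ?thesis by simp
qed

context expanded_union
begin

lemma wf_F: "wf_hypergraph F"
proof -
  have "wf_hypergraph (Q i)" if "i \<in> {1..k}" for i
    using Q_cases[OF that] wf_expansion[OF wf_path] wf_expansion[OF wf_cycle] by auto
  then show ?thesis unfolding F_def
    by (intro wf_disjoint_union wf_disjoint_Union wf_expansion wf_star) auto
qed

lemma cover_ge_F:
  assumes "\<And>i. i \<in> {1..p} \<Longrightarrow> ts i \<ge> 1"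
  shows "cover_ge F (t + 1)"
proof -
  have "cover_ge (Q i) ((l i + 1) div 2)" if "i \<in> {1..k}" for i
    using Q_cases[OF that] cover_ge_path cover_ge_cycle l[OF that] by auto
  moreover have "cover_ge (expansion r (star_graph (ts i))) 1" if "i \<in> {1..p}" for i
    using assms[OF that] by (intro cover_ge_1) (auto simp: expansion_def star_graph_def)
  ultimately have "cover_ge F ((\<Sum>i=1..k. (l i + 1) div 2) + (\<Sum>i=1..p. 1))"
    unfolding F_def by (intro cover_ge_disjoint_union cover_ge_disjoint_Union) auto
  \<comment> \<open>Guards the truncated subtraction in \<open>t\<close>.\<close>
  moreover have "(\<Sum>i=1..k. (l i + 1) div 2) \<ge> 1"
    using member_le_sum[of 1 "{1..k}" "\<lambda>i. (l i + 1) div 2"] k l[of 1] by auto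
  ultimately show ?thesis unfolding t_def by simp
qed

lemma no_isolated_F:
  assumes "\<And>i. i \<in> {1..p} \<Longrightarrow> ts i \<ge> 1"
  shows "no_isolated F"
proof -
  have "no_isolated (Q i)" if "i \<in> {1..k}" for i
    using Q_cases[OF that] no_isolated_expansion[OF no_isolated_path] no_isolated_expansion[OF no_isolated_cycle]
      l[OF that] by auto
  then show ?thesis unfolding F_def using assms
    by (intro no_isolated_disjoint_union no_isolated_disjoint_Union no_isolated_expansion no_isolated_star) auto
qed

text \<open>All edges of the host meet \<open>{..<t}\<close>, so the preimage of this set under an
  embedding would be a cover of \<open>F\<close> with at most \<open>t\<close> vertices.\<close>

lemma S_graph_free:
  assumes "\<And>i. i \<in> {1..p} \<Longrightarrow> ts i \<ge> 1"
  shows "copies F (S_graph r n t) = {}"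
proof (rule ccontr)
  assume "copies F (S_graph r n t) \<noteq> {}"
  then have "embeds (edges (S_graph r n t)) F (verts (S_graph r n t))"
    using copies_nonempty_iff[OF wf_F] by blast
  then obtain f where f: "inj_on f (verts F)" "\<forall>e\<in>edges F. f ` e \<in> edges (S_graph r n t)"
    unfolding embeds_def by auto
  define T where "T = {x \<in> verts F. f x < t}"
  have wf: "finite (verts F)" "\<And>e. e \<in> edges F \<Longrightarrow> e \<subseteq> verts F"
    using wf_F unfolding wf_hypergraph_def by auto
  have "e \<inter> T \<noteq> {}" if "e \<in> edges F" for e
  proof -
    have "f ` e \<inter> {..<t} \<noteq> {}" using f(2) that unfolding S_graph_def by auto
    then show ?thesis using wf(2)[OF that] unfolding T_def by auto
  qed
  moreover have "finite T" unfolding T_def using wf(1) by simp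
  ultimately have "t + 1 \<le> card T" using cover_ge_F[OF assms] unfolding cover_ge_def by auto
  moreover have "card T \<le> card {..<t}"
    using f(1) by (intro card_inj_on_le[of f]) (auto simp: T_def inj_on_def)
  ultimately show False by simp
qed

end

section \<open>Cliques of the construction and asymptotics\<close>

lemma r_graph_S_graph: "r_graph r (S_graph r n t)"
  unfolding r_graph_def wf_hypergraph_def S_graph_def by auto

text \<open>A set with only \<open>r - 1\<close> vertices outside \<open>{..<t}\<close> is a clique,
  since each of its \<open>r\<close>-subsets meets \<open>{..<t}\<close>.\<close>

lemma card_cliques_S_graph:
  assumes "t \<le> n" "r \<le> s" "r \<ge> 1"
  shows "(t choose (s - r + 1)) * ((n - t) choose (r - 1)) \<le> card (cliques r s (S_graph r n t))"
proof -
  define P where "P = {A. A \<subseteq> {..<t} \<and> card A = s - r + 1} \<times> {A. A \<subseteq> {t..<n} \<and> card A = r - 1}"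
  have "card P = (t choose (s - r + 1)) * ((n - t) choose (r - 1))"
    unfolding P_def card_cartesian_product by (simp add: n_subsets)
  moreover have "inj_on (\<lambda>(A, D). A \<union> D) P"
  proof (rule inj_onI, clarify)
    fix A D A' D' assume "(A, D) \<in> P" "(A', D') \<in> P" and eq: "A \<union> D = A' \<union> D'"
    then have s: "A \<subseteq> {..<t}" "D \<subseteq> {t..<n}" "A' \<subseteq> {..<t}" "D' \<subseteq> {t..<n}" unfolding P_def by auto
    have "A = (A \<union> D) \<inter> {..<t}" "D = (A \<union> D) \<inter> {t..<n}" using s by fastforce+
    moreover have "A' = (A' \<union> D') \<inter> {..<t}" "D' = (A' \<union> D') \<inter> {t..<n}" using s by fastforce+
    ultimately show "A = A' \<and> D = D'" using eq by metis
  qed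
  moreover have "(\<lambda>(A, D). A \<union> D) ` P \<subseteq> cliques r s (S_graph r n t)"
  proof clarify
    fix A D assume "(A, D) \<in> P"
    then have s: "A \<subseteq> {..<t}" "D \<subseteq> {t..<n}" "card A = s - r + 1" "card D = r - 1" unfolding P_def by auto
    then have fin: "finite A" "finite D" using finite_subset by blast+
    have dis: "A \<inter> D = {}" using s by fastforce
    have "A \<union> D \<subseteq> {..<n}" using s(1,2) assms(1) by fastforce
    moreover have "card (A \<union> D) = s" using card_Un_disjoint[OF fin dis] s(3,4) assms by simp
    moreover have "e \<in> edges (S_graph r n t)" if e: "e \<subseteq> A \<union> D" "card e = r" for e
    proof -
      have "\<not> e \<subseteq> D" using card_mono[OF fin(2), of e] e(2) s(4) assms(3) by auto
      then have "e \<inter> {..<t} \<noteq> {}" using e(1) s(1) by blast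
      then show ?thesis using e \<open>A \<union> D \<subseteq> {..<n}\<close> unfolding S_graph_def by auto
    qed
    ultimately show "A \<union> D \<in> cliques r s (S_graph r n t)" unfolding cliques_def by (auto simp: S_graph_def)
  qed
  moreover have "finite (cliques r s (S_graph r n t))"
    by (rule finite_subset[of _ "Pow {..<n}"]) (auto simp: cliques_def S_graph_def)
  ultimately show ?thesis using card_inj_on_le by metis
qed

lemma card_cliques_le_choose:
  assumes "finite (verts G)" shows "card (cliques r s G) \<le> card (verts G) choose s"
proof -
  have "card (cliques r s G) \<le> card {S. S \<subseteq> verts G \<and> card S = s}"
    using assms by (intro card_mono) (auto simp: cliques_def)
  then show ?thesis using n_subsets[OF assms] by simp
qed

lemma choose_tendsto:
  "(\<lambda>n. real ((n - t) choose q) / real n ^ q) \<longlonglongrightarrow> 1 / fact q"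
proof -
  have "(\<lambda>n. (\<Prod>i=0..<q. 1 - (real t + real i) / real n) / fact q) \<longlonglongrightarrow> (\<Prod>i=0..<q. 1 - 0) / fact q"
    by (intro tendsto_divide tendsto_prod tendsto_diff tendsto_const lim_const_over_n) auto
  moreover have "\<forall>\<^sub>F n in sequentially.
    (\<Prod>i=0..<q. 1 - (real t + real i) / real n) / fact q = real ((n - t) choose q) / real n ^ q"
    using eventually_gt_at_top[of "max t 0"]
  proof eventually_elim
    case (elim n)
    then have n: "n > 0" "t \<le> n" by auto
    have "real ((n - t) choose q) = (\<Prod>i=0..<q. real (n - t) - real i) / fact q"
      unfolding binomial_gbinomial gbinomial_prod_rev by simp
    also have "(\<Prod>i=0..<q. real (n - t) - real i) = (\<Prod>i=0..<q. real n * (1 - (real t + real i) / real n))"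
      using n by (intro prod.cong) (auto simp: field_simps of_nat_diff)
    also have "\<dots> = real n ^ q * (\<Prod>i=0..<q. 1 - (real t + real i) / real n)" by (simp add: prod.distrib)
    finally show ?case using n(1) by simp
  qed
  ultimately show ?thesis by (auto dest: tendsto_cong[THEN iffD1, rotated])
qed

text \<open>Both binomial coefficients have the leading term \<open>n ^ q / fact q\<close>, so the
  bounds pinch \<open>X\<close>. The shift by \<open>t\<close> only changes lower-order
  terms.\<close>

lemma smallo_of_bounds:
  fixes X :: "nat \<Rightarrow> real"
  assumes lower: "\<And>n. n \<ge> t \<Longrightarrow> c * real ((n - t) choose q) \<le> X n"
    and upper: "\<And>\<epsilon>. \<epsilon> > 0 \<Longrightarrow> \<forall>\<^sub>F n in at_top. X n \<le> c * real (n choose q) + \<epsilon> * real n ^ q"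
    and c: "c \<ge> 0"
  shows "(\<lambda>n. X n - c * (real n ^ q / fact q)) \<in> o[at_top](\<lambda>n. real n ^ q)"
proof (rule landau_o.smallI)
  fix \<epsilon> :: real assume \<epsilon>: "\<epsilon> > 0"
  \<comment> \<open>The added 1 covers \<open>c = 0\<close>, the case that occurs for large
    \<open>s\<close>.\<close>
  define \<delta> where "\<delta> = \<epsilon> / (c + 1)"
  have \<delta>: "\<delta> > 0" "c * \<delta> \<le> \<epsilon>" unfolding \<delta>_def using \<epsilon> c by (auto simp: field_simps)
  have "\<forall>\<^sub>F n in at_top. dist (real ((n - t) choose q) / real n ^ q) (1 / fact q) < \<delta>"
    using choose_tendsto[of t q] \<delta>(1) by (rule tendstoD)
  then show "\<forall>\<^sub>F n in at_top. norm (X n - c * (real n ^ q / fact q)) \<le> \<epsilon> * norm (real n ^ q)"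
    using upper[OF \<epsilon>] eventually_ge_at_top[of t] eventually_gt_at_top[of 0]
  proof eventually_elim
    case (elim n)
    have pos: "real n ^ q > 0" using elim(4) by simp
    have "real (n choose q) \<le> real n ^ q / fact q"
    proof -
      have "real ((n choose q) * fact q) \<le> real (n ^ q)" using binomial_fact_pow[of n q] of_nat_le_iff by blast
      then show ?thesis by (simp add: field_simps)
    qed
    then have "c * real (n choose q) \<le> c * (real n ^ q / fact q)" using c by (rule mult_left_mono)
    then have up: "X n - c * (real n ^ q / fact q) \<le> \<epsilon> * real n ^ q" using elim(2) by linarith
    have "real ((n - t) choose q) / real n ^ q \<ge> 1 / fact q - \<delta>" using elim(1) unfolding dist_real_def by linarith
    then have "real ((n - t) choose q) \<ge> (1 / fact q - \<delta>) * real n ^ q" using pos by (simp add: pos_le_divide_eq)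
    then have "c * real ((n - t) choose q) \<ge> c * ((1 / fact q - \<delta>) * real n ^ q)" using c by (rule mult_left_mono)
    moreover have "c * ((1 / fact q - \<delta>) * real n ^ q) = c * (real n ^ q / fact q) - c * \<delta> * real n ^ q"
      by (simp add: algebra_simps)
    moreover have "c * \<delta> * real n ^ q \<le> \<epsilon> * real n ^ q" using \<delta>(2) pos by (intro mult_right_mono) auto
    ultimately have "X n - c * (real n ^ q / fact q) \<ge> - (\<epsilon> * real n ^ q)" using lower[OF elim(3)] by linarith
    then show ?case using up by (simp add: abs_le_iff)
  qed
qed

theorem theorem2p10:
  fixes r k p s t :: nat
    and l ts :: "nat \<Rightarrow> nat"
    and Q :: "nat \<Rightarrow> (nat + nat set \<times> nat) hypergraph"
    and F :: "(nat \<times> (nat + nat set \<times> nat) + nat \<times> (nat + nat set \<times> nat)) hypergraph"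
  assumes "r \<ge> 3" and "k \<ge> 1" and "p \<ge> 0"
    and "\<forall>i\<in>{1..k}. l i \<ge> 5"
    and "\<forall>i\<in>{1..p}. ts i \<ge> 2"
    and "s \<ge> r"
    and "t = (\<Sum>i=1..k. (l i + 1) div 2) + p - 1"
    and "(\<forall>i\<in>{1..k}. Q i = expansion r (path_graph (l i))) \<or>
         (\<forall>i\<in>{1..k}. Q i = expansion r (cycle_graph (l i)))"
    and "F = disjoint_union (disjoint_Union {1..k} Q)
               (disjoint_Union {1..p} (\<lambda>i. expansion r (star_graph (ts i))))"
  shows "(s \<le> t + r - 1 \<longrightarrow>
            (\<lambda>n. real (gen_turan r n (complete_r_graph r s) F))
              \<sim>[at_top] (\<lambda>n. real (num_copies (complete_r_graph r s) (S_graph r n t))) \<and>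
            (\<lambda>n. real (num_copies (complete_r_graph r s) (S_graph r n t))
                 - real (t choose (s - r + 1)) * (real n ^ (r - 1) / fact (r - 1)))
              \<in> o[at_top](\<lambda>n. real n ^ (r - 1)) \<and>
            (\<lambda>n. real (gen_turan r n (complete_r_graph r s) F)
                 - real (t choose (s - r + 1)) * (real n ^ (r - 1) / fact (r - 1)))
              \<in> o[at_top](\<lambda>n. real n ^ (r - 1))) \<and>
         (s \<ge> t + r \<longrightarrow>
            (\<lambda>n. real (gen_turan r n (complete_r_graph r s) F))
              \<in> o[at_top](\<lambda>n. real n ^ (r - 1)))"
proof -
  interpret lf: expanded_union r k p l ts Q
    by unfold_locales (use assms in auto)
  have F: "F = lf.F" unfolding lf.F_def assms(9) ..
  have t: "t = lf.t" unfolding lf.t_def assms(7) ..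
  have ts: "ts i \<ge> 1" if "i \<in> {1..p}" for i using assms(5) that by fastforce
  define c where "c = real (t choose (s - r + 1))"
  define H where "H = complete_r_graph r s"
  define g where "g n = gen_turan r n H F" for n
  define N where "N n = num_copies H (S_graph r n t)" for n
  define Free where "Free n = {G :: nat hypergraph. r_graph r G \<and> card (verts G) = n \<and> copies F G = {}}" for n
  have g: "g n = Max (num_copies H ` Free n)" for n
    unfolding g_def gen_turan_def Free_def by (rule arg_cong[of _ _ Max]) auto
  have nc: "num_copies H G = card (cliques r s G)" if "r_graph r G" for G :: "nat hypergraph"
    unfolding H_def using num_copies_complete[OF that] .
  have finV: "finite (verts G)" if "r_graph r G" for G :: "nat hypergraph"
    using that unfolding r_graph_def wf_hypergraph_def by blast
  \<comment> \<open>\<open>Free n\<close> itself need not be finite, as the vertices may be any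
    \<open>n\<close> numbers; the maximum exists because the counts are bounded.\<close>
  have "num_copies H ` Free n \<subseteq> {..n choose s}" for n
    using nc card_cliques_le_choose[OF finV] unfolding Free_def by auto
  then have fin: "finite (num_copies H ` Free n)" for n using finite_subset by blast
  have S: "S_graph r n t \<in> Free n" for n
    using r_graph_S_graph lf.S_graph_free[OF ts] unfolding Free_def F t by (simp add: S_graph_def)
  have N_le_g: "N n \<le> g n" for n
    unfolding g N_def using fin S by (intro Max_ge) auto
  have lower: "c * real ((n - t) choose (r - 1)) \<le> real (N n)" if "n \<ge> t" for n
  proof -
    have "(t choose (s - r + 1)) * ((n - t) choose (r - 1)) \<le> N n"
      unfolding N_def nc[OF r_graph_S_graph] using assms that by (intro card_cliques_S_graph) auto
    then show ?thesis unfolding c_def by (metis of_nat_le_iff of_nat_mult)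
  qed
  have upper: "\<forall>\<^sub>F n in at_top. real (g n) \<le> c * real (n choose (r - 1)) + \<epsilon> * real n ^ (r - 1)"
    if \<epsilon>: "\<epsilon> > 0" for \<epsilon> :: real
  proof -
    obtain n0 where n0: "\<forall>G :: nat hypergraph. r_graph r G \<longrightarrow> card (verts G) \<ge> n0 \<longrightarrow>
        \<not> embeds (edges G) lf.F UNIV \<longrightarrow> real (card (cliques r s G)) \<le>
        real (lf.t choose (s - r + 1)) * real (card (verts G) choose (r - 1)) + \<epsilon> * real (card (verts G)) ^ (r - 1)"
      using lf.card_cliques_le[OF \<epsilon> assms(6)] by (elim exE) (rule that)
    have "real (g n) \<le> c * real (n choose (r - 1)) + \<epsilon> * real n ^ (r - 1)" if n: "n \<ge> n0" for n
    proof -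
      have "g n \<in> num_copies H ` Free n" unfolding g using fin S by (intro Max_in) auto
      then obtain G where G: "G \<in> Free n" "g n = num_copies H G" by blast
      then have rG: "r_graph r G" "card (verts G) = n" "copies lf.F G = {}" unfolding Free_def F by auto
      have "\<not> embeds (edges G) lf.F UNIV"
      proof
        assume "embeds (edges G) lf.F UNIV"
        moreover have "\<And>e. e \<in> edges G \<Longrightarrow> e \<subseteq> verts G"
          using rG(1) unfolding r_graph_def wf_hypergraph_def by blast
        ultimately have "embeds (edges G) lf.F (verts G)"
          using embeds_no_isolated[OF lf.no_isolated_F[OF ts]] by blast
        then show False using rG(3) copies_nonempty_iff[OF lf.wf_F, of G] by blast
      qed
      then show ?thesis using n0[rule_format, OF rG(1)] rG(2) n unfolding G(2) nc[OF rG(1)] c_def t by simp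
    qed
    then show ?thesis by (auto simp: eventually_at_top_linorder)
  qed
  \<comment> \<open>The construction competes in the maximum, so the upper bound for
    \<open>g\<close> also bounds \<open>N\<close>, and one pair of bounds settles both.\<close>
  have oN: "(\<lambda>n. real (N n) - c * (real n ^ (r - 1) / fact (r - 1))) \<in> o[at_top](\<lambda>n. real n ^ (r - 1))"
  proof (rule smallo_of_bounds[where t = t])
    fix \<epsilon> :: real assume "\<epsilon> > 0"
    from upper[OF this] show "\<forall>\<^sub>F n in at_top. real (N n) \<le> c * real (n choose (r - 1)) + \<epsilon> * real n ^ (r - 1)"
    proof eventually_elim
      case (elim n)
      then show ?case using N_le_g[of n] by linarith
    qed
  qed (use lower in \<open>auto simp: c_def\<close>)
  have og: "(\<lambda>n. real (g n) - c * (real n ^ (r - 1) / fact (r - 1))) \<in> o[at_top](\<lambda>n. real n ^ (r - 1))"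
  proof (rule smallo_of_bounds[where t = t])
    fix n assume "n \<ge> t"
    then show "c * real ((n - t) choose (r - 1)) \<le> real (g n)" using lower[of n] N_le_g[of n] by linarith
  qed (use upper in \<open>auto simp: c_def\<close>)
  have equiv: "(\<lambda>n. real (g n)) \<sim>[at_top] (\<lambda>n. real (N n))" if s: "s \<le> t + r - 1"
  proof -
    \<comment> \<open>The range of \<open>s\<close> is exactly what makes the leading coefficient
      nonzero, and only then does the common error term yield asymptotic equivalence.\<close>
    have "s - r + 1 \<le> t" using s assms(1,6) by linarith
    then have c: "c \<noteq> 0" unfolding c_def by simp
    have eq: "(\<lambda>n. c * (real n ^ (r - 1) / fact (r - 1))) = (\<lambda>n. (c / fact (r - 1)) * real n ^ (r - 1))" by auto
    have "o[at_top](\<lambda>n. c * (real n ^ (r - 1) / fact (r - 1))) = o[at_top](\<lambda>n. real n ^ (r - 1))"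
      unfolding eq using c by (intro landau_o.small.cmult) auto
    then have "(\<lambda>n. real (g n)) \<sim>[at_top] (\<lambda>n. c * (real n ^ (r - 1) / fact (r - 1)))"
      "(\<lambda>n. real (N n)) \<sim>[at_top] (\<lambda>n. c * (real n ^ (r - 1) / fact (r - 1)))"
      using og oN by (auto simp: asymp_equiv_altdef)
    then show ?thesis using asymp_equiv_trans asymp_equiv_sym by blast
  qed
  have "(\<lambda>n. real (g n)) \<in> o[at_top](\<lambda>n. real n ^ (r - 1))" if "s \<ge> t + r"
  proof -
    have "c = 0" unfolding c_def using that assms(6) by (simp add: binomial_eq_0)
    then show ?thesis using og by simp
  qed
  then show ?thesis using equiv oN og unfolding g_def N_def H_def c_def by blast
qed

end
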